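(* Let $\bar\tau$ be a tree with dimensions $(n_\ell)_{\ell\in L(\bar\tau)}$ and ranks $(r_\tau)_{\tau\le\bar\tau}$, $r_{\bar\tau}=1$. Let $A(t)$, $t_0\le t\le t_1$, be a continuously differentiable time-dependent family of tree tensor networks on $\bar\tau$ of full tree rank $(r_\tau)_{\tau\le\bar\tau}$ (i.e. $A(t)\in\mathcal M_{\bar\tau}$ for all $t\in[t_0,t_1]$). For every subtree $\tau\le\bar\tau$, let $A_\tau(t)\in\mathcal V_\tau$ be the restricted tensor obtained from $A(t)$ by the restrictions associated with $Y^0_{\bar\tau}=A(t_0)$ (defined in the context), and suppose that the following non-degeneracy condition holds: $A_\tau(t_1)$ has full tree rank $(r_\sigma)_{\sigma\le\tau}$ for every subtree $\tau\le\bar\tau$. Then the recursive TTN integrator used with the same tree rank $(r_\tau)_{\tau\le\bar\tau}$ for $F(t,Y)=\dot A(t)$ is exact: starting from $Y^0=A(t_0)$, one time step from $t_0$ to $t_1$ yields $Y^1=A(t_1)$.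
   Context: **Tensor notation.** For a tensor $A$ with modes of dimensions $n_j$, $\mathrm{Mat}_i(A)\in\mathbb R^{n_i\times\prod_{j\ne i}n_j}$ is the $i$th matricization (its $k$th row lists, in a fixed co-lexicographic order, all entries of $A$ with $i$th index equal to $k$), and $\mathrm{Ten}_i$ is the inverse operation (for the appropriate dimensions). For a matrix $\mathbf M$, $A\times_i\mathbf M$ is defined by $\mathrm{Mat}_i(A\times_i \mathbf M)=\mathbf M\,\mathrm{Mat}_i(A)$, and $A\,\mathsf X_{i=1}^m\mathbf M_i:=A\times_1\mathbf M_1\cdots\times_m\mathbf M_m$. The multilinear rank of $A$ is the tuple of ranks of its matricizations. For tensors of order $m+1$ associated with a tree with $m$ direct subtrees the modes are numbered $0,1,\dots,m$. **Trees.** Given a finite set $\mathcal L$ of leaves, the set $\mathcal T$ of trees $\tau$ with leaf sets $L(\tau)\subseteq\mathcal L$ is defined recursively: each $\ell\in\mathcal L$ is a tree with $L(\ell)=\{\ell\}$; if $m\ge2$ and $\tau_1,\dots,\tau_m\in\mathcal T$ have pairwise disjoint leaf sets, then $\tau=(\tau_1,\dots,\tau_m)\in\mathcal T$ with $L(\tau)=\bigcup_iL(\tau_i)$; $\tau_1,\dots,\tau_m$ are its direct subtrees. The set $T(\tau)$ of subtrees is $T(\ell)=\{\ell\}$, $T(\tau)=\{\tau\}\cup\bigcup_iT(\tau_i)$. Write $\sigma\le\tau$ if $\sigma\in T(\tau)$, and $\sigma<\tau$ if moreover $\sigma\neq\tau$. Fix a tree $\bar\tau$ with $L(\bar\tau)=\mathcal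 L$. **Tree tensor networks (TTN).** To each leaf $\ell$ belong a dimension $n_\ell$ and a rank $r_\ell\le n_\ell$; to each other subtree $\tau\le\bar\tau$ a rank $r_\tau$; $r_{\bar\tau}=1$. For $\tau=(\tau_1,\dots,\tau_m)$ put $n_\tau=\prod_in_{\tau_i}$ and $\mathcal V_\tau=\mathbb R^{r_\tau\times n_{\tau_1}\times\dots\times n_{\tau_m}}$; for a leaf, $\mathcal V_\ell=\mathbb R^{r_\ell\times n_\ell}$ (with $\mathrm{Mat}_0,\mathrm{Ten}_0$ the identity). Given basis matrices $\mathbf U_\ell\in\mathbb R^{n_\ell\times r_\ell}$ of full rank $r_\ell$ and connection tensors $C_\sigma\in\mathbb R^{r_\sigma\times r_{\sigma_1}\times\dots\times r_{\sigma_m}}$ of full multilinear rank for $\sigma=(\sigma_1,\dots,\sigma_m)$, define recursively $X_\ell=\mathbf U_\ell^\top$, and $X_\sigma=C_\sigma\,\mathsf X_{i=1}^m\mathbf U_{\sigma_i}\in\mathcal V_\sigma$, $\mathbf U_\sigma=\mathrm{Mat}_0(X_\sigma)^\top\in\mathbb R^{n_\sigma\times r_\sigma}$. A tensor $X_\tau\in\mathcal V_\tau$ obtained this way is called a tree tensor network on $\tau$ of full tree rank $(r_\sigma)_{\sigma\le\tau}$; the set of these is $\mathcal M_\tau\subset\mathcal V_\tau$ (for a leaf: the $r_\ell\times n_\ell$ matrices of rank $r_\ell$). A representation is orthonormal if $\mathbf U_\sigma$ has orthonormal columns for all $\sigma<\tau$; every TTN has an orthonormal representation, and orthonormal representations are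 always used. Since $r_{\bar\tau}=1$, $\mathcal V_{\bar\tau}$ is identified with the full tensor space. **Prolongation and restriction.** Let $\tau=(\tau_1,\dots,\tau_m)$, $1\le i\le m$, and let $Y_\tau^0=C_\tau^0\,\mathsf X_{j=1}^m\mathbf U_{\tau_j}^0$ with $\mathbf U^0_{\tau_j}$ having orthonormal columns. Take a QR decomposition $\mathrm{Mat}_i(C_\tau^0)^\top=\mathbf Q_{\tau_i}^0\mathbf S_{\tau_i}^{0,\top}$, $\mathbf Q^0_{\tau_i}$ with $r_{\tau_i}$ orthonormal columns, $\mathbf S^0_{\tau_i}\in\mathbb R^{r_{\tau_i}\times r_{\tau_i}}$, and set $\mathbf V_{\tau_i}^0=\mathrm{Mat}_i\big(\mathrm{Ten}_i(\mathbf Q_{\tau_i}^{0,\top})\,\mathsf X_{j\ne i}\mathbf U_{\tau_j}^0\big)^\top$. The associated maps are $\pi_{\tau,i}(Y)=\mathrm{Ten}_i\big((\mathbf V_{\tau_i}^0\mathrm{Mat}_0(Y))^\top\big)\in\mathcal V_\tau$ for $Y\in\mathcal V_{\tau_i}$, and $\pi_{\tau,i}^\dagger(Z)=\mathrm{Ten}_0\big((\mathrm{Mat}_i(Z)\mathbf V_{\tau_i}^0)^\top\big)\in\mathcal V_{\tau_i}$ for $Z\in\mathcal V_\tau$. **Restricted tensors $A_\tau(t)$.** Put $Y^0_{\bar\tau}=A(t_0)$, $A_{\bar\tau}(t)=A(t)$ and, recursively from the root to the leaves, for $\tau=(\tau_1,\dots,\tau_m)\le\bar\tau$ and $i=1,\dots,m$: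 $Y_{\tau_i}^0=\pi_{\tau,i}^\dagger(Y_\tau^0)$, $A_{\tau_i}(t)=\pi_{\tau,i}^\dagger(A_\tau(t))$, where $\pi_{\tau,i}^\dagger$ is associated with $Y_\tau^0$. **Recursive TTN integrator.** One time step $t_0\to t_1$ for $\tau=(\tau_1,\dots,\tau_m)$, a function $F_\tau:[t_0,t_1]\times\mathcal V_\tau\to\mathcal V_\tau$ and a TTN $Y_\tau^0=C_\tau^0\,\mathsf X_{j}\mathbf U_{\tau_j}^0$ (with $\mathbf U_{\tau_j}^0=\mathrm{Mat}_0(X_{\tau_j}^0)^\top$ having orthonormal columns, $X^0_{\tau_j}$ TTNs in orthonormal factorized form): set $Y_\tau^{[0]}=Y_\tau^0$; for $i=1,\dots,m$ set $Y_\tau^{[i]}=\Phi_\tau^{(i)}(Y_\tau^{[i-1]})$; return $Y_\tau^1=\Psi_\tau(Y_\tau^{[m]})$. For the full tree $\bar\tau$ one takes $F_{\bar\tau}=F$, $Y^0_{\bar\tau}=Y^0$, and $Y^1=Y^1_{\bar\tau}$. All differential equations are solved exactly. *Subflow $\Phi_\tau^{(i)}$*, applied to an input again denoted $Y_\tau^0=C_\tau^0\,\mathsf X_j\mathbf U_{\tau_j}^0$: (1) keep $\mathbf U_{\tau_j}^1=\mathbf U_{\tau_j}^0$ for $j\ne i$. (2) Compute the QR decomposition $\mathrm{Mat}_i(C_\tau^0)^\top=\mathbf Q_{\tau_i}^0\mathbf S_{\tau_i}^{0,\top}$; let $\pi_{\tau,i},\pi_{\tau,i}^\dagger$ be the maps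 associated with this input and $F_{\tau_i}(t,\cdot)=\pi_{\tau,i}^\dagger\circ F_\tau(t,\cdot)\circ\pi_{\tau,i}$. (3) Set $Y_{\tau_i}^0=X_{\tau_i}^0\times_0\mathbf S_{\tau_i}^{0,\top}$. (4) If $\tau_i$ is a leaf, solve $\dot Y_{\tau_i}=F_{\tau_i}(t,Y_{\tau_i})$, $Y_{\tau_i}(t_0)=Y_{\tau_i}^0$, and set $Y_{\tau_i}^1=Y_{\tau_i}(t_1)$; otherwise let $Y_{\tau_i}^1$ be the result of the recursive TTN integrator applied to $(\tau_i,Y_{\tau_i}^0,F_{\tau_i},t_0,t_1)$. (5) If $\tau_i$ is not a leaf, compute the QR decomposition $\mathrm{Mat}_0(C_{\tau_i}^1)^\top=\widehat{\mathbf Q}_{\tau_i}^1\widehat{\mathbf S}_{\tau_i}^1$ of the connection tensor $C^1_{\tau_i}$ at the root of $Y_{\tau_i}^1$, let $X_{\tau_i}^1$ be $Y_{\tau_i}^1$ with this connection tensor replaced by $\mathrm{Ten}_0(\widehat{\mathbf Q}_{\tau_i}^{1,\top})$, and $\mathbf U_{\tau_i}^1=\mathrm{Mat}_0(X_{\tau_i}^1)^\top$; if $\tau_i$ is a leaf, compute the QR decomposition $(Y_{\tau_i}^1)^\top=\mathbf U_{\tau_i}^1\widehat{\mathbf S}_{\tau_i}^1$ and set $X_{\tau_i}^1=\mathbf U_{\tau_i}^{1,\top}$. (6) Solve the $r_{\tau_i}\times r_{\tau_i}$ equation $\dot{\mathbf S}(t)=-\mathbf U_{\tau_i}^{1,\top}\mathrm{Mat}_0\big(F_{\tau_i}(t,X_{\tau_i}^1\times_0\mathbf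 S(t)^\top)\big)^\top$, $\mathbf S(t_0)=\widehat{\mathbf S}_{\tau_i}^1$, and put $\widetilde{\mathbf S}_{\tau_i}^0=\mathbf S(t_1)$. (7) Return $C_\tau^1\,\mathsf X_j\mathbf U_{\tau_j}^1$ with $C_\tau^1=\mathrm{Ten}_i(\widetilde{\mathbf S}_{\tau_i}^0\mathbf Q_{\tau_i}^{0,\top})$. *Subflow $\Psi_\tau$*, applied to $C_\tau^0\,\mathsf X_j\mathbf U_{\tau_j}$: solve $\dot C(t)=F_\tau\big(t,C(t)\,\mathsf X_j\mathbf U_{\tau_j}\big)\,\mathsf X_j\mathbf U_{\tau_j}^\top$, $C(t_0)=C_\tau^0$, and return $C(t_1)\,\mathsf X_j\mathbf U_{\tau_j}$. *)

theory Defs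
  imports Complex_Main "Jordan_Normal_Form.DL_Rank"
begin

section \<open>Tensors\<close>

text \<open>
  A tensor is its list of mode dimensions together with its entries.  Modes are numbered from 0.
  Elements of \<open>tensor_space ds\<close> have entry 0 at every index outside the box, so that equality of
  such tensors is entrywise equality.
\<close>

datatype tensor = Tensor (tdims: "nat list") (tentry: "nat list \<Rightarrow> real")

definition indices :: "nat list \<Rightarrow> nat list set" where
  "indices ds = {ks. list_all2 (<) ks ds}"

definition mk_tensor :: "nat list \<Rightarrow> (nat list \<Rightarrow> real) \<Rightarrow> tensor" where
  "mk_tensor ds f = Tensor ds (\<lambda>ks. if ks \<in> indices ds then f ks else 0)"

definition tensor_space :: "nat list \<Rightarrow> tensor set" where
  "tensor_space ds = {A. tdims A = ds \<and> (\<forall>ks. ks \<notin> indices ds \<longrightarrow> tentry A ks = 0)}"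

definition del_nth :: "nat \<Rightarrow> 'a list \<Rightarrow> 'a list" where
  "del_nth i xs = take i xs @ drop (Suc i) xs"

definition ins_nth :: "nat \<Rightarrow> 'a \<Rightarrow> 'a list \<Rightarrow> 'a list" where
  "ins_nth i x xs = take i xs @ x # drop i xs"

text \<open>Co-lexicographic numbering of multi-indices (the first index varies fastest).\<close>

fun colex :: "nat list \<Rightarrow> nat list \<Rightarrow> nat" where
  "colex (d # ds) (k # ks) = k + d * colex ds ks"
| "colex _ _ = 0"

fun uncolex :: "nat list \<Rightarrow> nat \<Rightarrow> nat list" where
  "uncolex [] c = []"
| "uncolex (d # ds) c = (c mod d) # uncolex ds (c div d)"

definition Mat :: "nat \<Rightarrow> tensor \<Rightarrow> real mat" where
  "Mat i A = mat (tdims A ! i) (prod_list (del_nth i (tdims A)))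
     (\<lambda>(k, c). tentry A (ins_nth i k (uncolex (del_nth i (tdims A)) c)))"

text \<open>The inverse of \<open>Mat i\<close>; \<open>ds\<close> are the dimensions of the resulting tensor.\<close>

definition Ten :: "nat \<Rightarrow> nat list \<Rightarrow> real mat \<Rightarrow> tensor" where
  "Ten i ds M = mk_tensor ds (\<lambda>ks. M $$ (ks ! i, colex (del_nth i ds) (del_nth i ks)))"

definition mode_prod :: "tensor \<Rightarrow> nat \<Rightarrow> real mat \<Rightarrow> tensor" where
  "mode_prod A i M = Ten i ((tdims A)[i := dim_row M]) (M * Mat i A)"

text \<open>
  Subtrees and their basis matrices are kept in lists and hence counted from 0, while mode 0 of a
  tensor is the additional mode: subtree \<open>j\<close> belongs to mode \<open>Suc j\<close>.
\<close>

definition multi_prod :: "tensor \<Rightarrow> nat list \<Rightarrow> (nat \<Rightarrow> real mat) \<Rightarrow> tensor" where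
  "multi_prod A js M = fold (\<lambda>j B. mode_prod B (Suc j) (M j)) js A"

abbreviation mat_rank :: "real mat \<Rightarrow> nat" where
  "mat_rank M \<equiv> vec_space.rank (dim_row M) M"

definition full_multilinear_rank :: "tensor \<Rightarrow> bool" where
  "full_multilinear_rank A \<longleftrightarrow> (\<forall>i < length (tdims A). mat_rank (Mat i A) = tdims A ! i)"

definition orthonormal_cols :: "real mat \<Rightarrow> bool" where
  "orthonormal_cols M \<longleftrightarrow> transpose_mat M * M = 1\<^sub>m (dim_col M)"

text \<open>
  QR decompositions are not unique; every construction below that computes one is a relation
  admitting all of them.
\<close>

definition is_QR :: "real mat \<Rightarrow> real mat \<Rightarrow> real mat \<Rightarrow> bool" where
  "is_QR M Q R \<longleftrightarrow> Q \<in> carrier_mat (dim_row M) (dim_col M)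
     \<and> R \<in> carrier_mat (dim_col M) (dim_col M)
     \<and> M = Q * R \<and> orthonormal_cols Q \<and> upper_triangular R"


section \<open>Differentiation and differential equations\<close>

definition tensor_has_derivative :: "(real \<Rightarrow> tensor) \<Rightarrow> tensor \<Rightarrow> nat list \<Rightarrow> real filter \<Rightarrow> bool" where
  "tensor_has_derivative Y D ds net \<longleftrightarrow>
     (\<forall>ks \<in> indices ds. ((\<lambda>t. tentry (Y t) ks) has_real_derivative tentry D ks) net)"

definition tensor_C1 :: "nat list \<Rightarrow> real \<Rightarrow> real \<Rightarrow> (real \<Rightarrow> tensor) \<Rightarrow> (real \<Rightarrow> tensor) \<Rightarrow> bool" where
  "tensor_C1 ds t\<^sub>0 t\<^sub>1 A A' \<longleftrightarrow>
     (\<forall>t \<in> {t\<^sub>0..t\<^sub>1}. A t \<in> tensor_space ds \<and> A' t \<in> tensor_space ds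
        \<and> tensor_has_derivative A (A' t) ds (at t within {t\<^sub>0..t\<^sub>1}))
     \<and> (\<forall>ks \<in> indices ds. continuous_on {t\<^sub>0..t\<^sub>1} (\<lambda>t. tentry (A' t) ks))"

definition solves_tensor_ode ::
  "nat list \<Rightarrow> (real \<Rightarrow> tensor \<Rightarrow> tensor) \<Rightarrow> real \<Rightarrow> real \<Rightarrow> tensor \<Rightarrow> (real \<Rightarrow> tensor) \<Rightarrow> bool" where
  "solves_tensor_ode ds F t\<^sub>0 t\<^sub>1 Y\<^sub>0 Y \<longleftrightarrow> Y t\<^sub>0 = Y\<^sub>0
     \<and> (\<forall>t \<in> {t\<^sub>0..t\<^sub>1}. Y t \<in> tensor_space ds
          \<and> tensor_has_derivative Y (F t (Y t)) ds (at t within {t\<^sub>0..t\<^sub>1}))"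

definition solves_mat_ode ::
  "nat \<Rightarrow> (real \<Rightarrow> real mat \<Rightarrow> real mat) \<Rightarrow> real \<Rightarrow> real \<Rightarrow> real mat \<Rightarrow> (real \<Rightarrow> real mat) \<Rightarrow> bool" where
  "solves_mat_ode k G t\<^sub>0 t\<^sub>1 S\<^sub>0 S \<longleftrightarrow> S t\<^sub>0 = S\<^sub>0
     \<and> (\<forall>t \<in> {t\<^sub>0..t\<^sub>1}. S t \<in> carrier_mat k k
          \<and> (\<forall>a < k. \<forall>b < k. ((\<lambda>s. S s $$ (a, b)) has_real_derivative G t (S t) $$ (a, b))
                (at t within {t\<^sub>0..t\<^sub>1})))"


section \<open>Trees\<close>

datatype 'l ttree = Leaf 'l | Node "'l ttree list"

fun leaves :: "'l ttree \<Rightarrow> 'l set" where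
  "leaves (Leaf l) = {l}"
| "leaves (Node ts) = (\<Union>t \<in> set ts. leaves t)"

fun subtrees :: "'l ttree \<Rightarrow> 'l ttree set" where
  "subtrees (Leaf l) = {Leaf l}"
| "subtrees (Node ts) = insert (Node ts) (\<Union>t \<in> set ts. subtrees t)"

fun valid_tree :: "'l ttree \<Rightarrow> bool" where
  "valid_tree (Leaf l) \<longleftrightarrow> True"
| "valid_tree (Node ts) \<longleftrightarrow> 2 \<le> length ts \<and> (\<forall>t \<in> set ts. valid_tree t)
     \<and> (\<forall>i < length ts. \<forall>j < length ts. i \<noteq> j \<longrightarrow> leaves (ts ! i) \<inter> leaves (ts ! j) = {})"

text \<open>\<open>n\<close> gives the dimensions of the leaves and \<open>r\<close> the ranks of the subtrees.\<close>

fun tree_dim :: "('l \<Rightarrow> nat) \<Rightarrow> 'l ttree \<Rightarrow> nat" where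
  "tree_dim n (Leaf l) = n l"
| "tree_dim n (Node ts) = prod_list (map (tree_dim n) ts)"

text \<open>
  The mode dimensions of the space \<open>\<V>\<^sub>\<tau>\<close>.  At a leaf its elements are tensors of order 2, for which
  \<open>Mat 0\<close> is the identification with matrices.
\<close>

fun vdims :: "('l \<Rightarrow> nat) \<Rightarrow> ('l ttree \<Rightarrow> nat) \<Rightarrow> 'l ttree \<Rightarrow> nat list" where
  "vdims n r (Leaf l) = [r (Leaf l), n l]"
| "vdims n r (Node ts) = r (Node ts) # map (tree_dim n) ts"


section \<open>Tree tensor networks\<close>

text \<open>Factorized form: basis matrices at the leaves, connection tensors at the other nodes.\<close>

datatype ttn = TLeaf "real mat" | TNode tensor "ttn list"

fun ttn_tensor :: "ttn \<Rightarrow> tensor" where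
  "ttn_tensor (TLeaf U) = Ten 0 [dim_col U, dim_row U] (transpose_mat U)"
| "ttn_tensor (TNode C xs) =
     multi_prod C [0..<length xs] (\<lambda>j. map (\<lambda>x. transpose_mat (Mat 0 (ttn_tensor x))) xs ! j)"

definition basis_mat :: "ttn \<Rightarrow> real mat" where
  "basis_mat x = transpose_mat (Mat 0 (ttn_tensor x))"

inductive full_rank_ttn :: "('l \<Rightarrow> nat) \<Rightarrow> ('l ttree \<Rightarrow> nat) \<Rightarrow> 'l ttree \<Rightarrow> ttn \<Rightarrow> bool"
  for n :: "'l \<Rightarrow> nat" and r :: "'l ttree \<Rightarrow> nat" where
  "U \<in> carrier_mat (n l) (r (Leaf l)) \<Longrightarrow> mat_rank U = r (Leaf l)
    \<Longrightarrow> full_rank_ttn n r (Leaf l) (TLeaf U)"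
| "C \<in> tensor_space (r (Node ts) # map r ts) \<Longrightarrow> full_multilinear_rank C
    \<Longrightarrow> list_all2 (full_rank_ttn n r) ts xs
    \<Longrightarrow> full_rank_ttn n r (Node ts) (TNode C xs)"

definition ttn_manifold :: "('l \<Rightarrow> nat) \<Rightarrow> ('l ttree \<Rightarrow> nat) \<Rightarrow> 'l ttree \<Rightarrow> tensor set" where
  "ttn_manifold n r \<tau> = {ttn_tensor x | x. full_rank_ttn n r \<tau> x}"

fun orthonormal_ttn :: "ttn \<Rightarrow> bool" where
  "orthonormal_ttn (TLeaf U) \<longleftrightarrow> True"
| "orthonormal_ttn (TNode C xs) \<longleftrightarrow> (\<forall>x \<in> set xs. orthonormal_cols (basis_mat x) \<and> orthonormal_ttn x)"

definition orthonormal_rep ::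
  "('l \<Rightarrow> nat) \<Rightarrow> ('l ttree \<Rightarrow> nat) \<Rightarrow> 'l ttree \<Rightarrow> ttn \<Rightarrow> tensor \<Rightarrow> bool" where
  "orthonormal_rep n r \<tau> x X \<longleftrightarrow> full_rank_ttn n r \<tau> x \<and> orthonormal_ttn x \<and> ttn_tensor x = X"


section \<open>Prolongation and restriction\<close>

text \<open>The matrix \<open>V\<^sup>0\<close> of subtree \<open>i\<close> of the network \<open>TNode C xs\<close>; \<open>Q\<close> is the QR factor.\<close>

definition frame_mat :: "tensor \<Rightarrow> ttn list \<Rightarrow> nat \<Rightarrow> real mat \<Rightarrow> real mat" where
  "frame_mat C xs i Q = transpose_mat (Mat (Suc i)
     (multi_prod (Ten (Suc i) (tdims C) (transpose_mat Q))
        (filter (\<lambda>j. j \<noteq> i) [0..<length xs]) (\<lambda>j. basis_mat (xs ! j))))"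

definition prolong ::
  "('l \<Rightarrow> nat) \<Rightarrow> ('l ttree \<Rightarrow> nat) \<Rightarrow> 'l ttree list \<Rightarrow> nat \<Rightarrow> real mat \<Rightarrow> tensor \<Rightarrow> tensor" where
  "prolong n r ts i V Y = Ten (Suc i) (vdims n r (Node ts)) (transpose_mat (V * Mat 0 Y))"

definition restr ::
  "('l \<Rightarrow> nat) \<Rightarrow> ('l ttree \<Rightarrow> nat) \<Rightarrow> 'l ttree list \<Rightarrow> nat \<Rightarrow> real mat \<Rightarrow> tensor \<Rightarrow> tensor" where
  "restr n r ts i V Z = Ten 0 (vdims n r (ts ! i)) (transpose_mat (Mat (Suc i) Z * V))"

text \<open>
  \<open>Ar \<tau> t\<close> are the restricted tensors of \<open>A\<close>.  \<open>Y0 \<tau>\<close> is an orthonormal factorized form of the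
  restricted initial value, from which the restriction maps to the direct subtrees of \<open>\<tau>\<close> are built.
\<close>

definition restricted_tensors ::
  "('l \<Rightarrow> nat) \<Rightarrow> ('l ttree \<Rightarrow> nat) \<Rightarrow> 'l ttree \<Rightarrow> real \<Rightarrow> real \<Rightarrow> (real \<Rightarrow> tensor)
    \<Rightarrow> ('l ttree \<Rightarrow> ttn) \<Rightarrow> ('l ttree \<Rightarrow> real \<Rightarrow> tensor) \<Rightarrow> bool" where
  "restricted_tensors n r \<tau>\<^sub>r t\<^sub>0 t\<^sub>1 A Y0 Ar \<longleftrightarrow>
     orthonormal_rep n r \<tau>\<^sub>r (Y0 \<tau>\<^sub>r) (A t\<^sub>0)
     \<and> (\<forall>t \<in> {t\<^sub>0..t\<^sub>1}. Ar \<tau>\<^sub>r t = A t)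
     \<and> (\<forall>ts i. Node ts \<in> subtrees \<tau>\<^sub>r \<and> i < length ts \<longrightarrow>
          (\<exists>C xs Q S. Y0 (Node ts) = TNode C xs
             \<and> is_QR (transpose_mat (Mat (Suc i) C)) Q (transpose_mat S)
             \<and> orthonormal_rep n r (ts ! i) (Y0 (ts ! i))
                 (restr n r ts i (frame_mat C xs i Q) (ttn_tensor (Y0 (Node ts))))
             \<and> (\<forall>t \<in> {t\<^sub>0..t\<^sub>1}. Ar (ts ! i) t = restr n r ts i (frame_mat C xs i Q) (Ar (Node ts) t))))"


section \<open>The recursive TTN integrator\<close>

text \<open>The network representing \<open>mode_prod (ttn_tensor x) 0 M\<close>: only its root is changed.\<close>

fun root_prod :: "ttn \<Rightarrow> real mat \<Rightarrow> ttn" where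
  "root_prod (TLeaf U) M = TLeaf (U * transpose_mat M)"
| "root_prod (TNode C xs) M = TNode (mode_prod C 0 M) xs"

text \<open>Orthonormalization at the root: the network \<open>y\<close> is split into \<open>x\<close> and the factor \<open>R\<close>.\<close>

fun root_QR :: "ttn \<Rightarrow> ttn \<Rightarrow> real mat \<Rightarrow> bool" where
  "root_QR (TLeaf U) x R \<longleftrightarrow> (\<exists>Q. is_QR U Q R \<and> x = TLeaf Q)"
| "root_QR (TNode C ys) x R \<longleftrightarrow>
     (\<exists>Q. is_QR (transpose_mat (Mat 0 C)) Q R \<and> x = TNode (Ten 0 (tdims C) (transpose_mat Q)) ys)"

text \<open>The subflow \<open>\<Psi>\<^sub>\<tau>\<close> for \<open>\<tau> = Node ts\<close>.\<close>

inductive ttn_psi :: "('l ttree \<Rightarrow> nat) \<Rightarrow> real \<Rightarrow> real \<Rightarrow> 'l ttree list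
    \<Rightarrow> (real \<Rightarrow> tensor \<Rightarrow> tensor) \<Rightarrow> ttn \<Rightarrow> ttn \<Rightarrow> bool"
  for r :: "'l ttree \<Rightarrow> nat" and t\<^sub>0 t\<^sub>1 :: real where
  "solves_tensor_ode (r (Node ts) # map r ts)
     (\<lambda>t B. multi_prod (F t (multi_prod B [0..<length xs] (\<lambda>j. basis_mat (xs ! j))))
              [0..<length xs] (\<lambda>j. transpose_mat (basis_mat (xs ! j))))
     t\<^sub>0 t\<^sub>1 C\<^sub>0 C
   \<Longrightarrow> ttn_psi r t\<^sub>0 t\<^sub>1 ts F (TNode C\<^sub>0 xs) (TNode (C t\<^sub>1) xs)"

text \<open>
  \<open>ttn_step n r t\<^sub>0 t\<^sub>1 \<tau> F y y'\<close>: one time step of the integrator on \<open>\<tau>\<close> may take \<open>y\<close> to \<open>y'\<close>;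
  \<open>ttn_phi n r t\<^sub>0 t\<^sub>1 ts i F y y'\<close>: the subflow \<open>\<Phi>\<close> of subtree \<open>i\<close> of \<open>Node ts\<close> may take \<open>y\<close> to \<open>y'\<close>.
  On a leaf, a time step is the exact solution of the differential equation, with which the
  recursion ends.
\<close>

inductive
  ttn_step :: "('l \<Rightarrow> nat) \<Rightarrow> ('l ttree \<Rightarrow> nat) \<Rightarrow> real \<Rightarrow> real \<Rightarrow> 'l ttree
    \<Rightarrow> (real \<Rightarrow> tensor \<Rightarrow> tensor) \<Rightarrow> ttn \<Rightarrow> ttn \<Rightarrow> bool" and
  ttn_phi :: "('l \<Rightarrow> nat) \<Rightarrow> ('l ttree \<Rightarrow> nat) \<Rightarrow> real \<Rightarrow> real \<Rightarrow> 'l ttree list \<Rightarrow> nat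
    \<Rightarrow> (real \<Rightarrow> tensor \<Rightarrow> tensor) \<Rightarrow> ttn \<Rightarrow> ttn \<Rightarrow> bool"
  for n :: "'l \<Rightarrow> nat" and r :: "'l ttree \<Rightarrow> nat" and t\<^sub>0 t\<^sub>1 :: real where
  step_leaf:
  "solves_tensor_ode (vdims n r (Leaf l)) F t\<^sub>0 t\<^sub>1 (ttn_tensor (TLeaf U)) Y
   \<Longrightarrow> ttn_step n r t\<^sub>0 t\<^sub>1 (Leaf l) F (TLeaf U) (TLeaf (transpose_mat (Mat 0 (Y t\<^sub>1))))"
| step_node:
  "(\<forall>i < length ts. ttn_phi n r t\<^sub>0 t\<^sub>1 ts i F (Y i) (Y (Suc i)))
   \<Longrightarrow> ttn_psi r t\<^sub>0 t\<^sub>1 ts F (Y (length ts)) Y\<^sub>1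
   \<Longrightarrow> ttn_step n r t\<^sub>0 t\<^sub>1 (Node ts) F (Y 0) Y\<^sub>1"
| phi:
  "is_QR (transpose_mat (Mat (Suc i) C)) Q (transpose_mat S\<^sub>0)
   \<Longrightarrow> V = frame_mat C xs i Q
   \<Longrightarrow> F\<^sub>i = (\<lambda>t. restr n r ts i V \<circ> F t \<circ> prolong n r ts i V)
   \<Longrightarrow> ttn_step n r t\<^sub>0 t\<^sub>1 (ts ! i) F\<^sub>i (root_prod (xs ! i) (transpose_mat S\<^sub>0)) y
   \<Longrightarrow> root_QR y x S\<^sub>1
   \<Longrightarrow> solves_mat_ode (r (ts ! i))
         (\<lambda>t S. - (transpose_mat (basis_mat x)
                    * transpose_mat (Mat 0 (F\<^sub>i t (mode_prod (ttn_tensor x) 0 (transpose_mat S))))))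
         t\<^sub>0 t\<^sub>1 S\<^sub>1 S
   \<Longrightarrow> ttn_phi n r t\<^sub>0 t\<^sub>1 ts i F (TNode C xs)
         (TNode (Ten (Suc i) (tdims C) (S t\<^sub>1 * transpose_mat Q)) (xs[i := x]))"

end

theory Submission
  imports Defs
begin

text \<open>
  Let \<open>X = A(t\<^sub>1)\<close> and \<open>Y = A(t\<^sub>0)\<close> at a node.  As the vector field does not depend on the solution, every
  differential equation of the integrator just adds an increment of a linear image of \<open>A\<close>.  By induction on the tree,
  the recursive call for subtree \<open>i\<close> returns \<open>Mat\<^sub>i(X) V\<^sub>i\<close> exactly; the subsequent step for the square factor then
  turns the current value \<open>Y'\<close> into \<open>Y' \<times>\<^sub>i P\<^sub>i\<close>, where \<open>P\<^sub>i\<close> projects onto the range of \<open>Mat\<^sub>i(X) V\<^sub>i\<close>, which is the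
  whole range of \<open>Mat\<^sub>i(X)\<close> by nondegeneracy and \<open>rank Mat\<^sub>i(X) \<le> r\<^sub>i\<close>.  After all subflows the core is
  \<open>Y\<close> contracted with the new bases, and the last flow replaces it by \<open>X\<close> contracted with them, so that the result is
  \<open>X\<close> projected in every mode, which is \<open>X\<close>.

  The frames \<open>V\<^sub>i\<close> of the intermediate networks differ from those in the nondegeneracy assumption, and so do the
  restrictions of \<open>A\<close>.  What they have in common is the contraction \<open>Mat\<^sub>0(X\<^sub>i)\<^sup>T Mat\<^sub>0(Y\<^sub>i) = Mat\<^sub>i(X) Mat\<^sub>i(Y)\<^sup>T\<close>
  of the two restricted end points, since \<open>V\<^sub>i\<close> spans the row space of the current value and \<open>X\<close> is fixed by the
  projections applied so far.  The contraction determines those of all further restrictions and transfers full rank.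
\<close>

section \<open>Indices, matricizations and mode products\<close>

text \<open>The obstacle is that path and network part company: after some subflows the network
  carries the projected value \<open>Y'\<close>, while the equations still integrate increments of
  \<open>A\<close>, which starts at \<open>Y\<close>. They agree where it matters. The tensor behind
  \<open>V\<close> is built from the current bases and hence fixed by every projection applied so
  far, so \<open>Y\<close> and \<open>Y'\<close> have the same restriction and the recursive call
  starts on its path. This also explains the projection: if the child returns
  \<open>Mat_i(X) V = U R\<close> with \<open>U\<close> the new basis, the equation with the minus
  sign starts at \<open>R\<close> and subtracts \<open>R - U^T Mat_i(Y') V\<close>, and
  \<open>U^T Mat_i(Y') V\<close> remains. Full rank of the intermediate networks is recovered, not
  assumed: a product of rank \<open>r\<close> forces rank \<open>r\<close> on both factors of every
  factorization through dimension \<open>r\<close>, and the contraction of the end points is such a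
  product. The same argument makes the cores left invertible, so that QR decompositions exist. As
  the integrator is a relation, existence of a run has to be proved along with its
  exactness.\<close>

lemma indices_iff: "ks \<in> indices ds \<longleftrightarrow> length ks = length ds \<and> (\<forall>i < length ds. ks ! i < ds ! i)"
  by (auto simp: indices_def list_all2_conv_all_nth)

lemma indices_length: "ks \<in> indices ds \<Longrightarrow> length ks = length ds"
  by (simp add: indices_iff)

lemma indices_Cons: "k # ks \<in> indices (d # ds) \<longleftrightarrow> k < d \<and> ks \<in> indices ds"
  by (simp add: indices_def)

lemma colex_less: "ks \<in> indices ds \<Longrightarrow> colex ds ks < prod_list ds"
proof (induction ds ks rule: colex.induct)
  case (1 d ds k ks)
  then have k: "k < d" and c: "colex ds ks < prod_list ds"
    by (auto simp: indices_Cons)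
  have "k + d * colex ds ks < d + d * colex ds ks"
    using k by simp
  also have "\<dots> = d * Suc (colex ds ks)"
    by simp
  also have "\<dots> \<le> d * prod_list ds"
    using c by (intro mult_le_mono2) simp
  finally show ?case
    by simp
qed (auto simp: indices_iff)

lemma uncolex_colex: "ks \<in> indices ds \<Longrightarrow> uncolex ds (colex ds ks) = ks"
  by (induction ds ks rule: colex.induct) (auto simp: indices_Cons, auto simp: indices_def)

lemma uncolex_indices: "c < prod_list ds \<Longrightarrow> uncolex ds c \<in> indices ds"
proof (induction ds arbitrary: c)
  case (Cons d ds)
  then have "0 < d"
    by (auto intro: gr0I)
  with Cons show ?case
    by (simp add: indices_Cons less_mult_imp_div_less mult.commute)
qed (simp add: indices_iff)

lemma colex_uncolex: "c < prod_list ds \<Longrightarrow> colex ds (uncolex ds c) = c"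
proof (induction ds arbitrary: c)
  case (Cons d ds)
  then show ?case
    by (simp add: less_mult_imp_div_less mult.commute)
qed simp

lemma length_del_nth: "i < length xs \<Longrightarrow> length (del_nth i xs) = length xs - 1"
  by (auto simp: del_nth_def)

lemma del_nth_0 [simp]: "del_nth 0 (x # xs) = xs"
  by (simp add: del_nth_def)

lemma del_ins_nth: "i \<le> length xs \<Longrightarrow> del_nth i (ins_nth i x xs) = xs"
  by (simp add: del_nth_def ins_nth_def min_def)

lemma ins_del_nth: "i < length xs \<Longrightarrow> ins_nth i (xs ! i) (del_nth i xs) = xs"
  by (simp add: del_nth_def ins_nth_def min_def id_take_nth_drop[symmetric])

lemma nth_ins_nth: "i \<le> length xs \<Longrightarrow> ins_nth i x xs ! i = x"
  by (simp add: ins_nth_def nth_append min_def)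

lemma ins_nth_update: "i \<le> length xs \<Longrightarrow> (ins_nth i x xs)[i := y] = ins_nth i y xs"
  by (simp add: ins_nth_def list_update_append min_def)

lemma del_nth_update: "i < length xs \<Longrightarrow> del_nth i (xs[i := y]) = del_nth i xs"
  by (simp add: del_nth_def)

lemma del_nth_indices:
  assumes "ks \<in> indices ds" "i < length ds"
  shows "del_nth i ks \<in> indices (del_nth i ds)"
  using assms unfolding indices_def del_nth_def
  by (auto intro!: list_all2_appendI list_all2_takeI list_all2_dropI)

lemma ins_nth_indices:
  assumes "ks \<in> indices (del_nth i ds)" "i < length ds" "k < ds ! i"
  shows "ins_nth i k ks \<in> indices ds"
proof -
  have l: "length ks = length (del_nth i ds)"
    using assms by (simp add: indices_length)
  have "list_all2 (<) ks (take i ds @ drop (Suc i) ds)"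
    using assms by (simp add: indices_def del_nth_def)
  from list_all2_takeI[OF this, of i] list_all2_dropI[OF this, of i]
  have "list_all2 (<) (take i ks) (take i ds)" "list_all2 (<) (drop i ks) (drop (Suc i) ds)"
    using assms by auto
  then have "list_all2 (<) (take i ks @ k # drop i ks) (take i ds @ ds ! i # drop (Suc i) ds)"
    using assms by (intro list_all2_appendI) auto
  then show ?thesis
    using assms by (simp add: indices_def ins_nth_def id_take_nth_drop[symmetric])
qed

lemma indices_update:
  assumes "ks \<in> indices (ds[j := d'])" "j < length ds" "k < d"
  shows "ks[j := k] \<in> indices (ds[j := d])"
  using assms by (auto simp: indices_iff nth_list_update)

lemma indices_update_same:
  assumes "ks \<in> indices (ds[j := d'])" "j < length ds" "k < ds ! j"
  shows "ks[j := k] \<in> indices ds"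
  using indices_update[OF assms(1,2,3)] by simp

lemma finite_indices [simp]: "finite (indices ds)"
proof (induction ds)
  case (Cons d ds)
  have "indices (d # ds) = (\<lambda>(k, ks). k # ks) ` ({..<d} \<times> indices ds)"
    by (force simp: indices_Cons image_iff indices_def list_all2_Cons2)
  with Cons show ?case
    by simp
qed (simp add: indices_def)

text \<open>Columns of \<open>Mat i\<close> are numbered by multi-indices with mode \<open>i\<close>
  deleted. The box \<open>ds[i := 1]\<close> keeps that mode as a dummy position with index 0
  instead, so that all lists keep their length and updates in different modes commute.\<close>

lemma sum_uncolex_ins:
  assumes "i < length ds"
  shows "(\<Sum>c < prod_list (del_nth i ds). f (ins_nth i k (uncolex (del_nth i ds) c)))
       = (\<Sum>ks \<in> indices (ds[i := 1]). f (ks[i := k]))"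
proof (rule sum.reindex_bij_witness[where i = "\<lambda>ks. colex (del_nth i ds) (del_nth i ks)"
      and j = "\<lambda>c. ins_nth i 0 (uncolex (del_nth i ds) c)"])
  fix c assume "c \<in> {..<prod_list (del_nth i ds)}"
  then have u: "uncolex (del_nth i ds) c \<in> indices (del_nth i ds)" "c < prod_list (del_nth i ds)"
    by (auto simp: uncolex_indices)
  then have l: "i \<le> length (uncolex (del_nth i ds) c)"
    using assms by (simp add: indices_length length_del_nth)
  show "colex (del_nth i ds) (del_nth i (ins_nth i 0 (uncolex (del_nth i ds) c))) = c"
    using l u by (simp add: del_ins_nth colex_uncolex)
  show "ins_nth i 0 (uncolex (del_nth i ds) c) \<in> indices (ds[i := 1])"
    using u assms by (intro ins_nth_indices) (auto simp: del_nth_update)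
  show "f ((ins_nth i 0 (uncolex (del_nth i ds) c))[i := k]) = f (ins_nth i k (uncolex (del_nth i ds) c))"
    using l by (simp add: ins_nth_update)
next
  fix ks assume ks: "ks \<in> indices (ds[i := 1])"
  then have d: "del_nth i ks \<in> indices (del_nth i ds)"
    using del_nth_indices[OF ks, of i] assms by (simp add: del_nth_update)
  have "ks ! i = 0" "i < length ks"
    using ks assms by (auto simp: indices_iff)
  then show "ins_nth i 0 (uncolex (del_nth i ds) (colex (del_nth i ds) (del_nth i ks))) = ks"
    using d ins_del_nth[of i ks] by (simp add: uncolex_colex)
  show "colex (del_nth i ds) (del_nth i ks) \<in> {..<prod_list (del_nth i ds)}"
    using d by (simp add: colex_less)
qed

text \<open>Fubini for one mode, which stays in the index as a dummy position.\<close>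

lemma sum_indices_split:
  assumes "j < length ds"
  shows "(\<Sum>ks \<in> indices ds. f ks) = (\<Sum>ks \<in> indices (ds[j := 1]). \<Sum>l < ds ! j. f (ks[j := l]))"
proof -
  have "(\<Sum>ks \<in> indices (ds[j := 1]). \<Sum>l < ds ! j. f (ks[j := l]))
      = (\<Sum>(ks, l) \<in> indices (ds[j := 1]) \<times> {..<ds ! j}. f (ks[j := l]))"
    by (simp add: sum.cartesian_product)
  also have "\<dots> = (\<Sum>ks \<in> indices ds. f ks)"
    by (rule sum.reindex_bij_witness[where j = "\<lambda>(ks, l). ks[j := l]" and i = "\<lambda>ks. (ks[j := 0], ks ! j)"])
      (use assms in \<open>auto simp: indices_iff nth_list_update list_update_same_conv split: if_splits\<close>)
  finally show ?thesis ..
qed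

section \<open>Tensors and their matricizations\<close>

lemma tensor_space_dims: "A \<in> tensor_space ds \<Longrightarrow> tdims A = ds"
  by (simp add: tensor_space_def)

lemma tensor_eqI:
  assumes "A \<in> tensor_space ds" "B \<in> tensor_space ds"
    and "\<And>ks. ks \<in> indices ds \<Longrightarrow> tentry A ks = tentry B ks"
  shows "A = B"
proof (rule tensor.expand, intro conjI ext)
  fix ks show "tentry A ks = tentry B ks"
    using assms by (cases "ks \<in> indices ds") (auto simp: tensor_space_def)
qed (use assms in \<open>simp add: tensor_space_def\<close>)

lemma Mat_carrier:
  "A \<in> tensor_space ds \<Longrightarrow> Mat i A \<in> carrier_mat (ds ! i) (prod_list (del_nth i ds))"
  by (simp add: Mat_def tensor_space_def)

lemma Ten_closed [simp]: "Ten i ds M \<in> tensor_space ds"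
  by (simp add: Ten_def mk_tensor_def tensor_space_def)

lemma tentry_Ten:
  "ks \<in> indices ds \<Longrightarrow> tentry (Ten i ds M) ks = M $$ (ks ! i, colex (del_nth i ds) (del_nth i ks))"
  by (simp add: Ten_def mk_tensor_def)

lemma Mat_at:
  assumes "A \<in> tensor_space ds" "i < length ds" "ks \<in> indices ds"
  shows "Mat i A $$ (ks ! i, colex (del_nth i ds) (del_nth i ks)) = tentry A ks"
proof -
  have "del_nth i ks \<in> indices (del_nth i ds)" "ks ! i < ds ! i" "i < length ks"
    using assms del_nth_indices by (auto simp: indices_iff)
  then show ?thesis
    using assms by (simp add: Mat_def tensor_space_def colex_less uncolex_colex ins_del_nth)
qed

lemma Ten_Mat:
  assumes "A \<in> tensor_space ds" "i < length ds"
  shows "Ten i ds (Mat i A) = A"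
  using assms by (intro tensor_eqI[of _ ds]) (auto simp: tentry_Ten Mat_at)

lemma Mat_Ten:
  assumes "M \<in> carrier_mat (ds ! i) (prod_list (del_nth i ds))" "i < length ds"
  shows "Mat i (Ten i ds M) = M"
proof (rule eq_matI)
  fix k c assume "k < dim_row M" "c < dim_col M"
  then have k: "k < ds ! i" and c: "c < prod_list (del_nth i ds)"
    using assms by auto
  then have u: "uncolex (del_nth i ds) c \<in> indices (del_nth i ds)"
    by (simp add: uncolex_indices)
  then have l: "i \<le> length (uncolex (del_nth i ds) c)"
    using assms by (simp add: indices_length length_del_nth)
  show "Mat i (Ten i ds M) $$ (k, c) = M $$ (k, c)"
    using k c u l assms ins_nth_indices[OF u \<open>i < length ds\<close> k]
    by (simp add: Mat_def tensor_space_dims[OF Ten_closed] tentry_Ten del_ins_nth nth_ins_nth colex_uncolex)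
qed (use assms in \<open>auto simp: Mat_def tensor_space_dims[OF Ten_closed]\<close>)

lemma Mat_inject:
  assumes "A \<in> tensor_space ds" "B \<in> tensor_space ds" "i < length ds" "Mat i A = Mat i B"
  shows "A = B"
  using Ten_Mat assms by metis

section \<open>Mode products of a tensor\<close>

lemma mode_prod_closed:
  assumes "A \<in> tensor_space ds" "M \<in> carrier_mat d d'"
  shows "mode_prod A i M \<in> tensor_space (ds[i := d])"
  using assms Ten_closed[of i "(tdims A)[i := dim_row M]" "M * Mat i A"]
  by (simp add: mode_prod_def tensor_space_dims)

lemma Mat_mode_prod:
  assumes "A \<in> tensor_space ds" "i < length ds" "M \<in> carrier_mat d (ds ! i)"
  shows "Mat i (mode_prod A i M) = M * Mat i A"
  unfolding mode_prod_def
  by (rule Mat_Ten) (use assms Mat_carrier[OF assms(1), of i] in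
      \<open>auto simp: tensor_space_dims del_nth_update\<close>)

text \<open>In this entrywise form, products in different modes touch different positions of the
  index list, which is how they are later commuted and moved across contractions.\<close>

lemma tentry_mode_prod:
  assumes A: "A \<in> tensor_space ds" and i: "i < length ds" and M: "M \<in> carrier_mat d (ds ! i)"
    and ks: "ks \<in> indices (ds[i := d])"
  shows "tentry (mode_prod A i M) ks = (\<Sum>l < ds ! i. M $$ (ks ! i, l) * tentry A (ks[i := l]))"
proof -
  let ?c = "colex (del_nth i ds) (del_nth i ks)"
  have d: "del_nth i ks \<in> indices (del_nth i ds)"
    using del_nth_indices[OF ks, of i] i by (simp add: del_nth_update)
  have k: "ks ! i < d" "i < length ks"
    using ks i by (auto simp: indices_iff)
  have *: "Mat i A $$ (l, ?c) = tentry A (ks[i := l])" if "l < ds ! i" for l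
    using Mat_at[OF A i indices_update_same[OF ks i that]] k by (simp add: del_nth_update)
  have "tentry (mode_prod A i M) ks = (M * Mat i A) $$ (ks ! i, ?c)"
    using A M ks i by (simp add: mode_prod_def tentry_Ten tensor_space_dims del_nth_update)
  also have "\<dots> = (\<Sum>l < ds ! i. M $$ (ks ! i, l) * Mat i A $$ (l, ?c))"
    using k d M Mat_carrier[OF A, of i]
    by (subst index_mult_mat) (auto simp: scalar_prod_def colex_less atLeast0LessThan)
  also have "\<dots> = (\<Sum>l < ds ! i. M $$ (ks ! i, l) * tentry A (ks[i := l]))"
    by (simp add: *)
  finally show ?thesis .
qed

lemma mode_prod_commute:
  assumes A: "A \<in> tensor_space ds" and ij: "i < length ds" "j < length ds" "i \<noteq> j"
    and M: "M \<in> carrier_mat d (ds ! i)" and N: "N \<in> carrier_mat e (ds ! j)"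
  shows "mode_prod (mode_prod A i M) j N = mode_prod (mode_prod A j N) i M"
proof (rule tensor_eqI)
  have AM: "mode_prod A i M \<in> tensor_space (ds[i := d])" and AN: "mode_prod A j N \<in> tensor_space (ds[j := e])"
    using mode_prod_closed A M N by auto
  show "mode_prod (mode_prod A i M) j N \<in> tensor_space (ds[i := d, j := e])"
    using mode_prod_closed AM N by auto
  show "mode_prod (mode_prod A j N) i M \<in> tensor_space (ds[i := d, j := e])"
    using mode_prod_closed[OF AN M, of i] ij by (simp add: list_update_swap)
  fix ks assume ks: "ks \<in> indices (ds[i := d, j := e])"
  have 1: "ks[j := l] \<in> indices (ds[i := d])" if "l < ds ! j" for l
    using indices_update_same[OF ks, of l] that ij by simp
  have 2: "ks[i := l] \<in> indices (ds[j := e])" if "l < ds ! i" for l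
    using indices_update_same[of ks "ds[j := e]" i d l] ks that ij by (simp add: list_update_swap)
  have "tentry (mode_prod (mode_prod A i M) j N) ks
      = (\<Sum>l < ds ! j. \<Sum>k < ds ! i. N $$ (ks ! j, l) * (M $$ (ks ! i, k) * tentry A (ks[j := l, i := k])))"
    using ij A M N ks 1
    by (simp add: tentry_mode_prod[OF AM] tentry_mode_prod[OF A] sum_distrib_left)
  also have "\<dots> = (\<Sum>k < ds ! i. \<Sum>l < ds ! j. M $$ (ks ! i, k) * (N $$ (ks ! j, l) * tentry A (ks[i := k, j := l])))"
    using ij by (subst sum.swap) (simp add: list_update_swap mult.left_commute)
  also have "\<dots> = tentry (mode_prod (mode_prod A j N) i M) ks"
    using ij A M N ks 2
    by (simp add: tentry_mode_prod[OF AN] tentry_mode_prod[OF A] sum_distrib_left list_update_swap)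
  finally show "tentry (mode_prod (mode_prod A i M) j N) ks = tentry (mode_prod (mode_prod A j N) i M) ks" .
qed

lemma mode_prod_mode_prod:
  assumes A: "A \<in> tensor_space ds" and i: "i < length ds"
    and M: "M \<in> carrier_mat d (ds ! i)" and N: "N \<in> carrier_mat e d"
  shows "mode_prod (mode_prod A i M) i N = mode_prod A i (N * M)"
proof (rule Mat_inject)
  have AM: "mode_prod A i M \<in> tensor_space (ds[i := d])"
    using mode_prod_closed A M by auto
  have NM: "N * M \<in> carrier_mat e (ds ! i)"
    using M N by simp
  show "mode_prod (mode_prod A i M) i N \<in> tensor_space (ds[i := e])"
    using mode_prod_closed[OF AM N, of i] by simp
  show "mode_prod A i (N * M) \<in> tensor_space (ds[i := e])"
    using mode_prod_closed[OF A NM] by auto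
  show "Mat i (mode_prod (mode_prod A i M) i N) = Mat i (mode_prod A i (N * M))"
    using i M N by (simp add: Mat_mode_prod[OF AM] Mat_mode_prod[OF A] Mat_mode_prod[OF A i NM]
        assoc_mult_mat[OF N M Mat_carrier[OF A]])
qed (use i in simp)

lemma mode_prod_one:
  assumes "A \<in> tensor_space ds" "i < length ds"
  shows "mode_prod A i (1\<^sub>m (ds ! i)) = A"
  using assms Mat_carrier[OF assms(1), of i] 
  by (simp add: mode_prod_def tensor_space_dims Ten_Mat)

lemma mode_prod_swap_Ten:
  assumes "M \<in> carrier_mat d (ds ! i)" "i < length ds" "N \<in> carrier_mat (ds ! i) (prod_list (del_nth i ds))"
  shows "mode_prod (Ten i ds N) i M = Ten i (ds[i := d]) (M * N)"
  using assms by (simp add: mode_prod_def tensor_space_dims[OF Ten_closed] Mat_Ten)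

section \<open>Gram matrices of matricizations\<close>

text \<open>The contraction of \<open>X\<close> and \<open>Y\<close> over every mode but
  \<open>i\<close>; the two tensors may differ in the dimension of mode \<open>i\<close>
  itself.\<close>

definition gram :: "nat \<Rightarrow> tensor \<Rightarrow> tensor \<Rightarrow> real mat" where
  "gram i X Y = Mat i X * transpose_mat (Mat i Y)"

lemma gram_carrier:
  assumes "X \<in> tensor_space ds" "Y \<in> tensor_space es"
  shows "gram i X Y \<in> carrier_mat (ds ! i) (es ! i)"
  using Mat_carrier[OF assms(1), of i] Mat_carrier[OF assms(2), of i] by (auto simp: gram_def)

lemma gram_entry:
  assumes X: "X \<in> tensor_space ds" and Y: "Y \<in> tensor_space (ds[i := e])"
    and i: "i < length ds" and ab: "a < ds ! i" "b < e"
  shows "gram i X Y $$ (a, b)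
    = (\<Sum>ks \<in> indices (ds[i := 1]). tentry X (ks[i := a]) * tentry Y (ks[i := b]))"
proof -
  let ?f = "\<lambda>ks. tentry X (ks[i := a]) * tentry Y (ks[i := b])"
  have l: "i \<le> length (uncolex (del_nth i ds) c)" if "c < prod_list (del_nth i ds)" for c
    using uncolex_indices[OF that] i by (simp add: indices_length length_del_nth)
  have "gram i X Y $$ (a, b) = (\<Sum>c < prod_list (del_nth i ds). Mat i X $$ (a, c) * Mat i Y $$ (b, c))"
    using Mat_carrier[OF X, of i] Mat_carrier[OF Y, of i] i ab unfolding gram_def
    by (subst index_mult_mat) (auto simp: scalar_prod_def atLeast0LessThan del_nth_update)
  also have "\<dots> = (\<Sum>c < prod_list (del_nth i ds). ?f (ins_nth i 0 (uncolex (del_nth i ds) c)))"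
    using X Y ab i l by (intro sum.cong) (auto simp: Mat_def tensor_space_dims del_nth_update ins_nth_update)
  also have "\<dots> = (\<Sum>ks \<in> indices (ds[i := 1]). ?f (ks[i := 0]))"
    using i by (rule sum_uncolex_ins)
  finally show ?thesis
    by simp
qed

text \<open>Mode \<open>j\<close> is summed over in the contraction, so a matrix acting there on one
  argument acts by its transpose on the other. This adjointness stands in for Kronecker product
  identities of matricizations.\<close>

lemma gram_mode_prod:
  assumes Z: "Z \<in> tensor_space ds" and W: "W \<in> tensor_space (ds[j := d, i := e])"
    and ij: "i < length ds" "j < length ds" "i \<noteq> j" and M: "M \<in> carrier_mat d (ds ! j)"
  shows "gram i (mode_prod Z j M) W = gram i Z (mode_prod W j (transpose_mat M))"
proof (rule eq_matI)
  have ZM: "mode_prod Z j M \<in> tensor_space (ds[j := d])"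
    using mode_prod_closed Z M by auto
  have M': "transpose_mat M \<in> carrier_mat (ds ! j) (ds[j := d, i := e] ! j)"
    using M ij by simp
  have "mode_prod W j (transpose_mat M) \<in> tensor_space (ds[j := d, i := e, j := ds ! j])"
    using mode_prod_closed[OF W M'] by auto
  also have "ds[j := d, i := e, j := ds ! j] = ds[i := e]"
    using ij by (simp add: list_eq_iff_nth_eq nth_list_update)
  finally have WM: "mode_prod W j (transpose_mat M) \<in> tensor_space (ds[i := e])" .
  note c1 = gram_carrier[OF ZM W, of i] and c2 = gram_carrier[OF Z WM, of i]
  show "dim_row (gram i (mode_prod Z j M) W) = dim_row (gram i Z (mode_prod W j (transpose_mat M)))"
    "dim_col (gram i (mode_prod Z j M) W) = dim_col (gram i Z (mode_prod W j (transpose_mat M)))"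
    using c1 c2 ij by auto
  fix a b assume "a < dim_row (gram i Z (mode_prod W j (transpose_mat M)))"
    "b < dim_col (gram i Z (mode_prod W j (transpose_mat M)))"
  then have a: "a < ds ! i" and b: "b < e"
    using c2 ij by auto
  let ?I = "indices (ds[i := 1, j := 1])"
  \<comment> \<open>The common summand: \<open>p\<close> is the index of \<open>Z\<close> and
    \<open>l\<close> that of \<open>W\<close> in mode \<open>j\<close>. The left side has the sum
    over \<open>p\<close> inside, the right side the sum over \<open>l\<close>.\<close>
  let ?s = "\<lambda>ks l p. M $$ (l, p) * tentry Z (ks[i := a, j := p]) * tentry W (ks[i := b, j := l])"
  have upd: "ds[j := d, i := x, j := y] = ds[i := x, j := y]" for x y
    using ij by (simp add: list_eq_iff_nth_eq nth_list_update)
  have mem: "ks[j := l, i := a] \<in> indices (ds[j := d])" if "ks \<in> ?I" "l < d" for ks l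
    using that a ij by (auto simp: indices_iff nth_list_update)
  have mem': "ks[j := p, i := b] \<in> indices (ds[j := d, i := e, j := ds ! j])" if "ks \<in> ?I" "p < ds ! j" for ks p
    using that b ij by (auto simp: indices_iff nth_list_update)
  have len: "length ks = length ds" if "ks \<in> ?I" for ks
    using that by (simp add: indices_iff)
  have "gram i (mode_prod Z j M) W $$ (a, b)
      = (\<Sum>ks \<in> indices (ds[j := d, i := 1]). tentry (mode_prod Z j M) (ks[i := a]) * tentry W (ks[i := b]))"
    using gram_entry[OF ZM W, of a b] ij a b by simp
  also have "\<dots> = (\<Sum>ks \<in> ?I. \<Sum>l < d. tentry (mode_prod Z j M) (ks[j := l, i := a]) * tentry W (ks[j := l, i := b]))"
    using ij sum_indices_split[of j "ds[j := d, i := 1]" "\<lambda>ks. tentry (mode_prod Z j M) (ks[i := a]) * tentry W (ks[i := b])"]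
    by (simp add: list_update_swap[of i j] upd)
  also have "\<dots> = (\<Sum>ks \<in> ?I. \<Sum>l < d. \<Sum>p < ds ! j. ?s ks l p)"
    using ij mem len
    by (intro sum.cong refl) (simp add: tentry_mode_prod[OF Z _ M] sum_distrib_right list_update_swap)
  also have "\<dots> = (\<Sum>ks \<in> ?I. \<Sum>p < ds ! j. \<Sum>l < d. ?s ks l p)"
    by (intro sum.cong refl sum.swap)
  also have "\<dots> = (\<Sum>ks \<in> ?I. \<Sum>p < ds ! j. tentry Z (ks[j := p, i := a])
        * tentry (mode_prod W j (transpose_mat M)) (ks[j := p, i := b]))"
    using ij mem' len M
    by (intro sum.cong refl)
      (simp add: tentry_mode_prod[OF W _ M'] sum_distrib_left list_update_swap mult_ac)
  also have "\<dots> = (\<Sum>ks \<in> indices (ds[i := 1]). tentry Z (ks[i := a])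
        * tentry (mode_prod W j (transpose_mat M)) (ks[i := b]))"
    using ij sum_indices_split[of j "ds[i := 1]" "\<lambda>ks. tentry Z (ks[i := a]) * tentry (mode_prod W j (transpose_mat M)) (ks[i := b])"]
    by simp
  also have "\<dots> = gram i Z (mode_prod W j (transpose_mat M)) $$ (a, b)"
    using gram_entry[OF Z WM, of a b] ij a b by simp
  finally show "gram i (mode_prod Z j M) W $$ (a, b) = gram i Z (mode_prod W j (transpose_mat M)) $$ (a, b)" .
qed

text \<open>\<open>transpose_mat (Mat 0 X) * Mat 0 Y\<close> sums over mode 0 alone and still
  contains every pair of remaining indices. Identifying and summing all of these except mode
  \<open>i\<close> is a partial trace, and its value is \<open>gram i\<close>.\<close>

lemma gram_partial_trace:
  assumes X: "X \<in> tensor_space ds" "Y \<in> tensor_space ds" "X' \<in> tensor_space ds" "Y' \<in> tensor_space ds"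
    and eq: "transpose_mat (Mat 0 X) * Mat 0 Y = transpose_mat (Mat 0 X') * Mat 0 Y'"
    and i: "i < length ds" "i \<noteq> 0"
  shows "gram i X Y = gram i X' Y'"
proof -
  \<comment> \<open>An entry of the product at two columns is the sum over mode 0 with the remaining
    indices of \<open>us\<close> and \<open>vs\<close> held fixed.\<close>
  have pair: "(\<Sum>k < ds ! 0. tentry A (us[0 := k]) * tentry B (vs[0 := k]))
      = (transpose_mat (Mat 0 A) * Mat 0 B) $$ (colex (del_nth 0 ds) (del_nth 0 us), colex (del_nth 0 ds) (del_nth 0 vs))"
    if A: "A \<in> tensor_space ds" and B: "B \<in> tensor_space ds"
      and u: "us \<in> indices (ds[0 := 1])" and v: "vs \<in> indices (ds[0 := 1])" for A B us vs
  proof -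
    have 0: "0 < length ds"
      using i by auto
    have c: "del_nth 0 us \<in> indices (del_nth 0 ds)" "del_nth 0 vs \<in> indices (del_nth 0 ds)"
      using del_nth_indices[OF u, of 0] del_nth_indices[OF v, of 0] 0 by (simp_all add: del_nth_update)
    have l: "0 < length us" "0 < length vs"
      using u v 0 by (simp_all add: indices_iff)
    show ?thesis
      using c Mat_carrier[OF A, of 0] Mat_carrier[OF B, of 0]
        Mat_at[OF A 0 indices_update_same[OF u 0]] Mat_at[OF B 0 indices_update_same[OF v 0]] l
      by (subst index_mult_mat) (auto simp: scalar_prod_def colex_less atLeast0LessThan del_nth_update intro!: sum.cong)
  qed
  have e: "gram i A B $$ (a, b) = (\<Sum>ks \<in> indices (ds[i := 1, 0 := 1]). \<Sum>k < ds ! 0.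
      tentry A ((ks[i := a])[0 := k]) * tentry B ((ks[i := b])[0 := k]))"
    if "A \<in> tensor_space ds" "B \<in> tensor_space ds" "a < ds ! i" "b < ds ! i" for A B a b
  proof -
    have "gram i A B $$ (a, b) = (\<Sum>ks \<in> indices (ds[i := 1]). tentry A (ks[i := a]) * tentry B (ks[i := b]))"
      using gram_entry[of A ds B i "ds ! i" a b] that i by simp
    also have "\<dots> = (\<Sum>ks \<in> indices (ds[i := 1, 0 := 1]). \<Sum>k < ds ! 0.
      tentry A (ks[0 := k, i := a]) * tentry B (ks[0 := k, i := b]))"
      using i by (subst sum_indices_split[of 0]) auto
    finally show ?thesis
      using i by (simp add: list_update_swap)
  qed
  have m: "ks[i := a] \<in> indices (ds[0 := 1])" if "ks \<in> indices (ds[i := 1, 0 := 1])" "a < ds ! i" for ks a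
    using that i indices_update_same[of ks "ds[0 := 1]" i 1 a] by (simp add: list_update_swap)
  show ?thesis
  proof (rule eq_matI)
    fix a b assume "a < dim_row (gram i X' Y')" "b < dim_col (gram i X' Y')"
    then have ab: "a < ds ! i" "b < ds ! i"
      using gram_carrier[of X' ds Y' ds i] X by auto
    show "gram i X Y $$ (a, b) = gram i X' Y' $$ (a, b)"
      using ab X by (simp add: e pair m eq cong: sum.cong del: One_nat_def)
  qed (use gram_carrier[of X ds Y ds i] gram_carrier[of X' ds Y' ds i] X in auto)
qed

section \<open>Mode products in several modes\<close>

text \<open>The dimensions of a \<open>multi_prod\<close> whose matrix for subtree \<open>j\<close>
  has \<open>f j\<close> rows. Subtree \<open>j\<close> sits in mode \<open>Suc j\<close>, so mode 0
  is never touched.\<close>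

definition upd_dims :: "nat list \<Rightarrow> nat list \<Rightarrow> (nat \<Rightarrow> nat) \<Rightarrow> nat list" where
  "upd_dims ds js f = map (\<lambda>k. if k \<in> Suc ` set js then f (k - 1) else ds ! k) [0..<length ds]"

lemma length_upd_dims [simp]: "length (upd_dims ds js f) = length ds"
  by (simp add: upd_dims_def)

lemma nth_upd_dims_0 [simp]: "0 < length ds \<Longrightarrow> upd_dims ds js f ! 0 = ds ! 0"
  by (auto simp: upd_dims_def)

lemma nth_upd_dims_Suc [simp]:
  "Suc k < length ds \<Longrightarrow> upd_dims ds js f ! Suc k = (if k \<in> set js then f k else ds ! Suc k)"
  by (auto simp: upd_dims_def)

lemma upd_dims_eqI:
  assumes "length ds = length es" "0 < length ds \<Longrightarrow> ds ! 0 = es ! 0"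
    and "\<And>k. Suc k < length ds \<Longrightarrow> (if k \<in> set js then f k else ds ! Suc k) = es ! Suc k"
  shows "upd_dims ds js f = es"
proof (rule nth_equalityI)
  fix k assume "k < length (upd_dims ds js f)"
  then show "upd_dims ds js f ! k = es ! k"
    using assms by (cases k) auto
qed (simp add: assms)

lemma upd_dims_Nil [simp]: "upd_dims ds [] f = ds"
  by (rule upd_dims_eqI) auto

lemma upd_dims_Cons: "j \<notin> set js \<Longrightarrow> upd_dims (ds[Suc j := f j]) js f = upd_dims ds (j # js) f"
  by (rule upd_dims_eqI) (auto simp: nth_list_update)

text \<open>Distinctness makes every mode be hit at most once, so each factor can be checked against
  the original \<open>ds\<close> although earlier factors change the dimensions.\<close>

definition multi_compat :: "nat list \<Rightarrow> nat list \<Rightarrow> (nat \<Rightarrow> nat) \<Rightarrow> (nat \<Rightarrow> real mat) \<Rightarrow> bool" where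
  "multi_compat ds js f M \<longleftrightarrow> distinct js
     \<and> (\<forall>j \<in> set js. Suc j < length ds \<and> M j \<in> carrier_mat (f j) (ds ! Suc j))"

lemma multi_compat_update:
  assumes "i \<notin> Suc ` set js"
  shows "multi_compat (ds[i := d]) js f M \<longleftrightarrow> multi_compat ds js f M"
proof -
  have "ds[i := d] ! Suc k = ds ! Suc k" if "k \<in> set js" for k
    using assms that by (intro nth_list_update_neq) auto
  then show ?thesis
    by (simp add: multi_compat_def)
qed

lemma multi_compat_Cons:
  "multi_compat ds (j # js) f M \<longleftrightarrow> j \<notin> set js \<and> Suc j < length ds
     \<and> M j \<in> carrier_mat (f j) (ds ! Suc j) \<and> multi_compat (ds[Suc j := f j]) js f M"
proof (cases "j \<in> set js")
  case False
  then show ?thesis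
    by (subst multi_compat_update) (auto simp: multi_compat_def)
qed (simp add: multi_compat_def)

lemma multi_prod_Nil [simp]: "multi_prod A [] M = A"
  by (simp add: multi_prod_def)

lemma multi_prod_Cons [simp]: "multi_prod A (j # js) M = multi_prod (mode_prod A (Suc j) (M j)) js M"
  by (simp add: multi_prod_def)

lemma multi_prod_snoc: "multi_prod A (js @ [j]) M = mode_prod (multi_prod A js M) (Suc j) (M j)"
  by (simp add: multi_prod_def)

lemma multi_prod_cong:
  "(\<And>j. j \<in> set js \<Longrightarrow> M j = M' j) \<Longrightarrow> multi_prod A js M = multi_prod A js M'"
  by (induction js arbitrary: A) auto

lemma multi_prod_closed:
  "A \<in> tensor_space ds \<Longrightarrow> multi_compat ds js f M \<Longrightarrow> multi_prod A js M \<in> tensor_space (upd_dims ds js f)"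
proof (induction js arbitrary: A ds)
  case (Cons j js)
  then show ?case
    using mode_prod_closed[of A ds "M j" "f j" _ "Suc j"]
    by (auto simp: multi_compat_Cons upd_dims_Cons[symmetric])
qed simp

lemma mode_prod_multi_prod:
  assumes "A \<in> tensor_space ds" "multi_compat ds js f M" "i < length ds" "i \<notin> Suc ` set js"
    and "N \<in> carrier_mat d (ds ! i)"
  shows "mode_prod (multi_prod A js M) i N = multi_prod (mode_prod A i N) js M"
  using assms
proof (induction js arbitrary: A ds)
  case (Cons j js)
  let ?B = "mode_prod A (Suc j) (M j)"
  have j: "j \<notin> set js" "Suc j < length ds" "M j \<in> carrier_mat (f j) (ds ! Suc j)"
    "multi_compat (ds[Suc j := f j]) js f M" "i \<noteq> Suc j"
    using Cons.prems by (auto simp: multi_compat_Cons)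
  have "?B \<in> tensor_space (ds[Suc j := f j])"
    using mode_prod_closed Cons.prems j by auto
  then have "mode_prod (multi_prod ?B js M) i N = multi_prod (mode_prod ?B i N) js M"
    using Cons.prems j by (intro Cons.IH[OF _ j(4)]) auto
  also have "mode_prod ?B i N = mode_prod (mode_prod A i N) (Suc j) (M j)"
    using Cons.prems j by (intro mode_prod_commute) auto
  finally show ?case
    by simp
qed simp

text \<open>Each \<open>N j\<close> commutes past the products in the other modes until it meets
  \<open>M j\<close>.\<close>

lemma multi_prod_multi_prod:
  assumes "A \<in> tensor_space ds" "multi_compat ds js f M"
    and "\<And>j. j \<in> set js \<Longrightarrow> N j \<in> carrier_mat (g j) (f j)"
  shows "multi_prod (multi_prod A js M) js N = multi_prod A js (\<lambda>j. N j * M j)"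
  using assms
proof (induction js arbitrary: A ds)
  case (Cons j js)
  let ?B = "mode_prod A (Suc j) (M j)"
  have j: "j \<notin> set js" "Suc j < length ds" "M j \<in> carrier_mat (f j) (ds ! Suc j)"
    "multi_compat (ds[Suc j := f j]) js f M" "N j \<in> carrier_mat (g j) (f j)"
    using Cons.prems by (auto simp: multi_compat_Cons)
  have B: "?B \<in> tensor_space (ds[Suc j := f j])"
    using mode_prod_closed Cons.prems j by auto
  have B': "mode_prod ?B (Suc j) (N j) \<in> tensor_space (ds[Suc j := g j])"
    using mode_prod_closed[OF B j(5), of "Suc j"] by simp
  have c: "multi_compat (ds[Suc j := g j]) js f M"
    using j(4) j(1) multi_compat_update[of "Suc j" js ds] by (auto simp: image_iff)
  have "mode_prod (multi_prod ?B js M) (Suc j) (N j) = multi_prod (mode_prod ?B (Suc j) (N j)) js M"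
    using j B by (intro mode_prod_multi_prod[OF B, where f = f and d = "g j"]) auto
  moreover have "mode_prod ?B (Suc j) (N j) = mode_prod A (Suc j) (N j * M j)"
    using Cons.prems j by (intro mode_prod_mode_prod) auto
  moreover have "multi_prod (multi_prod (mode_prod ?B (Suc j) (N j)) js M) js N
      = multi_prod (mode_prod ?B (Suc j) (N j)) js (\<lambda>j. N j * M j)"
    using Cons.prems c by (intro Cons.IH[OF B']) auto
  ultimately show ?case
    by simp
qed simp

lemma multi_prod_one:
  assumes "A \<in> tensor_space ds" "\<And>j. j \<in> set js \<Longrightarrow> Suc j < length ds \<and> M j = 1\<^sub>m (ds ! Suc j)"
  shows "multi_prod A js M = A"
  using assms by (induction js) (auto simp: mode_prod_one)

lemma multi_prod_id:
  assumes "A \<in> tensor_space ds" "\<And>j. j \<in> set js \<Longrightarrow> mode_prod A (Suc j) (M j) = A"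
  shows "multi_prod A js M = A"
  using assms by (induction js) auto

text \<open>Adjointness in all modes of \<open>js\<close> at once. Peeling off the first factor
  leaves its transpose outermost on the other side, from where it commutes back to the
  front.\<close>

lemma gram_multi_prod:
  assumes "Z \<in> tensor_space ds" "multi_compat ds js f M" "i < length ds" "i \<notin> Suc ` set js"
    and "W \<in> tensor_space ((upd_dims ds js f)[i := e])"
  shows "gram i (multi_prod Z js M) W = gram i Z (multi_prod W js (\<lambda>j. transpose_mat (M j)))"
  using assms
proof (induction js arbitrary: Z ds)
  case (Cons j js)
  let ?B = "mode_prod Z (Suc j) (M j)"
  let ?M = "\<lambda>j. transpose_mat (M j)"
  have j: "j \<notin> set js" "Suc j < length ds" "M j \<in> carrier_mat (f j) (ds ! Suc j)"
    "multi_compat (ds[Suc j := f j]) js f M" "i \<noteq> Suc j"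
    using Cons.prems by (auto simp: multi_compat_Cons)
  let ?ds = "ds[Suc j := f j]"
  have B: "?B \<in> tensor_space ?ds"
    using mode_prod_closed Cons.prems j by auto
  have W: "W \<in> tensor_space ((upd_dims ?ds js f)[i := e])"
    using Cons.prems j by (simp add: upd_dims_Cons)
  let ?es = "(upd_dims ?ds js f)[i := e]"
  have es': "?es ! Suc k = f k" if "k \<in> set js" for k
    using that Cons.prems(4) j(4) by (subst nth_list_update_neq) (auto simp: multi_compat_def)
  have c: "multi_compat ?es js (\<lambda>j. ?ds ! Suc j) ?M"
    using j(4) es' by (auto simp: multi_compat_def)
  have es: "?es ! Suc j = f j"
    using j by simp
  have "upd_dims ?es js (\<lambda>j. ?ds ! Suc j) = ?ds[i := e]"
    using Cons.prems by (intro upd_dims_eqI) (auto simp: nth_list_update)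
  then have W': "multi_prod W js ?M \<in> tensor_space (?ds[i := e])"
    using multi_prod_closed[OF W c] by simp
  have "gram i (multi_prod ?B js M) W = gram i ?B (multi_prod W js ?M)"
    using Cons.prems j W by (intro Cons.IH[OF B]) auto
  also have "\<dots> = gram i Z (mode_prod (multi_prod W js ?M) (Suc j) (?M j))"
    using Cons.prems j W' by (intro gram_mode_prod) auto
  also have "mode_prod (multi_prod W js ?M) (Suc j) (?M j) = multi_prod (mode_prod W (Suc j) (?M j)) js ?M"
    using j es by (intro mode_prod_multi_prod[OF W c, where d = "ds ! Suc j"]) auto
  finally show ?case
    by simp
qed simp

text \<open>Brings mode \<open>i\<close> to the outside: a subflow exchanges the basis of one mode
  and leaves the others alone.\<close>

lemma multi_prod_remove:
  assumes "A \<in> tensor_space ds" "multi_compat ds js f M" "i \<in> set js"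
  shows "multi_prod A js M = mode_prod (multi_prod A (filter (\<lambda>j. j \<noteq> i) js) M) (Suc i) (M i)"
  using assms
proof (induction js arbitrary: A ds)
  case (Cons j js)
  have j: "j \<notin> set js" "Suc j < length ds" "M j \<in> carrier_mat (f j) (ds ! Suc j)"
    "multi_compat (ds[Suc j := f j]) js f M"
    using Cons.prems by (auto simp: multi_compat_Cons)
  have B: "mode_prod A (Suc j) (M j) \<in> tensor_space (ds[Suc j := f j])"
    using mode_prod_closed Cons.prems j by auto
  show ?case
  proof (cases "i = j")
    case True
    then have "filter (\<lambda>j. j \<noteq> i) js = js"
      using j by (auto intro: filter_True)
    moreover have "multi_compat ds js f M"
      using Cons.prems by (auto simp: multi_compat_def)
    then have "mode_prod (multi_prod A js M) (Suc j) (M j) = multi_prod (mode_prod A (Suc j) (M j)) js M"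
      using j Cons.prems by (intro mode_prod_multi_prod) auto
    ultimately show ?thesis
      using True by simp
  next
    case False
    then show ?thesis
      using Cons.IH[OF B j(4)] Cons.prems(3) by auto
  qed
qed simp

section \<open>One-sided inverses and rank\<close>

text \<open>Full column rank, stated by a left inverse so that it passes from products to factors by
  associativity. Full row rank is this property of the transpose.\<close>

definition left_invertible :: "real mat \<Rightarrow> bool" where
  "left_invertible M \<longleftrightarrow> (\<exists>L \<in> carrier_mat (dim_col M) (dim_row M). L * M = 1\<^sub>m (dim_col M))"

lemma left_invertibleI:
  "M \<in> carrier_mat n k \<Longrightarrow> L \<in> carrier_mat k n \<Longrightarrow> L * M = 1\<^sub>m k \<Longrightarrow> left_invertible M"
  by (auto simp: left_invertible_def)

lemma left_invertibleE:
  assumes "left_invertible M" "M \<in> carrier_mat n k"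
  obtains L where "L \<in> carrier_mat k n" "L * M = 1\<^sub>m k"
  using assms by (auto simp: left_invertible_def)

lemma mult_mat_cancel:
  fixes A :: "'a :: semiring_1 mat"
  assumes "L \<in> carrier_mat k n" "A \<in> carrier_mat n k" "B \<in> carrier_mat k m" "L * A = 1\<^sub>m k"
  shows "L * (A * B) = B"
  using assoc_mult_mat[OF assms(1-3)] assms by simp

lemma left_invertible_factor:
  assumes "left_invertible (A * B)" "A \<in> carrier_mat n k" "B \<in> carrier_mat k m"
  shows "left_invertible B"
proof -
  obtain L where L: "L \<in> carrier_mat m n" "L * (A * B) = 1\<^sub>m m"
    using assms left_invertibleE[of "A * B" n m] by auto
  then have "(L * A) * B = 1\<^sub>m m"
    using assms by simp
  then show ?thesis
    using L assms by (intro left_invertibleI[of B k m "L * A"]) auto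
qed

lemma left_invertible_square:
  assumes "left_invertible A" "A \<in> carrier_mat n n"
  obtains B where "B \<in> carrier_mat n n" "A * B = 1\<^sub>m n" "B * A = 1\<^sub>m n"
  using left_invertibleE[OF assms] mat_mult_left_right_inverse[OF _ assms(2)] by metis

text \<open>If \<open>A^T A v = 0\<close> then \<open>|A v|^2 = 0\<close> over the reals, so the
  Gram matrix \<open>A^T A\<close> is nonsingular and \<open>(A^T A)^-1 A^T\<close> is a left
  inverse. The inverse is written through the adjugate.\<close>

lemma trivial_kernel_left_invertible:
  assumes A: "A \<in> carrier_mat n m"
    and ker: "\<And>v. v \<in> carrier_vec m \<Longrightarrow> A *\<^sub>v v = 0\<^sub>v n \<Longrightarrow> v = 0\<^sub>v m"
  shows "left_invertible A"
proof -
  let ?G = "transpose_mat A * A"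
  have G: "?G \<in> carrier_mat m m"
    using A by simp
  have "det ?G \<noteq> 0"
  proof
    assume "det ?G = 0"
    then obtain v where v: "v \<in> carrier_vec m" "v \<noteq> 0\<^sub>v m" "?G *\<^sub>v v = 0\<^sub>v m"
      using det_0_iff_vec_prod_zero_field[OF G] by blast
    let ?w = "A *\<^sub>v v"
    have w: "?w \<in> carrier_vec n"
      using A v by simp
    have "transpose_mat A *\<^sub>v ?w = 0\<^sub>v m"
      using v A by simp
    then have "(transpose_mat A *\<^sub>v ?w) \<bullet> v = 0"
      using v by simp
    then have "?w \<bullet> ?w = 0"
      using transpose_vec_mult_scalar[OF A v(1) w] by simp
    then have "(\<Sum>i \<in> {0..<n}. (?w $ i)\<^sup>2) = 0"
      unfolding scalar_prod_def carrier_vecD[OF w] power2_eq_square .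
    then have "\<forall>i \<in> {0..<n}. (?w $ i)\<^sup>2 = 0"
      by (subst (asm) sum_nonneg_eq_0_iff) auto
    then have "?w = 0\<^sub>v n"
      using A by (intro eq_vecI) auto
    then show False
      using ker v by blast
  qed
  define L where "L = ((1 / det ?G) \<cdot>\<^sub>m adj_mat ?G) * transpose_mat A"
  note adj = adj_mat[OF G]
  have "L * A = ((1 / det ?G) \<cdot>\<^sub>m adj_mat ?G) * ?G"
    unfolding L_def using A adj(1) by (intro assoc_mult_mat[of _ m m _ n]) auto
  also have "\<dots> = (1 / det ?G) \<cdot>\<^sub>m (adj_mat ?G * ?G)"
    using adj(1) G by (intro mult_smult_assoc_mat) auto
  also have "\<dots> = 1\<^sub>m m"
    using \<open>det ?G \<noteq> 0\<close> unfolding adj(3) by (intro eq_matI) auto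
  finally show ?thesis
    using A adj(1) by (intro left_invertibleI[of A n m L]) (auto simp: L_def)
qed

section \<open>From rank to one-sided inverses\<close>

context vec_space begin

lemma rank_attained:
  assumes "A \<in> carrier_mat n nc"
  obtains S where "S \<subseteq> set (cols A)" "lin_indpt S" "card S = rank A"
proof -
  obtain S where "maximal S (\<lambda>T. T \<subseteq> set (cols A) \<and> lin_indpt T)"
    using maximal_exists[of "(\<lambda>T. T \<subseteq> set (cols A) \<and> lin_indpt T)" "card (set (cols A))" "{}"]
    by (meson List.finite_set card_mono empty_iff empty_subsetI finite_lin_indpt2 rev_finite_subset)
  then show thesis
    using that[of S] rank_card_indpt[OF assms] by (simp add: maximal_def)
qed

lemma full_col_rank_kernel:
  assumes A: "A \<in> carrier_mat n nc" "rank A = nc"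
    and v: "v \<in> carrier_vec nc" "A *\<^sub>v v = 0\<^sub>v n"
  shows "v = 0\<^sub>v nc"
proof (rule ccontr)
  assume "v \<noteq> 0\<^sub>v nc"
  obtain S where S: "S \<subseteq> set (cols A)" "lin_indpt S" "card S = nc"
    using rank_attained[OF A(1)] A(2) by metis
  \<comment> \<open>The columns enter as a set. An independent subset of size \<open>nc\<close>
    exhausts it and rules out repeated columns, so that \<open>v\<close> is a genuine dependence of
    the set.\<close>
  have "card S \<le> card (set (cols A))" "card (set (cols A)) \<le> nc"
    using S A(1) card_mono[OF _ S(1)] card_length[of "cols A"] by auto
  then have c: "card (set (cols A)) = length (cols A)" "S = set (cols A)"
    using S A(1) card_subset_eq[OF _ S(1)] by auto
  then have "distinct (cols A)"
    by (simp add: card_distinct)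
  then show False
    using lin_depI[OF A(1) v(1) \<open>v \<noteq> 0\<^sub>v nc\<close> v(2)] S(2) c by simp
qed

text \<open>\<open>n\<close> independent columns form a basis of the whole space.\<close>

lemma full_row_rank_surj:
  assumes A: "A \<in> carrier_mat n nc" "rank A = n" and y: "y \<in> carrier_vec n"
  shows "\<exists>x \<in> carrier_vec nc. A *\<^sub>v x = y"
proof -
  obtain S where S: "S \<subseteq> set (cols A)" "lin_indpt S" "card S = n"
    using rank_attained[OF A(1)] A(2) by metis
  have cc: "set (cols A) \<subseteq> carrier_vec n"
    using A(1) cols_dim[of A] by simp
  have "basis S"
    using S cc dim_is_n finite_subset[OF S(1)] by (intro dim_li_is_basis) auto
  then have "span S = carrier_vec n"
    by (simp add: basis_def)
  then have "carrier_vec n \<subseteq> span (set (cols A))"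
    using span_is_monotone[OF S(1)] by simp
  then show ?thesis
    using y col_space_eq[OF A(1)] A(1) unfolding col_space_def by auto
qed

end

lemma full_col_rank_left_invertible:
  assumes "mat_rank M = dim_col M"
  shows "left_invertible M"
  using vec_space.full_col_rank_kernel[of M "dim_row M" "dim_col M"] assms
  by (intro trivial_kernel_left_invertible[of M "dim_row M" "dim_col M"]) auto

lemma full_row_rank_left_invertible:
  assumes "mat_rank M = dim_row M"
  shows "left_invertible (transpose_mat M)"
proof -
  let ?n = "dim_row M" and ?m = "dim_col M"
  have "\<exists>x. x \<in> carrier_vec ?m \<and> M *\<^sub>v x = unit_vec ?n i" for i
    using vec_space.full_row_rank_surj[of M ?n ?m "unit_vec ?n i"] assms by auto
  then obtain x where x: "\<And>i. x i \<in> carrier_vec ?m" "\<And>i. M *\<^sub>v x i = unit_vec ?n i"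
    by metis
  \<comment> \<open>The columns solve \<open>M x = e_i\<close>, so this is a right inverse of
    \<open>M\<close>; its transpose is the wanted left inverse.\<close>
  define B where "B = mat_of_cols ?m (map x [0..<?n])"
  have B: "B \<in> carrier_mat ?m ?n"
    using mat_of_cols_carrier(1)[of ?m "map x [0..<?n]"] by (simp add: B_def)
  have "M * B = 1\<^sub>m ?n"
  proof (rule mat_col_eqI)
    fix i assume "i < dim_col (1\<^sub>m ?n :: real mat)"
    then have i: "i < ?n"
      by simp
    then have "col (M * B) i = M *\<^sub>v col B i"
      using B by (intro col_mult2[of _ ?n ?m _ ?n]) auto
    also have "col B i = x i"
      using i x(1) unfolding B_def by (subst col_mat_of_cols) auto
    finally show "col (M * B) i = col (1\<^sub>m ?n) i"
      using x i by simp
  qed (use B in auto)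
  then have "transpose_mat B * transpose_mat M = 1\<^sub>m ?n"
    using B by (simp flip: transpose_mult[of M ?n ?m])
  then show ?thesis
    using B by (intro left_invertibleI[of _ ?m ?n "transpose_mat B"]) auto
qed

section \<open>QR decompositions\<close>

text \<open>Gram-Schmidt with one column per induction step, on functions rather than matrices so
  that nothing has to be resized. \<open>S\<close> expresses \<open>Q\<close> through the columns of
  \<open>M\<close>; it is carried along in order to turn a vanishing residual into a dependence
  between those columns.\<close>

lemma gram_schmidt_functions:
  fixes M :: "nat \<Rightarrow> nat \<Rightarrow> real"
  assumes indep: "\<forall>u. (\<forall>i < m. (\<Sum>j < N. M i j * u j) = 0) \<longrightarrow> (\<forall>j < N. u j = 0)"
  shows "k \<le> N \<Longrightarrow> \<exists>Q R S :: nat \<Rightarrow> nat \<Rightarrow> real.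
     (\<forall>i < m. \<forall>j < k. M i j = (\<Sum>l < k. Q i l * R l j))
   \<and> (\<forall>a < k. \<forall>b < k. (\<Sum>i < m. Q i a * Q i b) = (if a = b then 1 else 0))
   \<and> (\<forall>a < k. \<forall>b < a. R a b = 0)
   \<and> (\<forall>i < m. \<forall>l < k. Q i l = (\<Sum>j < k. M i j * S j l))"
proof (induction k)
  case (Suc k)
  then have "k \<le> N"
    by simp
  from Suc.IH[OF this] obtain Q R S :: "nat \<Rightarrow> nat \<Rightarrow> real" where
    QR': "\<forall>i < m. \<forall>j < k. M i j = (\<Sum>l < k. Q i l * R l j)" and
    QQ': "\<forall>a < k. \<forall>b < k. (\<Sum>i < m. Q i a * Q i b) = (if a = b then 1 else 0)" and
    R': "\<forall>a < k. \<forall>b < a. R a b = 0" and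
    S': "\<forall>i < m. \<forall>l < k. Q i l = (\<Sum>j < k. M i j * S j l)"
    by (elim exE conjE)
  note QR = QR'[rule_format] and QQ = QQ'[rule_format] and R = R'[rule_format] and S = S'[rule_format]
  \<comment> \<open>\<open>c\<close> holds the coefficients of column \<open>k\<close> along the
    earlier columns of \<open>Q\<close>, \<open>w\<close> is the residual, and \<open>u\<close> are
    the coefficients of \<open>w\<close> in the columns of \<open>M\<close>.\<close>
  define c where "c l = (\<Sum>i < m. Q i l * M i k)" for l
  define w where "w i = M i k - (\<Sum>l < k. Q i l * c l)" for i
  define u where "u j = (if j < k then - (\<Sum>l < k. S j l * c l) else if j = k then 1 else 0)" for j
  have wu: "w i = (\<Sum>j < Suc k. M i j * u j)" if "i < m" for i
  proof -
    have "(\<Sum>l < k. Q i l * c l) = (\<Sum>l < k. \<Sum>j < k. M i j * (S j l * c l))"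
      using S[OF that] by (simp add: sum_distrib_right mult.assoc)
    also have "\<dots> = (\<Sum>j < k. M i j * (\<Sum>l < k. S j l * c l))"
      by (subst sum.swap) (simp add: sum_distrib_left)
    finally show ?thesis
      by (simp add: w_def u_def sum_negf)
  qed
  \<comment> \<open>Were the residual zero, \<open>u\<close> would be a relation between the columns
    with coefficient 1 at \<open>k\<close>.\<close>
  have "\<exists>i < m. w i \<noteq> 0"
  proof (rule ccontr)
    assume "\<not> ?thesis"
    then have "(\<Sum>j < Suc k. M i j * u j) = 0" if "i < m" for i
      using wu[OF that] that by simp
    moreover have "(\<Sum>j < N. M i j * u j) = (\<Sum>j < Suc k. M i j * u j)" for i
      using Suc.prems by (intro sum.mono_neutral_right) (auto simp: u_def)
    ultimately have "u k = 0"
      using Suc.prems indep[rule_format, of u k] by auto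
    then show False
      by (simp add: u_def)
  qed
  then have pos: "0 < (\<Sum>i < m. (w i)\<^sup>2)"
    by (auto intro!: sum_pos2)
  define \<nu> where "\<nu> = sqrt (\<Sum>i < m. (w i)\<^sup>2)"
  have \<nu>: "\<nu> > 0" "\<nu> * \<nu> = (\<Sum>i < m. w i * w i)"
    using pos by (auto simp: \<nu>_def power2_eq_square)
  have Qw: "(\<Sum>i < m. Q i a * w i) = 0" if "a < k" for a
  proof -
    have "(\<Sum>i < m. Q i a * w i) = c a - (\<Sum>i < m. \<Sum>l < k. Q i a * Q i l * c l)"
      by (simp add: w_def c_def right_diff_distrib sum_subtractf sum_distrib_left mult.assoc)
    also have "(\<Sum>i < m. \<Sum>l < k. Q i a * Q i l * c l) = (\<Sum>l < k. (\<Sum>i < m. Q i a * Q i l) * c l)"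
      by (subst sum.swap) (simp add: sum_distrib_right)
    also have "\<dots> = (\<Sum>l < k. if a = l then c l else 0)"
      using that by (intro sum.cong) (auto simp: QQ)
    finally show ?thesis
      using that by simp
  qed
  define Q' where "Q' i l = (if l < k then Q i l else w i / \<nu>)" for i l
  define R' where "R' l j = (if j < k then (if l < k then R l j else 0) else if l < k then c l else \<nu>)" for l j
  define S' where "S' j l = (if l < k then (if j < k then S j l else 0) else u j / \<nu>)" for j l
  have 1: "M i j = (\<Sum>l < Suc k. Q' i l * R' l j)" if "i < m" "j < Suc k" for i j
    using that \<nu> QR[of i j] by (cases "j < k") (auto simp: Q'_def R'_def w_def less_Suc_eq)
  have 2: "(\<Sum>i < m. Q' i a * Q' i b) = (if a = b then 1 else 0)" if ab: "a < Suc k" "b < Suc k" for a b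
  proof -
    consider "a < k" "b < k" | "a < k" "b = k" | "a = k" "b < k" | "a = k" "b = k"
      using ab by linarith
    then show ?thesis
    proof cases
      case 2
      then show ?thesis
        using Qw by (simp add: Q'_def flip: sum_divide_distrib)
    next
      case 3
      then show ?thesis
        using Qw by (simp add: Q'_def mult.commute flip: sum_divide_distrib)
    next
      case 4
      then show ?thesis
        using \<nu>(1) by (simp add: Q'_def flip: sum_divide_distrib \<nu>(2))
    qed (simp add: Q'_def QQ)
  qed
  have 3: "R' a b = 0" if "a < Suc k" "b < a" for a b
    using that R by (auto simp: R'_def less_Suc_eq)
  have 4: "Q' i l = (\<Sum>j < Suc k. M i j * S' j l)" if "i < m" "l < Suc k" for i l
  proof (cases "l < k")
    case False
    then have "Q' i l = (\<Sum>j < Suc k. M i j * u j) / \<nu>"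
      using wu[OF that(1)] by (simp add: Q'_def)
    also have "\<dots> = (\<Sum>j < Suc k. M i j * S' j l)"
      unfolding sum_divide_distrib using False by (intro sum.cong) (auto simp: S'_def)
    finally show ?thesis .
  qed (use that S in \<open>auto simp: Q'_def S'_def\<close>)
  show ?case
    by (rule exI[of _ Q'], rule exI[of _ R'], rule exI[of _ S'],
        intro conjI allI impI; rule 1 2 3 4; assumption)
qed simp

lemma QR_exists:
  assumes "left_invertible M"
  shows "\<exists>Q R. is_QR M Q R"
proof -
  let ?m = "dim_row M" and ?n = "dim_col M"
  obtain L where L: "L \<in> carrier_mat ?n ?m" "L * M = 1\<^sub>m ?n"
    using assms by (auto simp: left_invertible_def)
  have indep: "u j = 0" if u: "\<And>i. i < ?m \<Longrightarrow> (\<Sum>j < ?n. M $$ (i, j) * u j) = 0" and j: "j < ?n" for u :: "nat \<Rightarrow> real" and j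
  proof -
    let ?u = "vec ?n u"
    have "M *\<^sub>v ?u = 0\<^sub>v ?m"
      using u by (intro eq_vecI) (auto simp: scalar_prod_def atLeast0LessThan)
    then have "L *\<^sub>v (M *\<^sub>v ?u) = 0\<^sub>v ?n"
      using L by (intro eq_vecI) auto
    then have "(L * M) *\<^sub>v ?u = 0\<^sub>v ?n"
      using L by (subst assoc_mult_mat_vec) auto
    then have "?u $ j = 0"
      using L j by simp
    then show ?thesis
      using j by simp
  qed
  have "\<forall>u. (\<forall>i < ?m. (\<Sum>j < ?n. M $$ (i, j) * u j) = 0) \<longrightarrow> (\<forall>j < ?n. u j = 0)"
    using indep by blast
  from gram_schmidt_functions[OF this, of ?n]
  obtain Q R :: "nat \<Rightarrow> nat \<Rightarrow> real" where
    QR: "\<forall>i < ?m. \<forall>j < ?n. M $$ (i, j) = (\<Sum>l < ?n. Q i l * R l j)"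
    and QQ: "\<forall>a < ?n. \<forall>b < ?n. (\<Sum>i < ?m. Q i a * Q i b) = (if a = b then 1 else 0)"
    and R: "\<forall>a < ?n. \<forall>b < a. R a b = 0"
    by auto
  let ?Q = "mat ?m ?n (\<lambda>(i, j). Q i j)" and ?R = "mat ?n ?n (\<lambda>(i, j). R i j)"
  have "M = ?Q * ?R"
    using QR by (intro eq_matI) (auto simp: scalar_prod_def atLeast0LessThan)
  moreover have "orthonormal_cols ?Q"
    unfolding orthonormal_cols_def using QQ by (intro eq_matI) (auto simp: scalar_prod_def atLeast0LessThan)
  moreover have "upper_triangular ?R"
    using R by auto
  ultimately have "is_QR M ?Q ?R"
    by (simp add: is_QR_def)
  then show ?thesis
    by blast
qed

section \<open>Linear maps along differentiable paths\<close>

text \<open>Uniqueness of solutions reduces to this, because the derivative of every solution is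
  here a given function of time.\<close>

lemma same_derivative_increment:
  fixes f g d :: "real \<Rightarrow> real"
  assumes "a < b"
    and f: "\<And>t. t \<in> {a..b} \<Longrightarrow> (f has_real_derivative d t) (at t within {a..b})"
    and g: "\<And>t. t \<in> {a..b} \<Longrightarrow> (g has_real_derivative d t) (at t within {a..b})"
  shows "f b - f a = g b - g a"
proof -
  let ?h = "\<lambda>t. f t - g t"
  have h: "(?h has_real_derivative 0) (at t within {a..b})" if "t \<in> {a..b}" for t
    using DERIV_diff[OF f[OF that] g[OF that]] by simp
  have "?h b = ?h a"
  proof (rule DERIV_isconst_end[OF \<open>a < b\<close>])
    show "continuous_on {a..b} ?h"
      using h DERIV_continuous continuous_on_eq_continuous_within by blast
    fix x assume "a < x" "x < b"
    then show "DERIV ?h x :> 0"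
      using h[of x] at_within_Icc_at[of a x b] by simp
  qed
  then show ?thesis
    by simp
qed

lemma has_real_derivative_transform:
  assumes "t \<in> T" "\<And>s. s \<in> T \<Longrightarrow> g s = f s" "(f has_real_derivative d) (at t within T)"
  shows "(g has_real_derivative d) (at t within T)"
  using assms unfolding has_field_derivative_def by (rule has_derivative_transform)

text \<open>Linearity by explicit coefficients, and only on \<open>tensor_space ds\<close>:
  derivatives and continuity along a path then follow from those of finitely many entries.\<close>

definition linear_form :: "nat list \<Rightarrow> (tensor \<Rightarrow> real) \<Rightarrow> bool" where
  "linear_form ds \<phi> \<longleftrightarrow> (\<exists>c. \<forall>A \<in> tensor_space ds. \<phi> A = (\<Sum>ks \<in> indices ds. c ks * tentry A ks))"

lemma linear_form_cong:
  assumes "linear_form ds \<psi>" "\<And>A. A \<in> tensor_space ds \<Longrightarrow> \<phi> A = \<psi> A"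
  shows "linear_form ds \<phi>"
  using assms by (simp add: linear_form_def)

lemma linear_form_entry:
  assumes "ks \<in> indices ds"
  shows "linear_form ds (\<lambda>A. tentry A ks)"
  unfolding linear_form_def
  by (rule exI[of _ "\<lambda>ls. if ls = ks then 1 else 0"]) (use assms in \<open>simp add: if_distrib[of "\<lambda>x. x * _"] cong: if_cong\<close>)

lemma linear_form_cmult: "linear_form ds \<phi> \<Longrightarrow> linear_form ds (\<lambda>A. a * \<phi> A)"
  unfolding linear_form_def
  by (elim exE, rule_tac x = "\<lambda>ks. a * c ks" in exI) (simp add: sum_distrib_left mult.assoc)

lemma linear_form_sum:
  assumes "finite I" "\<And>x. x \<in> I \<Longrightarrow> linear_form ds (\<phi> x)"
  shows "linear_form ds (\<lambda>A. \<Sum>x \<in> I. \<phi> x A)"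
proof -
  have "\<exists>c. \<forall>A \<in> tensor_space ds. \<phi> x A = (\<Sum>ks \<in> indices ds. c ks * tentry A ks)" if "x \<in> I" for x
    using assms(2)[OF that] by (simp add: linear_form_def)
  then obtain c where c: "\<And>x A. x \<in> I \<Longrightarrow> A \<in> tensor_space ds \<Longrightarrow> \<phi> x A = (\<Sum>ks \<in> indices ds. c x ks * tentry A ks)"
    by metis
  have "(\<Sum>x \<in> I. \<phi> x A) = (\<Sum>ks \<in> indices ds. (\<Sum>x \<in> I. c x ks) * tentry A ks)" if "A \<in> tensor_space ds" for A
  proof -
    have "(\<Sum>x \<in> I. \<phi> x A) = (\<Sum>x \<in> I. \<Sum>ks \<in> indices ds. c x ks * tentry A ks)"
      using that by (simp add: c)
    also have "\<dots> = (\<Sum>ks \<in> indices ds. \<Sum>x \<in> I. c x ks * tentry A ks)"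
      by (rule sum.swap)
    finally show ?thesis
      by (simp add: sum_distrib_right)
  qed
  then show ?thesis
    unfolding linear_form_def by (intro exI[of _ "\<lambda>ks. \<Sum>x \<in> I. c x ks"] ballI)
qed

lemma linear_form_Mat:
  assumes "i < length ds" "k < ds ! i" "c < prod_list (del_nth i ds)"
  shows "linear_form ds (\<lambda>A. Mat i A $$ (k, c))"
proof (rule linear_form_cong)
  show "linear_form ds (\<lambda>A. tentry A (ins_nth i k (uncolex (del_nth i ds) c)))"
    using assms by (intro linear_form_entry ins_nth_indices uncolex_indices)
qed (use assms in \<open>simp add: Mat_def tensor_space_dims\<close>)

lemma linear_form_mat_mult:
  assumes P: "P \<in> carrier_mat n k" and ab: "a < n" "b < m"
    and G: "\<And>A. A \<in> tensor_space ds \<Longrightarrow> G A \<in> carrier_mat k m"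
    and lin: "\<And>l. l < k \<Longrightarrow> linear_form ds (\<lambda>A. G A $$ (l, b))"
  shows "linear_form ds (\<lambda>A. (P * G A) $$ (a, b))"
proof (rule linear_form_cong)
  show "linear_form ds (\<lambda>A. \<Sum>l \<in> {0..<k}. P $$ (a, l) * G A $$ (l, b))"
    by (intro linear_form_sum linear_form_cmult lin) auto
  fix A assume "A \<in> tensor_space ds"
  from G[OF this] show "(P * G A) $$ (a, b) = (\<Sum>l \<in> {0..<k}. P $$ (a, l) * G A $$ (l, b))"
    using P ab by (auto simp: scalar_prod_def)
qed

definition linear_tensor_map :: "nat list \<Rightarrow> nat list \<Rightarrow> (tensor \<Rightarrow> tensor) \<Rightarrow> bool" where
  "linear_tensor_map ds es L \<longleftrightarrow> (\<forall>A \<in> tensor_space ds. L A \<in> tensor_space es)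
     \<and> (\<forall>ks \<in> indices es. linear_form ds (\<lambda>A. tentry (L A) ks))"

lemma linear_form_compose:
  assumes L: "linear_tensor_map ds es L" and \<phi>: "linear_form es \<phi>"
  shows "linear_form ds (\<lambda>A. \<phi> (L A))"
proof -
  obtain c where c: "\<forall>A \<in> tensor_space es. \<phi> A = (\<Sum>ks \<in> indices es. c ks * tentry A ks)"
    using \<phi> by (auto simp: linear_form_def)
  show ?thesis
  proof (rule linear_form_cong)
    show "linear_form ds (\<lambda>A. \<Sum>ks \<in> indices es. c ks * tentry (L A) ks)"
      using L by (intro linear_form_sum linear_form_cmult) (auto simp: linear_tensor_map_def)
  qed (use L c in \<open>auto simp: linear_tensor_map_def\<close>)
qed

lemma linear_tensor_map_compose:
  assumes "linear_tensor_map ds es L" "linear_tensor_map es fs K"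
  shows "linear_tensor_map ds fs (\<lambda>A. K (L A))"
  unfolding linear_tensor_map_def
proof (intro conjI ballI)
  fix ks assume "ks \<in> indices fs"
  then have "linear_form es (\<lambda>A. tentry (K A) ks)"
    using assms(2) by (simp add: linear_tensor_map_def)
  from linear_form_compose[OF assms(1) this] show "linear_form ds (\<lambda>A. tentry (K (L A)) ks)" .
qed (use assms in \<open>auto simp: linear_tensor_map_def\<close>)

lemma linear_mode_prod:
  assumes "i < length ds" "M \<in> carrier_mat d (ds ! i)"
  shows "linear_tensor_map ds (ds[i := d]) (\<lambda>A. mode_prod A i M)"
  unfolding linear_tensor_map_def
proof (intro conjI ballI)
  fix ks assume ks: "ks \<in> indices (ds[i := d])"
  show "linear_form ds (\<lambda>A. tentry (mode_prod A i M) ks)"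
  proof (rule linear_form_cong)
    show "linear_form ds (\<lambda>A. \<Sum>l < ds ! i. M $$ (ks ! i, l) * tentry A (ks[i := l]))"
      using ks assms by (intro linear_form_sum linear_form_cmult linear_form_entry) (auto intro: indices_update_same)
  qed (use ks assms in \<open>simp add: tentry_mode_prod\<close>)
qed (use assms mode_prod_closed in auto)

lemma linear_multi_prod:
  "multi_compat ds js f M \<Longrightarrow> linear_tensor_map ds (upd_dims ds js f) (\<lambda>A. multi_prod A js M)"
proof (induction js arbitrary: ds)
  case (Cons j js)
  then have j: "j \<notin> set js" "Suc j < length ds" "M j \<in> carrier_mat (f j) (ds ! Suc j)"
    "multi_compat (ds[Suc j := f j]) js f M"
    by (auto simp: multi_compat_Cons)
  from linear_tensor_map_compose[OF linear_mode_prod[OF j(2,3)] Cons.IH[OF j(4)]]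
  show ?case
    using j by (simp add: upd_dims_Cons)
qed (simp add: linear_tensor_map_def linear_form_entry)

lemma linear_form_derivative:
  assumes "linear_form ds \<phi>" "tensor_C1 ds t\<^sub>0 t\<^sub>1 A A'" "t \<in> {t\<^sub>0..t\<^sub>1}"
  shows "((\<lambda>s. \<phi> (A s)) has_real_derivative \<phi> (A' t)) (at t within {t\<^sub>0..t\<^sub>1})"
proof -
  obtain c where c: "\<And>B. B \<in> tensor_space ds \<Longrightarrow> \<phi> B = (\<Sum>ks \<in> indices ds. c ks * tentry B ks)"
    using assms(1) by (auto simp: linear_form_def)
  have "((\<lambda>s. \<Sum>ks \<in> indices ds. c ks * tentry (A s) ks) has_real_derivative
      (\<Sum>ks \<in> indices ds. c ks * tentry (A' t) ks)) (at t within {t\<^sub>0..t\<^sub>1})"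
    using assms(2,3) by (intro DERIV_sum DERIV_cmult) (auto simp: tensor_C1_def tensor_has_derivative_def)
  also have "(\<Sum>ks \<in> indices ds. c ks * tentry (A' t) ks) = \<phi> (A' t)"
    using assms(2,3) by (simp add: tensor_C1_def c)
  finally show ?thesis
    by (rule has_real_derivative_transform[OF assms(3), rotated]) (use assms(2) in \<open>simp add: tensor_C1_def c\<close>)
qed

lemma tensor_C1_linear:
  assumes L: "linear_tensor_map ds es L" and A: "tensor_C1 ds t\<^sub>0 t\<^sub>1 A A'"
  shows "tensor_C1 es t\<^sub>0 t\<^sub>1 (\<lambda>t. L (A t)) (\<lambda>t. L (A' t))"
  unfolding tensor_C1_def tensor_has_derivative_def
proof (intro conjI ballI)
  fix t assume t: "t \<in> {t\<^sub>0..t\<^sub>1}"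
  show "L (A t) \<in> tensor_space es" "L (A' t) \<in> tensor_space es"
    using L A t by (auto simp: linear_tensor_map_def tensor_C1_def)
  fix ks assume "ks \<in> indices es"
  then have "linear_form ds (\<lambda>A. tentry (L A) ks)"
    using L by (simp add: linear_tensor_map_def)
  from linear_form_derivative[OF this A t]
  show "((\<lambda>t. tentry (L (A t)) ks) has_real_derivative tentry (L (A' t)) ks) (at t within {t\<^sub>0..t\<^sub>1})" .
next
  fix ks assume "ks \<in> indices es"
  then obtain c where c: "\<And>B. B \<in> tensor_space ds \<Longrightarrow> tentry (L B) ks = (\<Sum>ls \<in> indices ds. c ls * tentry B ls)"
    using L by (auto simp: linear_tensor_map_def linear_form_def)
  have "continuous_on {t\<^sub>0..t\<^sub>1} (\<lambda>t. \<Sum>ls \<in> indices ds. c ls * tentry (A' t) ls)"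
    using A by (intro continuous_intros) (auto simp: tensor_C1_def)
  then show "continuous_on {t\<^sub>0..t\<^sub>1} (\<lambda>t. tentry (L (A' t)) ks)"
    using A by (subst continuous_on_cong[OF refl c]) (auto simp: tensor_C1_def)
qed

section \<open>Differential equations whose field ignores the unknown\<close>

lemma solves_constant_tensor_ode:
  assumes "tensor_C1 ds t\<^sub>0 t\<^sub>1 A A'"
  shows "solves_tensor_ode ds (\<lambda>t Y. A' t) t\<^sub>0 t\<^sub>1 (A t\<^sub>0) A"
  using assms by (simp add: solves_tensor_ode_def tensor_C1_def)

lemma constant_tensor_ode_unique:
  assumes "t\<^sub>0 < t\<^sub>1" and A: "tensor_C1 ds t\<^sub>0 t\<^sub>1 A A'"
    and Y: "solves_tensor_ode ds (\<lambda>t Y. A' t) t\<^sub>0 t\<^sub>1 (A t\<^sub>0) Y"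
  shows "Y t\<^sub>1 = A t\<^sub>1"
proof (rule tensor_eqI)
  show "Y t\<^sub>1 \<in> tensor_space ds" "A t\<^sub>1 \<in> tensor_space ds"
    using assms by (auto simp: solves_tensor_ode_def tensor_C1_def)
  fix ks assume "ks \<in> indices ds"
  then have "tentry (Y t\<^sub>1) ks - tentry (Y t\<^sub>0) ks = tentry (A t\<^sub>1) ks - tentry (A t\<^sub>0) ks"
    using assms
    by (intro same_derivative_increment[where d = "\<lambda>t. tentry (A' t) ks"])
      (auto simp: solves_tensor_ode_def tensor_C1_def tensor_has_derivative_def)
  then show "tentry (Y t\<^sub>1) ks = tentry (A t\<^sub>1) ks"
    using Y by (simp add: solves_tensor_ode_def)
qed

text \<open>As \<open>G\<close> is linear, integrating \<open>- G (A' t)\<close> yields minus the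
  increment of \<open>G\<close> along the path.\<close>

lemma constant_mat_ode:
  assumes "t\<^sub>0 < t\<^sub>1" and A: "tensor_C1 ds t\<^sub>0 t\<^sub>1 A A'"
    and G: "\<And>B. B \<in> tensor_space ds \<Longrightarrow> G B \<in> carrier_mat k k"
    and lin: "\<And>a b. a < k \<Longrightarrow> b < k \<Longrightarrow> linear_form ds (\<lambda>B. G B $$ (a, b))"
  shows constant_mat_ode_exists: "S\<^sub>0 \<in> carrier_mat k k \<Longrightarrow>
      \<exists>S. solves_mat_ode k (\<lambda>t S. - G (A' t)) t\<^sub>0 t\<^sub>1 S\<^sub>0 S"
    and constant_mat_ode_unique: "solves_mat_ode k (\<lambda>t S. - G (A' t)) t\<^sub>0 t\<^sub>1 S\<^sub>0 S
      \<Longrightarrow> S t\<^sub>1 = S\<^sub>0 - (G (A t\<^sub>1) - G (A t\<^sub>0))"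
proof -
  have mem: "A t \<in> tensor_space ds" "A' t \<in> tensor_space ds" if "t \<in> {t\<^sub>0..t\<^sub>1}" for t
    using A that by (auto simp: tensor_C1_def)
  have t01: "t\<^sub>0 \<in> {t\<^sub>0..t\<^sub>1}" "t\<^sub>1 \<in> {t\<^sub>0..t\<^sub>1}"
    using \<open>t\<^sub>0 < t\<^sub>1\<close> by auto
  have der: "((\<lambda>s. - G (A s) $$ (a, b)) has_real_derivative (- G (A' t)) $$ (a, b)) (at t within {t\<^sub>0..t\<^sub>1})"
    if "t \<in> {t\<^sub>0..t\<^sub>1}" "a < k" "b < k" for t a b
    using linear_form_derivative[OF lin[OF that(2,3)] A that(1)] G[OF mem(2)[OF that(1)]] that
    by (auto intro!: derivative_eq_intros)
  note Gc = G[OF mem(1)]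
  {
    assume S0: "S\<^sub>0 \<in> carrier_mat k k"
    \<comment> \<open>Both branches agree on \<open>k\<close> by \<open>k\<close> matrices; the case
      at \<open>t\<^sub>0\<close> makes the initial condition literal.\<close>
    define S where "S t = (if t = t\<^sub>0 then S\<^sub>0 else S\<^sub>0 - (G (A t) - G (A t\<^sub>0)))" for t
    have S: "S t = S\<^sub>0 - (G (A t) - G (A t\<^sub>0))" if "t \<in> {t\<^sub>0..t\<^sub>1}" for t
      using S0 Gc[OF t01(1)] by (auto simp: S_def)
    have "((\<lambda>s. S s $$ (a, b)) has_real_derivative (- G (A' t)) $$ (a, b)) (at t within {t\<^sub>0..t\<^sub>1})"
      if t: "t \<in> {t\<^sub>0..t\<^sub>1}" and ab: "a < k" "b < k" for t a b
    proof (rule has_real_derivative_transform[OF t])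
      show "((\<lambda>s. (S\<^sub>0 $$ (a, b) + G (A t\<^sub>0) $$ (a, b)) + - G (A s) $$ (a, b)) has_real_derivative (- G (A' t)) $$ (a, b))
          (at t within {t\<^sub>0..t\<^sub>1})"
        using DERIV_add[OF DERIV_const der[OF t ab]] by simp
      show "S s $$ (a, b) = (S\<^sub>0 $$ (a, b) + G (A t\<^sub>0) $$ (a, b)) + - G (A s) $$ (a, b)" if "s \<in> {t\<^sub>0..t\<^sub>1}" for s
        using S[OF that] S0 Gc[OF that] Gc[OF t01(1)] ab by simp
    qed
    moreover have "S t \<in> carrier_mat k k" if "t \<in> {t\<^sub>0..t\<^sub>1}" for t
      unfolding S[OF that] using Gc[OF t01(1)] by (intro minus_carrier_mat)
    ultimately have "solves_mat_ode k (\<lambda>t S. - G (A' t)) t\<^sub>0 t\<^sub>1 S\<^sub>0 S"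
      by (simp add: solves_mat_ode_def S_def)
    then show "\<exists>S. solves_mat_ode k (\<lambda>t S. - G (A' t)) t\<^sub>0 t\<^sub>1 S\<^sub>0 S"
      by blast
  }
  assume S: "solves_mat_ode k (\<lambda>t S. - G (A' t)) t\<^sub>0 t\<^sub>1 S\<^sub>0 S"
  then have c: "S t\<^sub>1 \<in> carrier_mat k k" "S\<^sub>0 \<in> carrier_mat k k" "S t\<^sub>0 = S\<^sub>0"
    using t01 by (auto simp: solves_mat_ode_def)
  show "S t\<^sub>1 = S\<^sub>0 - (G (A t\<^sub>1) - G (A t\<^sub>0))"
  proof (rule eq_matI)
    fix a b assume "a < dim_row (S\<^sub>0 - (G (A t\<^sub>1) - G (A t\<^sub>0)))" "b < dim_col (S\<^sub>0 - (G (A t\<^sub>1) - G (A t\<^sub>0)))"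
    then have ab: "a < k" "b < k"
      using Gc[OF t01(1)] by auto
    have "S t\<^sub>1 $$ (a, b) - S t\<^sub>0 $$ (a, b) = - G (A t\<^sub>1) $$ (a, b) - - G (A t\<^sub>0) $$ (a, b)"
      using S ab der by (intro same_derivative_increment[OF \<open>t\<^sub>0 < t\<^sub>1\<close>, where d = "\<lambda>t. (- G (A' t)) $$ (a, b)"])
        (auto simp: solves_mat_ode_def)
    then show "S t\<^sub>1 $$ (a, b) = (S\<^sub>0 - (G (A t\<^sub>1) - G (A t\<^sub>0))) $$ (a, b)"
      using Gc[OF t01(1)] Gc[OF t01(2)] c ab by simp
  qed (use c Gc[OF t01(1)] in auto)
qed

section \<open>Projections and invertible factors\<close>

lemma Mat_eq_factor_projection:
  assumes X: "X \<in> tensor_space ds" and k: "k < length ds" and U: "U \<in> carrier_mat (ds ! k) p"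
    and UU: "transpose_mat U * U = 1\<^sub>m p"
    and B: "B \<in> carrier_mat p (prod_list (del_nth k ds))" "Mat k X = U * B"
  shows "mode_prod X k (U * transpose_mat U) = X"
proof (rule Mat_inject)
  have P: "U * transpose_mat U \<in> carrier_mat (ds ! k) (ds ! k)"
    using U by simp
  show "mode_prod X k (U * transpose_mat U) \<in> tensor_space ds"
    using mode_prod_closed[OF X P, of k] by simp
  have UB: "U * B \<in> carrier_mat (ds ! k) (prod_list (del_nth k ds))"
    using U B(1) by simp
  have "Mat k (mode_prod X k (U * transpose_mat U)) = (U * transpose_mat U) * (U * B)"
    using X k P B by (simp add: Mat_mode_prod)
  \<comment> \<open>The projector sends \<open>U * B\<close> to \<open>U (U^T U) B\<close>, whose
    middle factor is the identity.\<close>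
  also have "\<dots> = U * (transpose_mat U * (U * B))"
    by (rule assoc_mult_mat[of U "ds ! k" p "transpose_mat U" "ds ! k"]) (use U UB in auto)
  also have "transpose_mat U * (U * B) = B"
    by (rule mult_mat_cancel[of _ p "ds ! k"]) (use U UU B in auto)
  finally show "Mat k (mode_prod X k (U * transpose_mat U)) = Mat k X"
    using B by simp
qed (use X k in auto)

lemma mode_prod_projection:
  assumes Z: "Z \<in> tensor_space ds" and k: "k < length ds" and U: "U \<in> carrier_mat d (ds ! k)"
    and UU: "transpose_mat U * U = 1\<^sub>m (ds ! k)"
  shows "mode_prod (mode_prod Z k U) k (U * transpose_mat U) = mode_prod Z k U"
  by (rule Mat_eq_factor_projection[OF mode_prod_closed[OF Z U], where p = "ds ! k" and B = "Mat k Z"])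
    (use assms Mat_carrier[OF Z, of k] in \<open>auto simp: Mat_mode_prod del_nth_update\<close>)

lemma gram_commute:
  assumes "X \<in> tensor_space ds" "Y \<in> tensor_space (ds[i := e])" "i < length ds"
  shows "gram i X Y = transpose_mat (gram i Y X)"
  using Mat_carrier[OF assms(1), of i] Mat_carrier[OF assms(2), of i] assms(3)
  unfolding gram_def
  by (subst transpose_mult[of _ e "prod_list (del_nth i ds)"]) (auto simp: del_nth_update)

text \<open>\<open>L * A\<close> and \<open>N\<close> are square, so the right inverse
  \<open>N\<close> of \<open>L * A\<close> is also a left inverse, which makes \<open>N * L\<close>
  a left inverse of \<open>A\<close>.\<close>

lemma left_invertible_sandwich:
  assumes "L \<in> carrier_mat r p" "A \<in> carrier_mat p r" "N \<in> carrier_mat r r" "L * A * N = 1\<^sub>m r"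
  shows "left_invertible A"
proof (rule left_invertibleI[OF assms(2)])
  have LA: "L * A \<in> carrier_mat r r"
    using assms by simp
  have "N * (L * A) = 1\<^sub>m r"
    using mat_mult_left_right_inverse[OF LA assms(3,4)] .
  then show "(N * L) * A = 1\<^sub>m r"
    using assms by simp
qed (use assms in auto)

text \<open>The product \<open>E * G\<close> has rank \<open>r\<close>, so no factorization of it
  through dimension \<open>r\<close> has a deficient factor: with a left inverse \<open>L\<close> of
  \<open>E\<close> and a right inverse \<open>D\<close> of \<open>G\<close>, the product of
  \<open>L * E'\<close> and \<open>G' * D\<close> is the identity. Full rank passes in this way from
  the reference pair to the tensors of an actual run.\<close>

lemma left_invertible_factorization:
  assumes E: "E \<in> carrier_mat p r" "left_invertible E" and G: "G \<in> carrier_mat r q" "left_invertible (transpose_mat G)"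
    and E': "E' \<in> carrier_mat p r" and G': "G' \<in> carrier_mat r q" and eq: "E' * G' = E * G"
  shows "left_invertible E'" "left_invertible (transpose_mat G')"
proof -
  obtain L where L: "L \<in> carrier_mat r p" "L * E = 1\<^sub>m r"
    using E left_invertibleE by blast
  obtain D' where D': "D' \<in> carrier_mat r q" "D' * transpose_mat G = 1\<^sub>m r"
    using G left_invertibleE[OF G(2), of q r] by auto
  define D where "D = transpose_mat D'"
  have "transpose_mat (D' * transpose_mat G) = G * D"
    using D'(1) G(1) transpose_mult[of D' r q "transpose_mat G" r] by (simp add: D_def)
  then have D: "D \<in> carrier_mat q r" "G * D = 1\<^sub>m r"
    unfolding D'(2) transpose_one using D'(1) by (simp_all add: D_def)
  have "(L * E') * (G' * D) = L * (E' * (G' * D))"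
    by (rule assoc_mult_mat[OF L(1) E']) (use G' D in auto)
  also have "E' * (G' * D) = (E' * G') * D"
    using assoc_mult_mat[OF E' G' D(1)] by simp
  also have "\<dots> = E * (G * D)"
    unfolding eq using assoc_mult_mat[OF E(1) G(1) D(1)] .
  finally have 1: "(L * E') * (G' * D) = 1\<^sub>m r"
    using D L E by simp
  show "left_invertible E'"
    by (rule left_invertible_sandwich[OF L(1) E' _ 1]) (use G' D in auto)
  have "transpose_mat D * transpose_mat G' * transpose_mat (L * E') = transpose_mat ((L * E') * (G' * D))"
    using L E' G' D transpose_mult[of "L * E'" r r "G' * D" r] transpose_mult[of G' r q D r] by simp
  then have "transpose_mat D * transpose_mat G' * transpose_mat (L * E') = 1\<^sub>m r"
    using 1 by simp
  then show "left_invertible (transpose_mat G')"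
    by (intro left_invertible_sandwich[of "transpose_mat D" r q _ "transpose_mat (L * E')"]) (use L E' G' D in auto)
qed

section \<open>Frames at a node\<close>

lemma vdims_simps [simp]:
  "vdims n r \<tau> ! 0 = r \<tau>" "prod_list (del_nth 0 (vdims n r \<tau>)) = tree_dim n \<tau>" "0 < length (vdims n r \<tau>)"
  "vdims n r \<tau> \<noteq> []"
  by (cases \<tau>; simp)+

lemma vdims_Node_simps [simp]:
  "i < length ts \<Longrightarrow> vdims n r (Node ts) ! Suc i = tree_dim n (ts ! i)"
  "length (vdims n r (Node ts)) = Suc (length ts)"
  by auto

lemma Mat_0_vdims_carrier:
  "X \<in> tensor_space (vdims n r \<tau>) \<Longrightarrow> Mat 0 X \<in> carrier_mat (r \<tau>) (tree_dim n \<tau>)"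
  using Mat_carrier[of X "vdims n r \<tau>" 0] by simp

text \<open>The bases form a function, so that exchanging the basis of one subtree is a function
  update.\<close>

locale node_bases =
  fixes n :: "'l \<Rightarrow> nat" and r :: "'l ttree \<Rightarrow> nat" and ts :: "'l ttree list" and U :: "nat \<Rightarrow> real mat"
  assumes U: "\<And>j. j < length ts \<Longrightarrow> U j \<in> carrier_mat (tree_dim n (ts ! j)) (r (ts ! j))"
begin

abbreviation "cdims \<equiv> r (Node ts) # map r ts"
abbreviation "ndims \<equiv> vdims n r (Node ts)"
abbreviation "others i \<equiv> filter (\<lambda>j. j \<noteq> i) [0..<length ts]"

lemma compat: "distinct js \<Longrightarrow> (\<And>j. j \<in> set js \<Longrightarrow> j < length ts) \<Longrightarrow> multi_compat cdims js (\<lambda>j. tree_dim n (ts ! j)) U"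
  using U by (auto simp: multi_compat_def)

lemma compat_transpose: "distinct js \<Longrightarrow> (\<And>j. j \<in> set js \<Longrightarrow> j < length ts) \<Longrightarrow>
    multi_compat ndims js (\<lambda>j. r (ts ! j)) (\<lambda>j. transpose_mat (U j))"
  using U by (auto simp: multi_compat_def)

lemma upd_dims_cdims: "upd_dims cdims [0..<length ts] (\<lambda>j. tree_dim n (ts ! j)) = ndims"
  by (rule upd_dims_eqI) auto

lemma upd_dims_ndims: "upd_dims ndims [0..<length ts] (\<lambda>j. r (ts ! j)) = cdims"
  by (rule upd_dims_eqI) auto

lemma upd_dims_others:
  "i < length ts \<Longrightarrow> upd_dims cdims (others i) (\<lambda>j. tree_dim n (ts ! j)) = ndims[Suc i := r (ts ! i)]"
  by (rule upd_dims_eqI) (auto simp: nth_list_update)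

lemma upd_dims_others':
  "i < length ts \<Longrightarrow> upd_dims ndims (others i) (\<lambda>j. r (ts ! j)) = cdims[Suc i := tree_dim n (ts ! i)]"
  by (rule upd_dims_eqI) (auto simp: nth_list_update)

lemma node_tensor_closed: "C \<in> tensor_space cdims \<Longrightarrow> multi_prod C [0..<length ts] U \<in> tensor_space ndims"
  using multi_prod_closed[OF _ compat, of C "[0..<length ts]"] by (auto simp: upd_dims_cdims)

lemma node_tensor_remove:
  assumes "C \<in> tensor_space cdims" "i < length ts"
  shows "multi_prod C [0..<length ts] U = mode_prod (multi_prod C (others i) U) (Suc i) (U i)"
    and "multi_prod C (others i) U \<in> tensor_space (ndims[Suc i := r (ts ! i)])"
proof -
  show "multi_prod C [0..<length ts] U = mode_prod (multi_prod C (others i) U) (Suc i) (U i)"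
    using assms compat[of "[0..<length ts]"] by (intro multi_prod_remove) auto
  have "multi_compat cdims (others i) (\<lambda>j. tree_dim n (ts ! j)) U"
    by (rule compat) auto
  from multi_prod_closed[OF assms(1) this]
  show "multi_prod C (others i) U \<in> tensor_space (ndims[Suc i := r (ts ! i)])"
    unfolding upd_dims_others[OF assms(2)] .
qed

end

text \<open>A dual network provides the left inverse: transposed left inverses \<open>L j\<close> at
  the subtrees and a core \<open>D\<close> dual to \<open>C\<close>. In the contraction the pairs
  \<open>L j * U j\<close> cancel and only \<open>C\<close> against \<open>D\<close>
  remains.\<close>

lemma node_basis_left_invertible:
  assumes "node_bases n r ts U" and C: "C \<in> tensor_space (r (Node ts) # map r ts)"
    and lC: "left_invertible (transpose_mat (Mat 0 C))"
    and lU: "\<And>j. j < length ts \<Longrightarrow> left_invertible (U j)"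
  shows "left_invertible (transpose_mat (Mat 0 (multi_prod C [0..<length ts] U)))"
proof -
  interpret node_bases n r ts U
    by fact
  let ?js = "[0..<length ts]"
  let ?p = "prod_list (map r ts)"
  have "\<exists>L. L \<in> carrier_mat (r (ts ! j)) (tree_dim n (ts ! j)) \<and> L * U j = 1\<^sub>m (r (ts ! j))" if "j < length ts" for j
    using left_invertibleE[OF lU U, OF that that] by blast
  then obtain L where L: "\<And>j. j < length ts \<Longrightarrow> L j \<in> carrier_mat (r (ts ! j)) (tree_dim n (ts ! j))"
    "\<And>j. j < length ts \<Longrightarrow> L j * U j = 1\<^sub>m (r (ts ! j))"
    by metis
  have MC: "Mat 0 C \<in> carrier_mat (r (Node ts)) ?p"
    using Mat_carrier[OF C, of 0] by simp
  obtain K where K: "K \<in> carrier_mat (r (Node ts)) ?p" "K * transpose_mat (Mat 0 C) = 1\<^sub>m (r (Node ts))"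
    using left_invertibleE[OF lC, of ?p] MC by auto
  define D where "D = Ten 0 cdims K"
  have D: "D \<in> tensor_space cdims" and MD: "Mat 0 D = K"
    using K(1) by (auto simp: D_def Mat_Ten)
  interpret L: node_bases n r ts "\<lambda>j. transpose_mat (L j)"
    by unfold_locales (use L in auto)
  define E where "E = multi_prod D ?js (\<lambda>j. transpose_mat (L j))"
  have E: "E \<in> tensor_space ndims"
    unfolding E_def using D by (rule L.node_tensor_closed)
  note X = node_tensor_closed[OF C]
  have "gram 0 (multi_prod C ?js U) E = gram 0 C (multi_prod E ?js (\<lambda>j. transpose_mat (U j)))"
    by (rule gram_multi_prod[OF C compat, where e = "r (Node ts)"]) (use E upd_dims_cdims in \<open>auto simp del: vdims.simps\<close>, simp)
  also have "multi_prod E ?js (\<lambda>j. transpose_mat (U j)) = multi_prod D ?js (\<lambda>j. transpose_mat (U j) * transpose_mat (L j))"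
    unfolding E_def by (rule multi_prod_multi_prod[OF D L.compat, where g = "\<lambda>j. r (ts ! j)"]) (use U in auto)
  also have "\<dots> = D"
  proof (rule multi_prod_one[OF D])
    fix j assume "j \<in> set ?js"
    then have j: "j < length ts"
      by simp
    have "transpose_mat (U j) * transpose_mat (L j) = transpose_mat (L j * U j)"
      using U[OF j] L(1)[OF j] by (simp add: transpose_mult[of "L j" _ _ "U j"])
    then show "Suc j < length cdims \<and> transpose_mat (U j) * transpose_mat (L j) = 1\<^sub>m (cdims ! Suc j)"
      using j L(2) by simp
  qed
  finally have "Mat 0 (multi_prod C ?js U) * transpose_mat (Mat 0 E) = Mat 0 C * transpose_mat K"
    by (simp add: gram_def MD)
  also have "\<dots> = 1\<^sub>m (r (Node ts))"
    using arg_cong[OF K(2), of transpose_mat] K(1) MC by (simp add: transpose_mult[of K _ ?p])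
  finally have "transpose_mat (Mat 0 (multi_prod C ?js U) * transpose_mat (Mat 0 E)) = 1\<^sub>m (r (Node ts))"
    by simp
  then have "Mat 0 E * transpose_mat (Mat 0 (multi_prod C ?js U)) = 1\<^sub>m (r (Node ts))"
    using Mat_0_vdims_carrier[OF X] Mat_0_vdims_carrier[OF E]
    by (simp add: transpose_mult[of _ "r (Node ts)" "tree_dim n (Node ts)"] del: tree_dim.simps)
  then show ?thesis
    using Mat_0_vdims_carrier[OF X] Mat_0_vdims_carrier[OF E]
    by (intro left_invertibleI[where L = "Mat 0 E"]) (auto simp del: tree_dim.simps)
qed

locale orthonormal_node_bases = node_bases +
  assumes UU: "\<And>j. j < length ts \<Longrightarrow> transpose_mat (U j) * U j = 1\<^sub>m (r (ts ! j))"
begin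

lemma node_tensor_transpose:
  assumes "C \<in> tensor_space cdims"
  shows "multi_prod (multi_prod C [0..<length ts] U) [0..<length ts] (\<lambda>j. transpose_mat (U j)) = C"
proof -
  have "multi_prod (multi_prod C [0..<length ts] U) [0..<length ts] (\<lambda>j. transpose_mat (U j))
      = multi_prod C [0..<length ts] (\<lambda>j. transpose_mat (U j) * U j)"
    by (rule multi_prod_multi_prod[OF assms compat, where g = "\<lambda>j. r (ts ! j)"]) (use U in auto)
  also have "\<dots> = C"
    by (rule multi_prod_one[OF assms]) (auto simp: UU)
  finally show ?thesis .
qed

text \<open>Orthonormal bases make the passage from core to tensor an isometry in the tree
  modes.\<close>

lemma gram_node_tensor:
  assumes C: "C \<in> tensor_space cdims" and D: "D \<in> tensor_space cdims"
  shows "gram 0 (multi_prod C [0..<length ts] U) (multi_prod D [0..<length ts] U) = gram 0 C D"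
proof -
  have "gram 0 (multi_prod C [0..<length ts] U) (multi_prod D [0..<length ts] U)
      = gram 0 C (multi_prod (multi_prod D [0..<length ts] U) [0..<length ts] (\<lambda>j. transpose_mat (U j)))"
    by (rule gram_multi_prod[OF C compat, where e = "r (Node ts)"])
      (use node_tensor_closed[OF D] upd_dims_cdims in \<open>auto simp del: vdims.simps\<close>, simp)
  then show ?thesis
    using node_tensor_transpose[OF D] by simp
qed

end

locale frame = orthonormal_node_bases +
  fixes i :: nat and Q :: "real mat"
  assumes i: "i < length ts"
    and Q: "Q \<in> carrier_mat (prod_list (del_nth (Suc i) (r (Node ts) # map r ts))) (r (ts ! i))"
    and QQ: "transpose_mat Q * Q = 1\<^sub>m (r (ts ! i))"
begin

text \<open>The transposed QR factor as a core, extended by the bases in every tree mode but that of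
  subtree \<open>i\<close>, which keeps dimension \<open>r (ts ! i)\<close>.\<close>

definition "T = multi_prod (Ten (Suc i) cdims (transpose_mat Q)) (others i) U"
definition "V = transpose_mat (Mat (Suc i) T)"

lemma T_closed: "T \<in> tensor_space (ndims[Suc i := r (ts ! i)])"
  unfolding T_def using node_tensor_remove(2)[OF Ten_closed i] .

lemma Mat_T_carrier: "Mat (Suc i) T \<in> carrier_mat (r (ts ! i)) (prod_list (del_nth (Suc i) ndims))"
  using Mat_carrier[OF T_closed, of "Suc i"] i by (simp add: del_nth_update del: vdims.simps)

lemma V_carrier: "V \<in> carrier_mat (prod_list (del_nth (Suc i) ndims)) (r (ts ! i))"
  using Mat_T_carrier by (simp add: V_def)

text \<open>Reading a restriction as a contraction with \<open>T\<close> makes adjointness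
  available: matrices acting on \<open>Z\<close> can be tested on \<open>T\<close>.\<close>

lemma Mat_mult_V: "Mat (Suc i) Z * V = gram (Suc i) Z T"
  by (simp add: gram_def V_def)

text \<open>Moving the bases across the contraction leaves \<open>U^T U = 1\<close> in the other
  tree modes and \<open>Q^T Q = 1\<close> in the mode of subtree \<open>i\<close>.\<close>

lemma VV: "transpose_mat V * V = 1\<^sub>m (r (ts ! i))"
proof -
  let ?Q = "Ten (Suc i) cdims (transpose_mat Q)"
  have T': "T \<in> tensor_space ((upd_dims cdims (others i) (\<lambda>j. tree_dim n (ts ! j)))[Suc i := r (ts ! i)])"
    unfolding upd_dims_others[OF i] list_update_overwrite by (rule T_closed)
  have "transpose_mat V * V = gram (Suc i) (multi_prod ?Q (others i) U) T"
    by (simp add: V_def gram_def T_def)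
  also have "\<dots> = gram (Suc i) ?Q (multi_prod T (others i) (\<lambda>j. transpose_mat (U j)))"
    by (rule gram_multi_prod[OF Ten_closed compat _ _ T']) (use i in auto)
  also have "multi_prod T (others i) (\<lambda>j. transpose_mat (U j)) = multi_prod ?Q (others i) (\<lambda>j. transpose_mat (U j) * U j)"
    unfolding T_def
    by (rule multi_prod_multi_prod[OF Ten_closed compat, where g = "\<lambda>j. r (ts ! j)"]) (use U in auto)
  also have "\<dots> = ?Q"
    by (rule multi_prod_one[OF Ten_closed]) (auto simp: UU)
  also have "gram (Suc i) ?Q ?Q = transpose_mat Q * Q"
    using Q i by (simp add: gram_def Mat_Ten)
  finally show ?thesis
    using QQ by simp
qed

text \<open>In the mode of subtree \<open>j\<close> the tensor is an image under \<open>U j\<close>,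
  whose projector therefore fixes it. This makes restrictions blind to the projections of earlier
  subflows.\<close>

lemma T_projection:
  assumes "j < length ts" "j \<noteq> i"
  shows "mode_prod T (Suc j) (U j * transpose_mat (U j)) = T"
proof -
  let ?Q = "Ten (Suc i) cdims (transpose_mat Q)"
  let ?js = "filter (\<lambda>k. k \<noteq> j) (others i)"
  have j: "j \<in> set (others i)"
    using assms by auto
  have c: "multi_compat cdims (others i) (\<lambda>j. tree_dim n (ts ! j)) U" "multi_compat cdims ?js (\<lambda>j. tree_dim n (ts ! j)) U"
    by (rule compat; auto)+
  have "T = mode_prod (multi_prod ?Q ?js U) (Suc j) (U j)"
    unfolding T_def by (rule multi_prod_remove[OF Ten_closed c(1) j])
  moreover have "multi_prod ?Q ?js U \<in> tensor_space (upd_dims cdims ?js (\<lambda>j. tree_dim n (ts ! j)))"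
    by (rule multi_prod_closed[OF Ten_closed c(2)])
  moreover have "upd_dims cdims ?js (\<lambda>j. tree_dim n (ts ! j)) ! Suc j = r (ts ! j)"
    using assms by simp
  ultimately show ?thesis
    using assms U UU mode_prod_projection[of _ "upd_dims cdims ?js (\<lambda>j. tree_dim n (ts ! j))" "Suc j" "U j"] by auto
qed

text \<open>\<open>M\<close> may differ from \<open>U\<close> at \<open>i\<close>, so that one
  identity covers the network before a subflow, with \<open>K = U i\<close>, and the one after it,
  with the new basis.\<close>

lemma node_tensor_frame:
  assumes S: "S \<in> carrier_mat (r (ts ! i)) (r (ts ! i))" and K: "K \<in> carrier_mat (tree_dim n (ts ! i)) (r (ts ! i))"
    and M: "M i = K" "\<And>j. j < length ts \<Longrightarrow> j \<noteq> i \<Longrightarrow> M j = U j"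
  shows "multi_prod (Ten (Suc i) cdims (S * transpose_mat Q)) [0..<length ts] M = mode_prod T (Suc i) (K * S)"
proof -
  let ?Q = "Ten (Suc i) cdims (transpose_mat Q)"
  have C: "Ten (Suc i) cdims (S * transpose_mat Q) = mode_prod ?Q (Suc i) S"
  proof -
    have "cdims[Suc i := r (ts ! i)] = cdims"
      using i by (subst list_update_same_conv) auto
    then show ?thesis
      using mode_prod_swap_Ten[of S "r (ts ! i)" cdims "Suc i" "transpose_mat Q"] S Q i by simp
  qed
  have SC: "S \<in> carrier_mat (r (ts ! i)) (cdims ! Suc i)"
    using S i by simp
  interpret M: node_bases n r ts M
    by unfold_locales (metis U K M)
  have "multi_prod (mode_prod ?Q (Suc i) S) [0..<length ts] M
      = mode_prod (multi_prod (mode_prod ?Q (Suc i) S) (others i) M) (Suc i) K"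
    using M.node_tensor_remove(1)[of "mode_prod ?Q (Suc i) S" i] Ten_closed C i M(1) by metis
  also have "multi_prod (mode_prod ?Q (Suc i) S) (others i) M = multi_prod (mode_prod ?Q (Suc i) S) (others i) U"
    by (rule multi_prod_cong) (use M(2) in auto)
  also have "\<dots> = mode_prod T (Suc i) S"
    unfolding T_def using i SC
    by (intro mode_prod_multi_prod[OF Ten_closed compat, symmetric]) auto
  also have "mode_prod (mode_prod T (Suc i) S) (Suc i) K = mode_prod T (Suc i) (K * S)"
    using mode_prod_mode_prod[OF T_closed, of "Suc i" S "r (ts ! i)" K] i S K by simp
  finally show ?thesis
    unfolding C .
qed

lemma Mat_mode_prod_T:
  assumes "K \<in> carrier_mat (tree_dim n (ts ! i)) (r (ts ! i))"
  shows "Mat (Suc i) (mode_prod T (Suc i) K) = K * transpose_mat V"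
  using Mat_mode_prod[OF T_closed, of "Suc i" K] i assms by (simp add: V_def)

end

section \<open>Restriction maps\<close>

lemma restr_closed: "restr n r ts i V Z \<in> tensor_space (vdims n r (ts ! i))"
  by (simp add: restr_def)

lemma Mat_restr:
  assumes "i < length ts" "Z \<in> tensor_space (vdims n r (Node ts))"
    and "V \<in> carrier_mat (prod_list (del_nth (Suc i) (vdims n r (Node ts)))) (r (ts ! i))"
  shows "Mat 0 (restr n r ts i V Z) = transpose_mat (Mat (Suc i) Z * V)"
  unfolding restr_def
  by (rule Mat_Ten) (use Mat_carrier[OF assms(2), of "Suc i"] assms in \<open>auto simp del: vdims.simps\<close>)

text \<open>By linearity, restricting the field \<open>A' t\<close> gives the derivative of the
  restricted path, so the subproblem has the same form as the original problem.\<close>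

lemma linear_restr:
  assumes i: "i < length ts"
    and V: "V \<in> carrier_mat (prod_list (del_nth (Suc i) (vdims n r (Node ts)))) (r (ts ! i))"
  shows "linear_tensor_map (vdims n r (Node ts)) (vdims n r (ts ! i)) (restr n r ts i V)"
  unfolding linear_tensor_map_def
proof (intro conjI ballI restr_closed)
  let ?vd = "vdims n r (Node ts)" and ?es = "vdims n r (ts ! i)"
  fix ks assume ks: "ks \<in> indices ?es"
  let ?c = "colex (del_nth 0 ?es) (del_nth 0 ks)"
  have c: "?c < tree_dim n (ts ! i)"
    using colex_less[OF del_nth_indices[OF ks, of 0]] by simp
  have k: "ks ! 0 < r (ts ! i)"
  proof -
    have "\<forall>k < length ?es. ks ! k < ?es ! k"
      using ks by (simp add: indices_iff)
    from this[rule_format, of 0] show ?thesis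
      by simp
  qed
  show "linear_form ?vd (\<lambda>A. tentry (restr n r ts i V A) ks)"
  proof (rule linear_form_cong)
    show "linear_form ?vd (\<lambda>A. (transpose_mat V * transpose_mat (Mat (Suc i) A)) $$ (ks ! 0, ?c))"
    proof (rule linear_form_mat_mult)
      show "transpose_mat V \<in> carrier_mat (r (ts ! i)) (prod_list (del_nth (Suc i) ?vd))"
        using V by simp
      show "transpose_mat (Mat (Suc i) A) \<in> carrier_mat (prod_list (del_nth (Suc i) ?vd)) (tree_dim n (ts ! i))"
        if "A \<in> tensor_space ?vd" for A
        using Mat_carrier[OF that, of "Suc i"] i by (simp del: vdims.simps)
      fix l assume l: "l < prod_list (del_nth (Suc i) ?vd)"
      show "linear_form ?vd (\<lambda>A. transpose_mat (Mat (Suc i) A) $$ (l, ?c))"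
      proof (rule linear_form_cong)
        show "linear_form ?vd (\<lambda>A. Mat (Suc i) A $$ (?c, l))"
          using i c l by (intro linear_form_Mat) (auto simp del: vdims.simps)
        fix A assume "A \<in> tensor_space ?vd"
        then show "transpose_mat (Mat (Suc i) A) $$ (l, ?c) = Mat (Suc i) A $$ (?c, l)"
          using Mat_carrier[of A ?vd "Suc i"] i c l by (auto simp del: vdims.simps)
      qed
    qed (use k c in auto)
    fix A assume "A \<in> tensor_space ?vd"
    then show "tentry (restr n r ts i V A) ks = (transpose_mat V * transpose_mat (Mat (Suc i) A)) $$ (ks ! 0, ?c)"
      using Mat_carrier[of A ?vd "Suc i"] V ks transpose_mult[of "Mat (Suc i) A" _ _ V]
      by (simp add: restr_def tentry_Ten del: vdims.simps)
  qed
qed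

lemma linear_form_mult_transpose_Mat:
  assumes "P \<in> carrier_mat k (tree_dim n \<tau>)" "a < k" "b < r \<tau>"
  shows "linear_form (vdims n r \<tau>) (\<lambda>B. (P * transpose_mat (Mat 0 B)) $$ (a, b))"
proof (rule linear_form_mat_mult[OF assms(1) assms(2,3)])
  show "transpose_mat (Mat 0 B) \<in> carrier_mat (tree_dim n \<tau>) (r \<tau>)" if "B \<in> tensor_space (vdims n r \<tau>)" for B
    using Mat_0_vdims_carrier[OF that] by simp
  fix l assume l: "l < tree_dim n \<tau>"
  show "linear_form (vdims n r \<tau>) (\<lambda>B. transpose_mat (Mat 0 B) $$ (l, b))"
  proof (rule linear_form_cong)
    show "linear_form (vdims n r \<tau>) (\<lambda>B. Mat 0 B $$ (b, l))"
      using assms l by (intro linear_form_Mat) auto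
    fix B assume "B \<in> tensor_space (vdims n r \<tau>)"
    then show "transpose_mat (Mat 0 B) $$ (l, b) = Mat 0 B $$ (b, l)"
      using Mat_0_vdims_carrier[of B n r \<tau>] assms l by auto
  qed
qed

section \<open>Orthonormal networks\<close>

lemma ttn_tensor_TNode:
  "ttn_tensor (TNode C xs) = multi_prod C [0..<length xs] (\<lambda>j. basis_mat (xs ! j))"
  by (auto simp: basis_mat_def intro: multi_prod_cong)

declare ttn_tensor.simps(2) [simp del]

lemma basis_mat_TLeaf [simp]: "basis_mat (TLeaf U) = U"
  by (simp add: basis_mat_def Mat_Ten)

lemma basis_mat_carrier:
  "ttn_tensor x \<in> tensor_space (vdims n r \<tau>) \<Longrightarrow> basis_mat x \<in> carrier_mat (tree_dim n \<tau>) (r \<tau>)"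
  using Mat_0_vdims_carrier by (simp add: basis_mat_def)

text \<open>By induction the subtree bases are left invertible, and the core has full rank in mode
  0; the dual network combines the two.\<close>

lemma full_rank_ttn_basis:
  "full_rank_ttn n r \<tau> x \<Longrightarrow> ttn_tensor x \<in> tensor_space (vdims n r \<tau>) \<and> left_invertible (basis_mat x)"
proof (induction rule: full_rank_ttn.induct)
  case (1 U l)
  then show ?case
    by (auto intro!: full_col_rank_left_invertible)
next
  case (2 C ts xs)
  then have l: "length xs = length ts"
    and IH: "\<And>j. j < length ts \<Longrightarrow> ttn_tensor (xs ! j) \<in> tensor_space (vdims n r (ts ! j))"
      "\<And>j. j < length ts \<Longrightarrow> left_invertible (basis_mat (xs ! j))"
    by (auto simp: list_all2_conv_all_nth)
  then interpret node_bases n r ts "\<lambda>j. basis_mat (xs ! j)"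
    by unfold_locales (simp add: basis_mat_carrier)
  have "mat_rank (Mat 0 C) = r (Node ts)"
    using 2(1,2) by (auto simp: full_multilinear_rank_def tensor_space_dims)
  then have "left_invertible (transpose_mat (Mat 0 C))"
    using Mat_carrier[OF 2(1), of 0] by (intro full_row_rank_left_invertible) simp
  from node_basis_left_invertible[OF node_bases_axioms 2(1) this IH(2)]
  have "left_invertible (basis_mat (TNode C xs))"
    unfolding basis_mat_def[of "TNode C xs"] ttn_tensor_TNode l .
  then show ?case
    using node_tensor_closed[OF 2(1)] l by (simp add: ttn_tensor_TNode)
qed

text \<open>Orthonormality one level deep. The QR step at a root looks no further than the bases of
  the direct subtrees, and this much will be shown of every output of a time step.\<close>

fun root_orthonormal :: "('l \<Rightarrow> nat) \<Rightarrow> ('l ttree \<Rightarrow> nat) \<Rightarrow> 'l ttree \<Rightarrow> ttn \<Rightarrow> bool" where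
  "root_orthonormal n r (Leaf l) (TLeaf U) \<longleftrightarrow> U \<in> carrier_mat (n l) (r (Leaf l))"
| "root_orthonormal n r (Node ts) (TNode C xs) \<longleftrightarrow> C \<in> tensor_space (r (Node ts) # map r ts)
     \<and> length xs = length ts \<and> orthonormal_node_bases n r ts (\<lambda>j. basis_mat (xs ! j))"
| "root_orthonormal n r _ _ \<longleftrightarrow> False"

lemma root_orthonormal_cases [consumes 1, case_names Leaf Node]:
  assumes "root_orthonormal n r \<tau> y"
  obtains l U where "\<tau> = Leaf l" "y = TLeaf U" "U \<in> carrier_mat (n l) (r (Leaf l))"
  | ts C xs where "\<tau> = Node ts" "y = TNode C xs" "C \<in> tensor_space (r (Node ts) # map r ts)"
    "length xs = length ts" "orthonormal_node_bases n r ts (\<lambda>j. basis_mat (xs ! j))"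
  using assms by (cases \<tau>; cases y) auto

lemma root_orthonormal_closed:
  assumes "root_orthonormal n r \<tau> y"
  shows "ttn_tensor y \<in> tensor_space (vdims n r \<tau>)"
  using assms
proof (cases rule: root_orthonormal_cases)
  case (Node ts C xs)
  then interpret orthonormal_node_bases n r ts "\<lambda>j. basis_mat (xs ! j)"
    by simp
  show ?thesis
    using Node node_tensor_closed[of C] by (simp add: ttn_tensor_TNode)
qed auto

text \<open>Unlike \<^const>\<open>full_rank_ttn\<close>, this does not constrain the ranks: \<open>root_prod\<close> preserves it for arbitrary factors,
  and all invertibility comes from nondegeneracy.\<close>

inductive orthonormal_network :: "('l \<Rightarrow> nat) \<Rightarrow> ('l ttree \<Rightarrow> nat) \<Rightarrow> 'l ttree \<Rightarrow> ttn \<Rightarrow> bool"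
  for n :: "'l \<Rightarrow> nat" and r :: "'l ttree \<Rightarrow> nat" where
  "U \<in> carrier_mat (n l) (r (Leaf l)) \<Longrightarrow> orthonormal_network n r (Leaf l) (TLeaf U)"
| "C \<in> tensor_space (r (Node ts) # map r ts) \<Longrightarrow> list_all2 (orthonormal_network n r) ts xs
    \<Longrightarrow> \<forall>x \<in> set xs. orthonormal_cols (basis_mat x)
    \<Longrightarrow> orthonormal_network n r (Node ts) (TNode C xs)"

lemma orthonormal_network_root: "orthonormal_network n r \<tau> y \<Longrightarrow> root_orthonormal n r \<tau> y"
proof (induction rule: orthonormal_network.induct)
  case (2 C ts xs)
  have "orthonormal_node_bases n r ts (\<lambda>j. basis_mat (xs ! j))"
  proof
    fix j assume j: "j < length ts"
    then show c: "basis_mat (xs ! j) \<in> carrier_mat (tree_dim n (ts ! j)) (r (ts ! j))"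
      using 2 by (auto simp: list_all2_conv_all_nth intro!: basis_mat_carrier root_orthonormal_closed)
    have "xs ! j \<in> set xs"
      using 2 j by (auto dest: list_all2_lengthD)
    then show "transpose_mat (basis_mat (xs ! j)) * basis_mat (xs ! j) = 1\<^sub>m (r (ts ! j))"
      using 2 c by (auto simp: orthonormal_cols_def)
  qed
  then show ?case
    using 2 by (auto dest: list_all2_lengthD)
qed simp

lemma full_rank_orthonormal_network:
  "full_rank_ttn n r \<tau> x \<Longrightarrow> orthonormal_ttn x \<Longrightarrow> orthonormal_network n r \<tau> x"
  by (induction rule: full_rank_ttn.induct)
    (auto simp: list_all2_conv_all_nth intro!: orthonormal_network.intros)

text \<open>A factor in mode 0 changes the root alone and commutes with the bases, so orthonormality
  below survives every square factor, singular or not.\<close>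

lemma root_prod_network:
  assumes "orthonormal_network n r \<tau> x" and M: "M \<in> carrier_mat (r \<tau>) (r \<tau>)"
  shows "orthonormal_network n r \<tau> (root_prod x M)"
    and "ttn_tensor (root_prod x M) = mode_prod (ttn_tensor x) 0 M"
proof -
  have "orthonormal_network n r \<tau> (root_prod x M) \<and> ttn_tensor (root_prod x M) = mode_prod (ttn_tensor x) 0 M"
    using assms(1)
  proof cases
    case (1 U l)
    then have "transpose_mat (U * transpose_mat M) = M * transpose_mat U"
      using M transpose_mult[of U "n l" "r (Leaf l)" "transpose_mat M"] by simp
    then show ?thesis
      using 1 M mode_prod_swap_Ten[of M "r (Leaf l)" "[r (Leaf l), n l]" 0 "transpose_mat U"]
      by (auto intro: orthonormal_network.intros)
  next
    case (2 C ts xs)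
    interpret orthonormal_node_bases n r ts "\<lambda>j. basis_mat (xs ! j)"
      using orthonormal_network_root[OF assms(1)] 2 by simp
    have l: "length xs = length ts"
      using 2(4) by (auto dest: list_all2_lengthD)
    have "mode_prod C 0 M \<in> tensor_space cdims"
      using mode_prod_closed[OF 2(3), of M "r \<tau>" "r \<tau>" 0] M 2(1) by simp
    then have "orthonormal_network n r (Node ts) (TNode (mode_prod C 0 M) xs)"
      using 2 by (intro orthonormal_network.intros) auto
    moreover have "mode_prod (multi_prod C [0..<length ts] (\<lambda>j. basis_mat (xs ! j))) 0 M
        = multi_prod (mode_prod C 0 M) [0..<length ts] (\<lambda>j. basis_mat (xs ! j))"
      using M 2(1) by (intro mode_prod_multi_prod[OF 2(3) compat, where d = "r \<tau>"]) auto
    ultimately show ?thesis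
      using 2 l by (simp add: ttn_tensor_TNode)
  qed
  then show "orthonormal_network n r \<tau> (root_prod x M)"
    "ttn_tensor (root_prod x M) = mode_prod (ttn_tensor x) 0 M"
    by auto
qed

text \<open>A left inverse for the whole tensor, read as a tensor and contracted with the bases,
  becomes one for the core.\<close>

lemma (in node_bases) node_root_left_invertible:
  assumes C: "C \<in> tensor_space cdims"
    and inv: "left_invertible (transpose_mat (Mat 0 (multi_prod C [0..<length ts] U)))"
  shows "left_invertible (transpose_mat (Mat 0 C))"
proof -
  let ?X = "multi_prod C [0..<length ts] U" and ?k = "r (Node ts)" and ?p = "prod_list (map r ts)"
  have X: "Mat 0 ?X \<in> carrier_mat ?k (tree_dim n (Node ts))"
    using Mat_0_vdims_carrier[OF node_tensor_closed[OF C]] .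
  obtain L where L: "L \<in> carrier_mat ?k (tree_dim n (Node ts))" "L * transpose_mat (Mat 0 ?X) = 1\<^sub>m ?k"
    using left_invertibleE[OF inv, of "tree_dim n (Node ts)" ?k] X by auto
  define D where "D = Ten 0 ndims L"
  have D: "D \<in> tensor_space ndims" and MD: "Mat 0 D = L"
    using L(1) by (simp_all add: D_def Mat_Ten)
  let ?E = "multi_prod D [0..<length ts] (\<lambda>j. transpose_mat (U j))"
  have E: "?E \<in> tensor_space cdims"
    using multi_prod_closed[OF D compat_transpose, of "[0..<length ts]"] upd_dims_ndims by simp
  have "gram 0 ?X D = gram 0 C ?E"
  proof (rule gram_multi_prod[OF C compat, where e = ?k])
    show "D \<in> tensor_space ((upd_dims cdims [0..<length ts] (\<lambda>j. tree_dim n (ts ! j)))[0 := ?k])"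
      unfolding upd_dims_cdims using D by simp
  qed auto
  then have "Mat 0 C * transpose_mat (Mat 0 ?E) = Mat 0 ?X * transpose_mat L"
    by (simp add: gram_def MD)
  also have "\<dots> = transpose_mat (L * transpose_mat (Mat 0 ?X))"
    using L(1) X transpose_mult[of L _ _ "transpose_mat (Mat 0 ?X)"] by simp
  finally have "transpose_mat (Mat 0 C * transpose_mat (Mat 0 ?E)) = 1\<^sub>m ?k"
    unfolding L(2) by simp
  moreover have "Mat 0 C \<in> carrier_mat ?k ?p" "Mat 0 ?E \<in> carrier_mat ?k ?p"
    using Mat_carrier[OF C, of 0] Mat_carrier[OF E, of 0] by auto
  ultimately show ?thesis
    using transpose_mult[of "Mat 0 C" ?k ?p "transpose_mat (Mat 0 ?E)" ?k]
    by (intro left_invertibleI[of _ ?p ?k "Mat 0 ?E"]) (simp_all only: transpose_carrier_mat transpose_transpose)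
qed

lemma root_QR_exists:
  assumes y: "root_orthonormal n r \<tau> y" and inv: "left_invertible (basis_mat y)"
  shows "\<exists>x R. root_QR y x R"
  using y
proof (cases rule: root_orthonormal_cases)
  case (Leaf l U)
  then show ?thesis
    using QR_exists[of U] inv by auto
next
  case (Node ts C xs)
  then interpret orthonormal_node_bases n r ts "\<lambda>j. basis_mat (xs ! j)"
    by simp
  have "left_invertible (transpose_mat (Mat 0 (multi_prod C [0..<length ts] (\<lambda>j. basis_mat (xs ! j)))))"
    using inv Node(4) unfolding Node(2) basis_mat_def[of "TNode C xs"] ttn_tensor_TNode by simp
  with Node(3) have "left_invertible (transpose_mat (Mat 0 C))"
    by (rule node_root_left_invertible)
  then show ?thesis
    using QR_exists[of "transpose_mat (Mat 0 C)"] Node by auto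
qed

text \<open>The triangular factor acts in mode 0 and can be pulled out through the bases. The new
  root basis is orthonormal because its Gram matrix is that of the core.\<close>

lemma root_QR_basis:
  assumes y: "root_orthonormal n r \<tau> y" and QR: "root_QR y x R"
  shows "basis_mat x \<in> carrier_mat (tree_dim n \<tau>) (r \<tau>)" "transpose_mat (basis_mat x) * basis_mat x = 1\<^sub>m (r \<tau>)"
    "R \<in> carrier_mat (r \<tau>) (r \<tau>)" "basis_mat y = basis_mat x * R"
proof -
  have "basis_mat x \<in> carrier_mat (tree_dim n \<tau>) (r \<tau>) \<and> transpose_mat (basis_mat x) * basis_mat x = 1\<^sub>m (r \<tau>)
    \<and> R \<in> carrier_mat (r \<tau>) (r \<tau>) \<and> basis_mat y = basis_mat x * R"
    using y
  proof (cases rule: root_orthonormal_cases)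
    case (Leaf l U)
    then show ?thesis
      using QR by (auto simp: is_QR_def orthonormal_cols_def)
  next
    case (Node ts C xs)
    then interpret orthonormal_node_bases n r ts "\<lambda>j. basis_mat (xs ! j)"
      by simp
    let ?k = "r (Node ts)" and ?p = "prod_list (map r ts)" and ?U = "\<lambda>j. basis_mat (xs ! j)"
    have C: "C \<in> tensor_space cdims" and l: "length xs = length ts"
      using Node by auto
    have MC: "Mat 0 C \<in> carrier_mat ?k ?p"
      using Mat_carrier[OF C, of 0] by simp
    obtain Q where Q: "is_QR (transpose_mat (Mat 0 C)) Q R" and x: "x = TNode (Ten 0 cdims (transpose_mat Q)) xs"
      using QR Node tensor_space_dims[OF C] by auto
    have Qc: "Q \<in> carrier_mat ?p ?k" "R \<in> carrier_mat ?k ?k" "transpose_mat Q * Q = 1\<^sub>m ?k"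
      and QRC: "transpose_mat (Mat 0 C) = Q * R"
      using Q MC by (auto simp: is_QR_def orthonormal_cols_def)
    let ?Q = "Ten 0 cdims (transpose_mat Q)"
    have MQ: "Mat 0 ?Q = transpose_mat Q"
      using Qc by (intro Mat_Ten) auto
    have "Mat 0 C = transpose_mat R * transpose_mat Q"
      using arg_cong[OF QRC, of transpose_mat] Qc transpose_mult[of Q ?p ?k R ?k] by simp
    then have "C = Ten 0 cdims (transpose_mat R * transpose_mat Q)"
      using Ten_Mat[OF C, of 0] by simp
    also have "\<dots> = mode_prod ?Q 0 (transpose_mat R)"
      using mode_prod_swap_Ten[of "transpose_mat R" ?k cdims 0 "transpose_mat Q"] Qc by simp
    finally have CQ: "C = mode_prod ?Q 0 (transpose_mat R)" .
    have tx: "ttn_tensor x = multi_prod ?Q [0..<length ts] ?U"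
      by (simp add: x ttn_tensor_TNode l)
    have X: "ttn_tensor x \<in> tensor_space ndims"
      unfolding tx by (rule node_tensor_closed) simp
    note MX = Mat_0_vdims_carrier[OF X]
    have "ttn_tensor y = multi_prod (mode_prod ?Q 0 (transpose_mat R)) [0..<length ts] ?U"
      using CQ Node by (simp add: ttn_tensor_TNode l)
    also have "\<dots> = mode_prod (ttn_tensor x) 0 (transpose_mat R)"
      unfolding tx using Qc
      by (intro mode_prod_multi_prod[OF Ten_closed compat, where d = ?k, symmetric]) auto
    finally have "Mat 0 (ttn_tensor y) = transpose_mat R * Mat 0 (ttn_tensor x)"
      using Mat_mode_prod[OF X, of 0 "transpose_mat R" ?k] Qc by simp
    then have "basis_mat y = basis_mat x * R"
      using transpose_mult[of "transpose_mat R" ?k ?k "Mat 0 (ttn_tensor x)"] Qc MX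
      by (simp add: basis_mat_def del: tree_dim.simps)
    moreover have "transpose_mat (basis_mat x) * basis_mat x = 1\<^sub>m ?k"
      using gram_node_tensor[of ?Q ?Q] Qc MQ by (simp add: basis_mat_def tx gram_def)
    ultimately show ?thesis
      using Node Qc basis_mat_carrier[OF X] by simp
  qed
  then show "basis_mat x \<in> carrier_mat (tree_dim n \<tau>) (r \<tau>)" "transpose_mat (basis_mat x) * basis_mat x = 1\<^sub>m (r \<tau>)"
    "R \<in> carrier_mat (r \<tau>) (r \<tau>)" "basis_mat y = basis_mat x * R"
    by auto
qed

text \<open>The product is \<open>Mat Z * V * V^T * Mat W^T\<close>, and \<open>V V^T\<close> fixes
  the rows of \<open>Mat W\<close>. The result no longer mentions \<open>V\<close>, which lets
  restrictions along different frames be compared.\<close>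

lemma restr_pair:
  assumes i: "i < length ts" and Z: "Z \<in> tensor_space (vdims n r (Node ts))" and W: "W \<in> tensor_space (vdims n r (Node ts))"
    and V: "V \<in> carrier_mat (prod_list (del_nth (Suc i) (vdims n r (Node ts)))) (r (ts ! i))"
    and VV: "Mat (Suc i) W * V * transpose_mat V = Mat (Suc i) W"
  shows "transpose_mat (Mat 0 (restr n r ts i V Z)) * Mat 0 (restr n r ts i V W) = gram (Suc i) Z W"
proof -
  let ?p = "prod_list (del_nth (Suc i) (vdims n r (Node ts)))" and ?d = "tree_dim n (ts ! i)"
  have MZ: "Mat (Suc i) Z \<in> carrier_mat ?d ?p" and MW: "Mat (Suc i) W \<in> carrier_mat ?d ?p"
    using Mat_carrier[OF Z, of "Suc i"] Mat_carrier[OF W, of "Suc i"] i by (simp_all del: vdims.simps)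
  have V': "transpose_mat V \<in> carrier_mat (r (ts ! i)) ?p"
    using V by simp
  have WV: "Mat (Suc i) W * V \<in> carrier_mat ?d (r (ts ! i))"
    using MW V by simp
  have "transpose_mat (Mat 0 (restr n r ts i V Z)) * Mat 0 (restr n r ts i V W)
      = Mat (Suc i) Z * V * transpose_mat (Mat (Suc i) W * V)"
    by (simp add: Mat_restr[OF i Z V] Mat_restr[OF i W V] del: vdims.simps)
  also have "\<dots> = Mat (Suc i) Z * (V * transpose_mat (Mat (Suc i) W * V))"
    by (rule assoc_mult_mat[OF MZ V]) (use WV in simp)
  also have "V * transpose_mat (Mat (Suc i) W * V) = transpose_mat (Mat (Suc i) W * V * transpose_mat V)"
    using transpose_mult[OF WV V'] by simp
  finally show ?thesis
    by (simp add: VV gram_def)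
qed

section \<open>Nondegenerate pairs\<close>

text \<open>The pair \<open>X\<close>, \<open>Y\<close> stands for the end point and the starting point of a path of restricted tensors.
  All that is needed of \<open>Y\<close> below the root is that each restriction matrix \<open>V\<close> spans its row space.\<close>

inductive nondegenerate :: "('l \<Rightarrow> nat) \<Rightarrow> ('l ttree \<Rightarrow> nat) \<Rightarrow> 'l ttree \<Rightarrow> tensor \<Rightarrow> tensor \<Rightarrow> bool"
  for n :: "'l \<Rightarrow> nat" and r :: "'l ttree \<Rightarrow> nat" where
  nondegenerate_Leaf:
  "X \<in> tensor_space (vdims n r (Leaf l)) \<Longrightarrow> Y \<in> tensor_space (vdims n r (Leaf l))
   \<Longrightarrow> left_invertible (transpose_mat (Mat 0 X)) \<Longrightarrow> left_invertible (transpose_mat (Mat 0 Y))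
   \<Longrightarrow> nondegenerate n r (Leaf l) X Y"
| nondegenerate_Node:
  "X \<in> tensor_space (vdims n r (Node ts)) \<Longrightarrow> Y \<in> tensor_space (vdims n r (Node ts))
   \<Longrightarrow> left_invertible (transpose_mat (Mat 0 X)) \<Longrightarrow> left_invertible (transpose_mat (Mat 0 Y))
   \<Longrightarrow> (\<And>i. i < length ts \<Longrightarrow> \<exists>Z M. Z \<in> tensor_space ((vdims n r (Node ts))[Suc i := r (ts ! i)])
          \<and> M \<in> carrier_mat (tree_dim n (ts ! i)) (r (ts ! i)) \<and> X = mode_prod Z (Suc i) M)
   \<Longrightarrow> (\<And>i. i < length ts \<Longrightarrow> \<exists>V \<in> carrier_mat (prod_list (del_nth (Suc i) (vdims n r (Node ts)))) (r (ts ! i)).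
          Mat (Suc i) Y * V * transpose_mat V = Mat (Suc i) Y
          \<and> nondegenerate n r (ts ! i) (restr n r ts i V X) (restr n r ts i V Y))
   \<Longrightarrow> nondegenerate n r (Node ts) X Y"

lemma nondegenerateD:
  assumes "nondegenerate n r \<tau> X Y"
  shows "X \<in> tensor_space (vdims n r \<tau>)" "Y \<in> tensor_space (vdims n r \<tau>)"
    "left_invertible (transpose_mat (Mat 0 X))" "left_invertible (transpose_mat (Mat 0 Y))"
  using assms by (cases; simp del: vdims.simps)+

lemma nondegenerate_NodeD:
  assumes "nondegenerate n r (Node ts) X Y" and i: "i < length ts"
  shows "\<exists>Z M. Z \<in> tensor_space ((vdims n r (Node ts))[Suc i := r (ts ! i)])
      \<and> M \<in> carrier_mat (tree_dim n (ts ! i)) (r (ts ! i)) \<and> X = mode_prod Z (Suc i) M"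
    and "\<exists>V \<in> carrier_mat (prod_list (del_nth (Suc i) (vdims n r (Node ts)))) (r (ts ! i)).
      Mat (Suc i) Y * V * transpose_mat V = Mat (Suc i) Y
      \<and> nondegenerate n r (ts ! i) (restr n r ts i V X) (restr n r ts i V Y)"
proof -
  note * = assms(1)
  from * show "\<exists>Z M. Z \<in> tensor_space ((vdims n r (Node ts))[Suc i := r (ts ! i)])
      \<and> M \<in> carrier_mat (tree_dim n (ts ! i)) (r (ts ! i)) \<and> X = mode_prod Z (Suc i) M"
    by cases (use i in blast)
  from * show "\<exists>V \<in> carrier_mat (prod_list (del_nth (Suc i) (vdims n r (Node ts)))) (r (ts ! i)).
      Mat (Suc i) Y * V * transpose_mat V = Mat (Suc i) Y
      \<and> nondegenerate n r (ts ! i) (restr n r ts i V X) (restr n r ts i V Y)"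
  proof cases
    case nondegenerate_Node
    show ?thesis
      by (rule nondegenerate_Node(6)[OF i])
  qed
qed

section \<open>The invariant of the subflows\<close>

text \<open>Shared by the initial networks behind the reference pair and by the networks of a
  run.\<close>

locale QR_frame = orthonormal_node_bases +
  fixes C :: tensor and i :: nat and Q S\<^sub>0 :: "real mat"
  assumes core: "C \<in> tensor_space (r (Node ts) # map r ts)"
    and mode: "i < length ts"
    and QR: "is_QR (transpose_mat (Mat (Suc i) C)) Q (transpose_mat S\<^sub>0)"
begin

lemma MC: "Mat (Suc i) C \<in> carrier_mat (r (ts ! i)) (prod_list (del_nth (Suc i) cdims))"
  using Mat_carrier[OF core, of "Suc i"] mode by simp

lemma S\<^sub>0: "S\<^sub>0 \<in> carrier_mat (r (ts ! i)) (r (ts ! i))"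
  using QR MC by (simp add: is_QR_def)

sublocale frame n r ts U i Q
  by unfold_locales (use QR MC mode in \<open>auto simp: is_QR_def orthonormal_cols_def\<close>)

lemma Mat_C: "Mat (Suc i) C = S\<^sub>0 * transpose_mat Q"
  using QR transpose_mult[OF Q, of "transpose_mat S\<^sub>0" "r (ts ! i)"] S\<^sub>0 transpose_transpose[of "Mat (Suc i) C"]
  by (simp add: is_QR_def)

lemma C_Ten: "C = Ten (Suc i) cdims (S\<^sub>0 * transpose_mat Q)"
  using Ten_Mat[OF core, of "Suc i"] mode Mat_C by simp

abbreviation "network \<equiv> multi_prod C [0..<length ts] U"

lemma Yc_T: "network = mode_prod T (Suc i) (U i * S\<^sub>0)"
  using node_tensor_frame[OF S\<^sub>0 U[OF mode], of U] unfolding C_Ten[symmetric] by simp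

lemma US: "U i * S\<^sub>0 \<in> carrier_mat (tree_dim n (ts ! i)) (r (ts ! i))"
  using U[OF mode] S\<^sub>0 by simp

lemma Mat_Yc: "Mat (Suc i) network = U i * S\<^sub>0 * transpose_mat V"
  unfolding Yc_T by (rule Mat_mode_prod_T[OF US])

text \<open>Up to transposition, the restriction of the network is the value with which the
  recursion on subtree \<open>i\<close> starts.\<close>

lemma Mat_Yc_V: "Mat (Suc i) network * V = U i * S\<^sub>0"
proof -
  have "Mat (Suc i) network * V = U i * S\<^sub>0 * (transpose_mat V * V)"
    unfolding Mat_Yc by (rule assoc_mult_mat[OF US]) (use V_carrier in auto)
  then show ?thesis
    using right_mult_one_mat[OF US] by (simp add: VV)
qed

text \<open>Supplies the row space hypothesis of \<open>restr_pair\<close>.\<close>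

lemma Mat_Yc_VV: "Mat (Suc i) network * V * transpose_mat V = Mat (Suc i) network"
  unfolding Mat_Yc_V unfolding Mat_Yc ..

end

text \<open>\<open>A\<close> is the restricted path of an actual run, \<open>X'\<close> and
  \<open>Y'\<close> the reference pair. Rank information on \<open>A t\<^sub>1\<close> is not
  postulated but drawn from the pair through \<open>rel\<close>.\<close>

locale node_path =
  fixes n :: "'l \<Rightarrow> nat" and r :: "'l ttree \<Rightarrow> nat" and ts :: "'l ttree list"
    and t\<^sub>0 t\<^sub>1 :: real and A A' :: "real \<Rightarrow> tensor" and X' Y' :: tensor
  assumes t01: "t\<^sub>0 < t\<^sub>1"
    and A: "tensor_C1 (vdims n r (Node ts)) t\<^sub>0 t\<^sub>1 A A'"
    and nd: "nondegenerate n r (Node ts) X' Y'"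
    and rel: "transpose_mat (Mat 0 (A t\<^sub>1)) * Mat 0 (A t\<^sub>0) = transpose_mat (Mat 0 X') * Mat 0 Y'"
    and inv_start: "left_invertible (transpose_mat (Mat 0 (A t\<^sub>0)))"
begin

abbreviation "X \<equiv> A t\<^sub>1"
abbreviation "Y \<equiv> A t\<^sub>0"
abbreviation "dims \<equiv> vdims n r (Node ts)"
abbreviation "nt i \<equiv> tree_dim n (ts ! i)"
abbreviation "rt i \<equiv> r (ts ! i)"
abbreviation "rest i \<equiv> prod_list (del_nth (Suc i) dims)"

lemma X: "X \<in> tensor_space dims" and Y: "Y \<in> tensor_space dims"
  using A t01 by (auto simp: tensor_C1_def)

lemma X': "X' \<in> tensor_space dims" and Y': "Y' \<in> tensor_space dims"
  using nondegenerateD[OF nd] by blast+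

lemma Mat_dims: "Z \<in> tensor_space dims \<Longrightarrow> i < length ts \<Longrightarrow> Mat (Suc i) Z \<in> carrier_mat (nt i) (rest i)"
  using Mat_carrier[of Z dims "Suc i"] by simp

text \<open>\<open>Mat 0 Y\<close> has a right inverse, so \<open>rel\<close> exhibits
  \<open>Mat 0 X\<close> as a square matrix times \<open>Mat 0 X'\<close>. Hence \<open>X\<close>
  arises from \<open>X'\<close> by a product in mode 0, which leaves the factorization of
  \<open>X'\<close> in a tree mode intact.\<close>

lemma X_factor:
  assumes i: "i < length ts"
  obtains U B where "U \<in> carrier_mat (nt i) (rt i)" "B \<in> carrier_mat (rt i) (rest i)" "Mat (Suc i) X = U * B"
proof -
  let ?k = "r (Node ts)" and ?d = "tree_dim n (Node ts)"
  note MX = Mat_0_vdims_carrier[OF X] and MY = Mat_0_vdims_carrier[OF Y]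
    and MX' = Mat_0_vdims_carrier[OF X'] and MY' = Mat_0_vdims_carrier[OF Y']
  obtain K where K: "K \<in> carrier_mat ?k ?d" "K * transpose_mat (Mat 0 Y) = 1\<^sub>m ?k"
    using left_invertibleE[OF inv_start, of ?d ?k] MY by auto
  \<comment> \<open>Multiplied from the right by \<open>transpose_mat K\<close>, the left side of
    \<open>rel\<close> becomes \<open>Mat 0 X\<close> transposed and the right side becomes
    \<open>Mat 0 X'\<close> transposed times \<open>N\<close>.\<close>
  define N where "N = Mat 0 Y' * transpose_mat K"
  have K': "transpose_mat K \<in> carrier_mat ?d ?k"
    using K(1) by simp
  have N: "N \<in> carrier_mat ?k ?k"
    using MY' K' by (simp add: N_def)
  have YK: "Mat 0 Y * transpose_mat K = 1\<^sub>m ?k"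
    using arg_cong[OF K(2), of transpose_mat] unfolding transpose_one
    by (subst (asm) transpose_mult[of K ?k ?d "transpose_mat (Mat 0 Y)" ?k]) (use K(1) MY in auto)
  have tX: "transpose_mat (Mat 0 X) \<in> carrier_mat ?d ?k" and tX': "transpose_mat (Mat 0 X') \<in> carrier_mat ?d ?k"
    using MX MX' by simp_all
  have "transpose_mat (Mat 0 X) = transpose_mat (Mat 0 X) * Mat 0 Y * transpose_mat K"
    using assoc_mult_mat[OF tX MY K'] YK tX by simp
  also have "\<dots> = transpose_mat (Mat 0 X') * N"
    unfolding rel N_def by (rule assoc_mult_mat[OF tX' MY' K'])
  finally have "transpose_mat (transpose_mat (Mat 0 X)) = transpose_mat (transpose_mat (Mat 0 X') * N)"
    by (rule arg_cong)
  then have "Mat 0 X = transpose_mat N * Mat 0 X'"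
    using transpose_mult[OF tX' N] by simp
  also have "\<dots> = Mat 0 (mode_prod X' 0 (transpose_mat N))"
    using Mat_mode_prod[OF X', of 0 "transpose_mat N" ?k] N by simp
  finally have XN: "X = mode_prod X' 0 (transpose_mat N)"
    using Mat_inject[OF X, of "mode_prod X' 0 (transpose_mat N)" 0]
      mode_prod_closed[OF X', of "transpose_mat N" ?k ?k 0] N by simp
  obtain Z U where Z: "Z \<in> tensor_space (dims[Suc i := rt i])" and U: "U \<in> carrier_mat (nt i) (rt i)"
    and X'Z: "X' = mode_prod Z (Suc i) U"
    using nondegenerate_NodeD(1)[OF nd i] by blast
  let ?Z = "mode_prod Z 0 (transpose_mat N)"
  have Z0: "?Z \<in> tensor_space (dims[Suc i := rt i])"
    using mode_prod_closed[OF Z, of "transpose_mat N" ?k ?k 0] N by simp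
  have "X = mode_prod ?Z (Suc i) U"
    unfolding XN X'Z using U N i by (intro mode_prod_commute[OF Z]) auto
  then have "Mat (Suc i) X = U * Mat (Suc i) ?Z"
    using Mat_mode_prod[OF Z0, of "Suc i" U] U i by simp
  moreover have "Mat (Suc i) ?Z \<in> carrier_mat (rt i) (rest i)"
    using Mat_carrier[OF Z0, of "Suc i"] i by (simp add: del_nth_update del: vdims.simps)
  ultimately show thesis
    using that U by blast
qed

lemma gram_ends: "i < length ts \<Longrightarrow> gram (Suc i) X Y = gram (Suc i) X' Y'"
  using rel by (intro gram_partial_trace[OF X Y X' Y']) auto

end

text \<open>The state after \<open>i\<close> subflows: the network represents the starting value projected, in each of the first
  \<open>i\<close> tree modes, onto a space that contains the mode range of the end point.\<close>

locale node_state = node_path + orthonormal_node_bases n r ts U for U :: "nat \<Rightarrow> real mat" +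
  fixes C :: tensor and i :: nat
  assumes C: "C \<in> tensor_space (r (Node ts) # map r ts)"
    and i_le: "i \<le> length ts"
    and X_projection: "\<And>j. j < i \<Longrightarrow> mode_prod X (Suc j) (U j * transpose_mat (U j)) = X"
    and current: "multi_prod C [0..<length ts] U = multi_prod Y [0..<i] (\<lambda>j. U j * transpose_mat (U j))"
begin

abbreviation "P j \<equiv> U j * transpose_mat (U j)"
abbreviation "Yc \<equiv> multi_prod C [0..<length ts] U"

lemma Yc: "Yc \<in> tensor_space dims"
  by (rule node_tensor_closed[OF C])

lemma P_carrier: "j < length ts \<Longrightarrow> P j \<in> carrier_mat (nt j) (nt j)"
  using U[of j] by simp

lemma P_transpose: "j < length ts \<Longrightarrow> transpose_mat (P j) = P j"
  using U[of j] transpose_mult[of "U j" _ _ "transpose_mat (U j)"] by simp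

lemma P_compat: "k \<le> length ts \<Longrightarrow> multi_compat dims [0..<k] nt P"
  using P_carrier by (auto simp: multi_compat_def)

lemma upd_dims_P: "upd_dims dims js nt = dims"
  by (rule upd_dims_eqI) auto

text \<open>The projections are symmetric, so they move from \<open>Y\<close> to \<open>W\<close>,
  which they fix. As \<open>i \<le> k\<close>, mode \<open>Suc k\<close> is not among the projected
  ones.\<close>

lemma gram_projected:
  assumes "k < length ts" "i \<le> k" and W: "W \<in> tensor_space (dims[Suc k := e])"
    and proj: "\<And>j. j < i \<Longrightarrow> mode_prod W (Suc j) (P j) = W"
  shows "gram (Suc k) Yc W = gram (Suc k) Y W"
proof -
  have "gram (Suc k) Yc W = gram (Suc k) Y (multi_prod W [0..<i] (\<lambda>j. transpose_mat (P j)))"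
    unfolding current using assms
    by (intro gram_multi_prod[OF Y P_compat, where e = e]) (auto simp: upd_dims_P simp del: vdims.simps)
  also have "multi_prod W [0..<i] (\<lambda>j. transpose_mat (P j)) = multi_prod W [0..<i] P"
    using i_le by (intro multi_prod_cong P_transpose) auto
  also have "\<dots> = W"
    using proj by (intro multi_prod_id[OF W]) auto
  finally show ?thesis .
qed

lemma gram_current:
  assumes k: "k < length ts" "i \<le> k"
  shows "gram (Suc k) X Yc = gram (Suc k) X Y"
proof -
  have e: "dims[Suc k := nt k] = dims"
    using k by (subst list_update_same_conv) auto
  have "gram (Suc k) Yc X = gram (Suc k) Y X"
    using gram_projected[OF k, of X "nt k"] X_projection X unfolding e by blast
  then show ?thesis
    using gram_commute[of X dims _ "Suc k" "nt k"] X Y Yc k unfolding e by simp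
qed

text \<open>The frame of the reference pair enters, yet the contraction is that of \<open>X\<close>
  with the current network: \<open>restr_pair\<close> removes the frame, \<open>gram_ends\<close>
  passes to \<open>X\<close> and \<open>Y\<close>, and \<open>gram_current\<close> to
  \<open>Yc\<close>.\<close>

lemma reference_child:
  assumes i: "i < length ts"
  obtains X\<^sub>i Y\<^sub>i where "nondegenerate n r (ts ! i) X\<^sub>i Y\<^sub>i"
    "transpose_mat (Mat 0 X\<^sub>i) * Mat 0 Y\<^sub>i = gram (Suc i) X Yc"
proof -
  obtain V where V: "V \<in> carrier_mat (rest i) (rt i)" "Mat (Suc i) Y' * V * transpose_mat V = Mat (Suc i) Y'"
    and "nondegenerate n r (ts ! i) (restr n r ts i V X') (restr n r ts i V Y')"
    using nondegenerate_NodeD(2)[OF nd i] by blast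
  then show thesis
    using that restr_pair[OF i X' Y' V] gram_current[OF i] gram_ends[OF i] by simp
qed

text \<open>Guarantees that the core has a QR decomposition. The contraction of \<open>X\<close>
  with \<open>Yc\<close> factors through dimension \<open>rt i\<close> in two ways: as the full rank
  product of the reference pair, and with \<open>U i\<close> transposed on the right and a left
  factor that ends in the matrix claimed to be left invertible.\<close>

lemma core_left_invertible:
  assumes i: "i < length ts"
  shows "left_invertible (transpose_mat (Mat (Suc i) C))"
proof -
  let ?D = "multi_prod C (others i) U" and ?K = "multi_prod X (others i) (\<lambda>j. transpose_mat (U j))"
  let ?p = "prod_list (del_nth (Suc i) cdims)"
  obtain X\<^sub>i Y\<^sub>i where nd\<^sub>i: "nondegenerate n r (ts ! i) X\<^sub>i Y\<^sub>i"
    and ref: "transpose_mat (Mat 0 X\<^sub>i) * Mat 0 Y\<^sub>i = gram (Suc i) X Yc"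
    using reference_child[OF i] .
  note D = node_tensor_remove[OF C i]
  have c: "multi_compat dims (others i) rt (\<lambda>j. transpose_mat (U j))"
    by (rule compat_transpose) auto
  have K: "?K \<in> tensor_space (cdims[Suc i := nt i])"
    using multi_prod_closed[OF X c] unfolding upd_dims_others'[OF i] .
  have MD: "Mat (Suc i) ?D \<in> carrier_mat (rt i) (rest i)"
    using Mat_carrier[OF D(2), of "Suc i"] i by (simp add: del_nth_update del: vdims.simps)
  have MK: "Mat (Suc i) ?K \<in> carrier_mat (nt i) ?p"
    using Mat_carrier[OF K, of "Suc i"] i by (simp add: del_nth_update del: list_update.simps)
  have MC: "transpose_mat (Mat (Suc i) C) \<in> carrier_mat ?p (rt i)"
    using Mat_carrier[OF C, of "Suc i"] i by simp
  have Ui: "U i \<in> carrier_mat (nt i) (rt i)"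
    using U i by simp
  have MX: "Mat (Suc i) X \<in> carrier_mat (nt i) (rest i)"
    using Mat_dims[OF X i] .
  have "Mat (Suc i) Yc = U i * Mat (Suc i) ?D"
    unfolding D(1) using Mat_mode_prod[OF D(2), of "Suc i" "U i" "nt i"] Ui i by simp
  then have "gram (Suc i) X Yc = Mat (Suc i) X * (transpose_mat (Mat (Suc i) ?D) * transpose_mat (U i))"
    using transpose_mult[OF Ui MD] by (simp add: gram_def)
  also have "\<dots> = gram (Suc i) X ?D * transpose_mat (U i)"
    unfolding gram_def
    by (rule assoc_mult_mat[OF MX, symmetric]) (use MD Ui in auto)
  also have "gram (Suc i) X ?D = transpose_mat (gram (Suc i) ?D X)"
    using gram_commute[of X dims ?D "Suc i" "rt i"] X D(2) i by simp
  \<comment> \<open>The other bases move from the network to \<open>X\<close>, which frees the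
    core.\<close>
  also have "gram (Suc i) ?D X = gram (Suc i) C (multi_prod X (others i) (\<lambda>j. transpose_mat (U j)))"
  proof (rule gram_multi_prod[OF C compat, where e = "nt i"])
    have "dims[Suc i := rt i, Suc i := nt i] = dims"
      unfolding list_update_overwrite using i by (subst list_update_same_conv) auto
    then show "X \<in> tensor_space ((upd_dims cdims (others i) nt)[Suc i := nt i])"
      unfolding upd_dims_others[OF i] using X by (simp del: vdims.simps)
  qed (use i in auto)
  also have "transpose_mat (gram (Suc i) C ?K) = Mat (Suc i) ?K * transpose_mat (Mat (Suc i) C)"
    using gram_commute[of C cdims ?K "Suc i" "nt i"] C K i unfolding gram_def
    using MK MC transpose_mult[of "Mat (Suc i) C" "rt i" ?p "transpose_mat (Mat (Suc i) ?K)" "nt i"] by simp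
  finally have eq: "Mat (Suc i) ?K * transpose_mat (Mat (Suc i) C) * transpose_mat (U i) = transpose_mat (Mat 0 X\<^sub>i) * Mat 0 Y\<^sub>i"
    using ref by simp
  note nd\<^sub>i = nondegenerateD[OF nd\<^sub>i]
  have "left_invertible (Mat (Suc i) ?K * transpose_mat (Mat (Suc i) C))"
    using Mat_0_vdims_carrier[OF nd\<^sub>i(1)] Mat_0_vdims_carrier[OF nd\<^sub>i(2)] nd\<^sub>i MK MC Ui
    by (intro left_invertible_factorization(1)[OF _ _ _ _ _ _ eq]) auto
  then show ?thesis
    using left_invertible_factor MK MC by blast
qed

end

locale node_frame = node_state +
  fixes Q S\<^sub>0 :: "real mat"
  assumes i: "i < length ts"
    and is_QR: "is_QR (transpose_mat (Mat (Suc i) C)) Q (transpose_mat S\<^sub>0)"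
begin

sublocale QR_frame n r ts U C i Q S\<^sub>0
  by unfold_locales (use C i is_QR in auto)

text \<open>The path starts at \<open>Y\<close> and not at \<open>Yc\<close>, but the two have equal
  restrictions, since \<open>T\<close> is fixed by the projections applied so far. The restricted
  path thus starts at the value handed to the subtree.\<close>

lemma Mat_Y_V: "Mat (Suc i) Y * V = U i * S\<^sub>0"
  using gram_projected[OF i order_refl T_closed] T_projection i Mat_Yc_V
  by (simp add: Mat_mult_V del: vdims.simps)

lemma restr_Y: "restr n r ts i V Y = restr n r ts i V Yc"
  by (simp add: restr_def Mat_Yc_V Mat_Y_V)

text \<open>These are the hypotheses of the recursive call. The frame is that of the current
  network, and the equal contraction transfers full rank from the reference pair to both ends of the
  restricted path.\<close>

lemma child_rel:
  obtains X\<^sub>i Y\<^sub>i where "nondegenerate n r (ts ! i) X\<^sub>i Y\<^sub>i"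
    "transpose_mat (Mat 0 (restr n r ts i V X)) * Mat 0 (restr n r ts i V Y) = transpose_mat (Mat 0 X\<^sub>i) * Mat 0 Y\<^sub>i"
    "left_invertible (transpose_mat (Mat 0 (restr n r ts i V X)))"
    "left_invertible (transpose_mat (Mat 0 (restr n r ts i V Y)))"
proof -
  obtain X\<^sub>i Y\<^sub>i where nd\<^sub>i: "nondegenerate n r (ts ! i) X\<^sub>i Y\<^sub>i"
    and ref: "transpose_mat (Mat 0 X\<^sub>i) * Mat 0 Y\<^sub>i = gram (Suc i) X Yc"
    using reference_child[OF i] .
  from restr_pair[OF i X Yc V_carrier Mat_Yc_VV]
  have eq: "transpose_mat (Mat 0 (restr n r ts i V X)) * Mat 0 (restr n r ts i V Y) = transpose_mat (Mat 0 X\<^sub>i) * Mat 0 Y\<^sub>i"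
    unfolding restr_Y ref .
  note d = nondegenerateD[OF nd\<^sub>i]
  note E = Mat_0_vdims_carrier[OF d(1)] and G = Mat_0_vdims_carrier[OF d(2)]
  note E' = Mat_0_vdims_carrier[OF restr_closed[of n r ts i V X]]
    and G' = Mat_0_vdims_carrier[OF restr_closed[of n r ts i V Y]]
  have "left_invertible (transpose_mat (Mat 0 (restr n r ts i V X)))"
    "left_invertible (transpose_mat (Mat 0 (restr n r ts i V Y)))"
    by (rule left_invertible_factorization[OF _ _ _ _ _ _ eq, of "nt i" "rt i" "nt i"];
        use E G E' G' d in simp)+
  with nd\<^sub>i eq show thesis
    by (rule that)
qed

text \<open>The new core factor multiplies the network by \<open>Ux Ux^T\<close> in the mode of
  subtree \<open>i\<close>. This projector fixes \<open>X\<close>: with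
  \<open>Mat X = Uf * B\<close> in that mode, \<open>B * V\<close> turns out invertible, so the
  range of \<open>Uf\<close> is that of \<open>Mat X * V\<close>, which lies in the range of
  \<open>Ux\<close>.\<close>

lemma next_state:
  assumes Ux: "Ux \<in> carrier_mat (nt i) (rt i)" "transpose_mat Ux * Ux = 1\<^sub>m (rt i)"
    and S\<^sub>1: "S\<^sub>1 \<in> carrier_mat (rt i) (rt i)" "transpose_mat (Mat 0 (restr n r ts i V X)) = Ux * S\<^sub>1"
  shows "node_state n r ts t\<^sub>0 t\<^sub>1 A A' X' Y' (U(i := Ux))
      (Ten (Suc i) cdims (transpose_mat Ux * (U i * S\<^sub>0) * transpose_mat Q)) (Suc i)"
proof -
  let ?U = "U(i := Ux)" and ?S = "transpose_mat Ux * (U i * S\<^sub>0)"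
  have inv: "left_invertible (transpose_mat (Mat 0 (restr n r ts i V X)))"
    using child_rel by blast
  have XV: "Mat (Suc i) X * V = Ux * S\<^sub>1"
    using S\<^sub>1(2) unfolding Mat_restr[OF i X V_carrier] by simp
  obtain Uf B where f: "Uf \<in> carrier_mat (nt i) (rt i)" "B \<in> carrier_mat (rt i) (rest i)" "Mat (Suc i) X = Uf * B"
    using X_factor[OF i] .
  have BV: "B * V \<in> carrier_mat (rt i) (rt i)"
    using f V_carrier by simp
  have UBV: "Uf * (B * V) = Ux * S\<^sub>1"
    using assoc_mult_mat[OF f(1,2) V_carrier] f(3) XV by simp
  \<comment> \<open>\<open>Uf * (B * V)\<close> is left invertible because the end of the restricted
    path has full rank, and this passes to the right factor, which is square.\<close>
  have "left_invertible (B * V)"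
    using inv left_invertible_factor[OF _ f(1) BV] UBV S\<^sub>1(2) by simp
  then obtain W where W: "W \<in> carrier_mat (rt i) (rt i)" "(B * V) * W = 1\<^sub>m (rt i)"
    using left_invertible_square[OF _ BV] by blast
  have "Uf = Uf * (B * V) * W"
    using assoc_mult_mat[OF f(1) BV W(1)] W(2) f(1) by simp
  also have "\<dots> = Ux * (S\<^sub>1 * W)"
    unfolding UBV by (rule assoc_mult_mat[OF Ux(1) S\<^sub>1(1) W(1)])
  finally have Uf: "Uf = Ux * (S\<^sub>1 * W)" .
  have SW: "S\<^sub>1 * W \<in> carrier_mat (rt i) (rt i)"
    using S\<^sub>1 W by simp
  have "Mat (Suc i) X = Ux * (S\<^sub>1 * W * B)"
    unfolding f(3) Uf by (rule assoc_mult_mat[OF Ux(1) SW f(2)])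
  moreover have "S\<^sub>1 * W * B \<in> carrier_mat (rt i) (prod_list (del_nth (Suc i) dims))"
    using SW f(2) by simp
  ultimately have X_proj: "mode_prod X (Suc i) (Ux * transpose_mat Ux) = X"
    using Ux i by (intro Mat_eq_factor_projection[OF X, where p = "rt i"]) auto
  interpret U': orthonormal_node_bases n r ts ?U
    by unfold_locales (use U UU Ux in auto)
  show ?thesis
  proof unfold_locales
    show "mode_prod X (Suc j) (?U j * transpose_mat (?U j)) = X" if "j < Suc i" for j
      using that X_proj X_projection[of j] by (cases "j = i") auto
    have S: "?S \<in> carrier_mat (rt i) (rt i)"
      using Ux US by simp
    have "multi_prod (Ten (Suc i) cdims (?S * transpose_mat Q)) [0..<length ts] ?U = mode_prod T (Suc i) (Ux * ?S)"
      using node_tensor_frame[OF S Ux(1), of ?U] by simp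
    also have "Ux * ?S = Ux * transpose_mat Ux * (U i * S\<^sub>0)"
      by (rule assoc_mult_mat[symmetric, of _ "nt i" "rt i" _ "nt i" _ "rt i"]) (use Ux US in auto)
    also have "mode_prod T (Suc i) \<dots> = mode_prod Yc (Suc i) (Ux * transpose_mat Ux)"
      unfolding Yc_T
      by (rule mode_prod_mode_prod[OF T_closed, symmetric]) (use Ux US i in auto)
    also have "\<dots> = multi_prod Y [0..<Suc i] (\<lambda>j. ?U j * transpose_mat (?U j))"
    proof -
      have "multi_prod Y [0..<i] P = multi_prod Y [0..<i] (\<lambda>j. ?U j * transpose_mat (?U j))"
        by (rule multi_prod_cong) simp
      then show ?thesis
        unfolding current by (simp add: multi_prod_snoc)
    qed
    finally show "multi_prod (Ten (Suc i) cdims (?S * transpose_mat Q)) [0..<length ts] ?U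
      = multi_prod Y [0..<Suc i] (\<lambda>j. ?U j * transpose_mat (?U j))" .
  qed (use i in auto)
qed

end

text \<open>The start and the end of the last equation: since \<open>U^T U U^T = U^T\<close>, the
  core is the contracted \<open>Y\<close>, and since all projections fix \<open>X\<close>, the
  contracted \<open>X\<close> expands to \<open>X\<close> itself.\<close>

lemma (in node_state) final_core:
  assumes "i = length ts"
  shows "C = multi_prod Y [0..<length ts] (\<lambda>j. transpose_mat (U j))"
    and "multi_prod (multi_prod X [0..<length ts] (\<lambda>j. transpose_mat (U j))) [0..<length ts] U = X"
proof -
  let ?js = "[0..<length ts]" and ?Ut = "\<lambda>j. transpose_mat (U j)"
  have c: "multi_compat dims ?js rt ?Ut"
    by (rule compat_transpose) auto
  have "C = multi_prod (multi_prod Y ?js P) ?js ?Ut"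
    using node_tensor_transpose[OF C] current assms by simp
  also have "\<dots> = multi_prod Y ?js (\<lambda>j. ?Ut j * P j)"
    by (rule multi_prod_multi_prod[OF Y P_compat, where g = rt]) (use U in auto)
  also have "\<dots> = multi_prod Y ?js ?Ut"
  proof (rule multi_prod_cong)
    fix j assume "j \<in> set ?js"
    then have j: "j < length ts"
      by simp
    show "?Ut j * P j = ?Ut j"
      using mult_mat_cancel[of "?Ut j" "rt j" "nt j" "U j" "?Ut j" "nt j"] U[OF j] UU[OF j] by simp
  qed
  finally show "C = multi_prod Y ?js ?Ut" .
  have "multi_prod (multi_prod X ?js ?Ut) ?js U = multi_prod X ?js P"
    by (rule multi_prod_multi_prod[OF X c, where g = nt]) (use U in auto)
  also have "\<dots> = X"
    using X_projection assms by (intro multi_prod_id[OF X]) auto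
  finally show "multi_prod (multi_prod X ?js ?Ut) ?js U = X" .
qed

section \<open>Exactness\<close>

text \<open>Only the end points of the path matter: \<open>X'\<close>, \<open>Y'\<close> are the end points of the path restricted along
  the initial network, from which a run of the integrator deviates; \<open>Mat\<^sub>0(X)\<^sup>T Mat\<^sub>0(Y)\<close> is the invariant that the
  two restrictions share.\<close>

definition integrates_exactly :: "('l \<Rightarrow> nat) \<Rightarrow> ('l ttree \<Rightarrow> nat) \<Rightarrow> real \<Rightarrow> real \<Rightarrow> 'l ttree \<Rightarrow> bool" where
  "integrates_exactly n r t\<^sub>0 t\<^sub>1 \<tau> \<longleftrightarrow> (\<forall>A A' X' Y' y.
      nondegenerate n r \<tau> X' Y' \<longrightarrow> tensor_C1 (vdims n r \<tau>) t\<^sub>0 t\<^sub>1 A A'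
      \<longrightarrow> transpose_mat (Mat 0 (A t\<^sub>1)) * Mat 0 (A t\<^sub>0) = transpose_mat (Mat 0 X') * Mat 0 Y'
      \<longrightarrow> left_invertible (transpose_mat (Mat 0 (A t\<^sub>0)))
      \<longrightarrow> orthonormal_network n r \<tau> y \<longrightarrow> ttn_tensor y = A t\<^sub>0
      \<longrightarrow> (\<exists>y\<^sub>1. ttn_step n r t\<^sub>0 t\<^sub>1 \<tau> (\<lambda>t Y. A' t) y y\<^sub>1)
        \<and> (\<forall>y\<^sub>1. ttn_step n r t\<^sub>0 t\<^sub>1 \<tau> (\<lambda>t Y. A' t) y y\<^sub>1
            \<longrightarrow> root_orthonormal n r \<tau> y\<^sub>1 \<and> ttn_tensor y\<^sub>1 = A t\<^sub>1))"

text \<open>The QR factors are arbitrary, so two things are shown: the subflow has a result, and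
  every result continues the state.\<close>

lemma phi_step:
  fixes n :: "'l \<Rightarrow> nat" and r :: "'l ttree \<Rightarrow> nat"
  assumes st: "node_state n r ts t\<^sub>0 t\<^sub>1 A A' X' Y' (\<lambda>j. basis_mat (zs ! j)) C i"
    and i: "i < length ts" and l: "length zs = length ts"
    and net: "orthonormal_network n r (ts ! i) (zs ! i)"
    and IH: "integrates_exactly n r t\<^sub>0 t\<^sub>1 (ts ! i)"
  shows "\<exists>z'. ttn_phi n r t\<^sub>0 t\<^sub>1 ts i (\<lambda>t Y. A' t) (TNode C zs) z'"
    and "ttn_phi n r t\<^sub>0 t\<^sub>1 ts i (\<lambda>t Y. A' t) (TNode C zs) z' \<Longrightarrow>
      \<exists>C' x. z' = TNode C' (zs[i := x])
        \<and> node_state n r ts t\<^sub>0 t\<^sub>1 A A' X' Y' (\<lambda>j. basis_mat (zs[i := x] ! j)) C' (Suc i)"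
proof -
  interpret st: node_state n r ts t\<^sub>0 t\<^sub>1 A A' X' Y' "\<lambda>j. basis_mat (zs ! j)" C i
    by (rule st)
  let ?M = "transpose_mat (Mat (Suc i) C)"
  let ?B = "\<lambda>Q t. restr n r ts i (frame_mat C zs i Q) (A t)"
  let ?B' = "\<lambda>Q t. restr n r ts i (frame_mat C zs i Q) (A' t)"
  let ?y = "\<lambda>S\<^sub>0. root_prod (zs ! i) (transpose_mat S\<^sub>0)"
  let ?G = "\<lambda>x B. transpose_mat (basis_mat x) * transpose_mat (Mat 0 B)"
  have dimC: "tdims C = st.cdims"
    using st.C by (rule tensor_space_dims)
  have frame: "frame_mat C zs i Q = frame.V r ts (\<lambda>j. basis_mat (zs ! j)) i Q"
    if "is_QR ?M Q (transpose_mat S\<^sub>0)" for Q S\<^sub>0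
  proof -
    interpret node_frame n r ts t\<^sub>0 t\<^sub>1 A A' X' Y' "\<lambda>j. basis_mat (zs ! j)" C i Q S\<^sub>0
      by unfold_locales (use i that in auto)
    show ?thesis
      by (simp add: frame_mat_def V_def T_def dimC l)
  qed
  \<comment> \<open>Stated for every QR decomposition: the existence part picks one, while the other
    part receives one from the given run.\<close>
  have child: "(\<exists>y\<^sub>1. ttn_step n r t\<^sub>0 t\<^sub>1 (ts ! i) (\<lambda>t Y. ?B' Q t) (?y S\<^sub>0) y\<^sub>1)
        \<and> (\<forall>y\<^sub>1. ttn_step n r t\<^sub>0 t\<^sub>1 (ts ! i) (\<lambda>t Y. ?B' Q t) (?y S\<^sub>0) y\<^sub>1
            \<longrightarrow> root_orthonormal n r (ts ! i) y\<^sub>1 \<and> ttn_tensor y\<^sub>1 = ?B Q t\<^sub>1 \<and> left_invertible (basis_mat y\<^sub>1))"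
    and path: "tensor_C1 (vdims n r (ts ! i)) t\<^sub>0 t\<^sub>1 (?B Q) (?B' Q)"
    if QR: "is_QR ?M Q (transpose_mat S\<^sub>0)" for Q S\<^sub>0
  proof -
    interpret node_frame n r ts t\<^sub>0 t\<^sub>1 A A' X' Y' "\<lambda>j. basis_mat (zs ! j)" C i Q S\<^sub>0
      by unfold_locales (use i QR in auto)
    note V = frame[OF QR]
    obtain X\<^sub>i Y\<^sub>i where nd\<^sub>i: "nondegenerate n r (ts ! i) X\<^sub>i Y\<^sub>i"
      and rel: "transpose_mat (Mat 0 (?B Q t\<^sub>1)) * Mat 0 (?B Q t\<^sub>0) = transpose_mat (Mat 0 X\<^sub>i) * Mat 0 Y\<^sub>i"
      and inv: "left_invertible (transpose_mat (Mat 0 (?B Q t\<^sub>1)))" "left_invertible (transpose_mat (Mat 0 (?B Q t\<^sub>0)))"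
      using child_rel unfolding V .
    show path: "tensor_C1 (vdims n r (ts ! i)) t\<^sub>0 t\<^sub>1 (?B Q) (?B' Q)"
      unfolding V by (rule tensor_C1_linear[OF linear_restr[OF i V_carrier] st.A])
    have tS: "transpose_mat S\<^sub>0 \<in> carrier_mat (r (ts ! i)) (r (ts ! i))"
      using S\<^sub>0 by simp
    note y = root_prod_network[OF net tS]
    have x: "ttn_tensor (zs ! i) \<in> tensor_space (vdims n r (ts ! i))"
      using net orthonormal_network_root root_orthonormal_closed by blast
    have Bz: "basis_mat (zs ! i) \<in> carrier_mat (tree_dim n (ts ! i)) (r (ts ! i))"
      using basis_mat_carrier[OF x] .
    have Mx: "Mat 0 (ttn_tensor (zs ! i)) = transpose_mat (basis_mat (zs ! i))"
      by (simp add: basis_mat_def)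
    have "ttn_tensor (?y S\<^sub>0) = ?B Q t\<^sub>0"
    proof (rule Mat_inject)
      show "ttn_tensor (?y S\<^sub>0) \<in> tensor_space (vdims n r (ts ! i))"
        using y(1) orthonormal_network_root root_orthonormal_closed by blast
      show "?B Q t\<^sub>0 \<in> tensor_space (vdims n r (ts ! i))"
        by (rule restr_closed)
      have "Mat 0 (ttn_tensor (?y S\<^sub>0)) = transpose_mat S\<^sub>0 * Mat 0 (ttn_tensor (zs ! i))"
        unfolding y(2) by (rule Mat_mode_prod[OF x]) (use tS in auto)
      also have "\<dots> = transpose_mat (basis_mat (zs ! i) * S\<^sub>0)"
        unfolding Mx by (rule transpose_mult[OF Bz S\<^sub>0, symmetric])
      also have "\<dots> = Mat 0 (?B Q t\<^sub>0)"
        unfolding V Mat_restr[OF i st.Y V_carrier] Mat_Y_V ..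
      finally show "Mat 0 (ttn_tensor (?y S\<^sub>0)) = Mat 0 (?B Q t\<^sub>0)" .
    qed simp
    from IH[unfolded integrates_exactly_def, rule_format, OF nd\<^sub>i path rel inv(2) y(1) this]
    show "(\<exists>y\<^sub>1. ttn_step n r t\<^sub>0 t\<^sub>1 (ts ! i) (\<lambda>t Y. ?B' Q t) (?y S\<^sub>0) y\<^sub>1)
        \<and> (\<forall>y\<^sub>1. ttn_step n r t\<^sub>0 t\<^sub>1 (ts ! i) (\<lambda>t Y. ?B' Q t) (?y S\<^sub>0) y\<^sub>1
            \<longrightarrow> root_orthonormal n r (ts ! i) y\<^sub>1 \<and> ttn_tensor y\<^sub>1 = ?B Q t\<^sub>1 \<and> left_invertible (basis_mat y\<^sub>1))"
      using inv(1) by (metis basis_mat_def)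
  qed
  have ode: "S\<^sub>1 \<in> carrier_mat (r (ts ! i)) (r (ts ! i))"
      "\<exists>S. solves_mat_ode (r (ts ! i)) (\<lambda>t S. - ?G x (?B' Q t)) t\<^sub>0 t\<^sub>1 S\<^sub>1 S"
      "\<And>S. solves_mat_ode (r (ts ! i)) (\<lambda>t S. - ?G x (?B' Q t)) t\<^sub>0 t\<^sub>1 S\<^sub>1 S
        \<Longrightarrow> node_state n r ts t\<^sub>0 t\<^sub>1 A A' X' Y' (\<lambda>j. basis_mat (zs[i := x] ! j))
              (Ten (Suc i) (tdims C) (S t\<^sub>1 * transpose_mat Q)) (Suc i)"
    if QR: "is_QR ?M Q (transpose_mat S\<^sub>0)" and y\<^sub>1: "root_orthonormal n r (ts ! i) y\<^sub>1" "ttn_tensor y\<^sub>1 = ?B Q t\<^sub>1"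
      and x: "root_QR y\<^sub>1 x S\<^sub>1" for Q S\<^sub>0 y\<^sub>1 x S\<^sub>1
  proof -
    interpret node_frame n r ts t\<^sub>0 t\<^sub>1 A A' X' Y' "\<lambda>j. basis_mat (zs ! j)" C i Q S\<^sub>0
      by unfold_locales (use i QR in auto)
    note V = frame[OF QR]
    note Ux = root_QR_basis[OF y\<^sub>1(1) x]
    let ?Ut = "transpose_mat (basis_mat x)"
    have Ut: "?Ut \<in> carrier_mat (r (ts ! i)) (tree_dim n (ts ! i))"
      using Ux(1) by simp
    have G: "?G x B \<in> carrier_mat (r (ts ! i)) (r (ts ! i))" if "B \<in> tensor_space (vdims n r (ts ! i))" for B
      using Ut Mat_0_vdims_carrier[OF that] by simp
    note lin = linear_form_mult_transpose_Mat[where \<tau> = "ts ! i", OF Ut]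
    show S\<^sub>1: "S\<^sub>1 \<in> carrier_mat (r (ts ! i)) (r (ts ! i))"
      by (rule Ux(3))
    show "\<exists>S. solves_mat_ode (r (ts ! i)) (\<lambda>t S. - ?G x (?B' Q t)) t\<^sub>0 t\<^sub>1 S\<^sub>1 S"
      by (rule constant_mat_ode_exists[OF st.t01 path[OF QR] G lin S\<^sub>1])
    have X\<^sub>i: "transpose_mat (Mat 0 (?B Q t\<^sub>1)) = basis_mat x * S\<^sub>1"
      using Ux(4) y\<^sub>1(2) by (simp add: basis_mat_def)
    have GX: "?G x (?B Q t\<^sub>1) = S\<^sub>1"
      unfolding X\<^sub>i by (rule mult_mat_cancel[OF Ut Ux(1) Ux(3) Ux(2)])
    have GY: "?G x (?B Q t\<^sub>0) = ?Ut * (basis_mat (zs ! i) * S\<^sub>0)"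
      unfolding V Mat_restr[OF i st.Y V_carrier] Mat_Y_V by simp
    have c: "?Ut * (basis_mat (zs ! i) * S\<^sub>0) \<in> carrier_mat (r (ts ! i)) (r (ts ! i))"
      using Ut US by simp
    fix S assume S: "solves_mat_ode (r (ts ! i)) (\<lambda>t S. - ?G x (?B' Q t)) t\<^sub>0 t\<^sub>1 S\<^sub>1 S"
    \<comment> \<open>The end of the path contributes exactly the initial value
      \<open>S\<^sub>1\<close>, which cancels; what the new basis sees of the starting value
      survives.\<close>
    have "S t\<^sub>1 = S\<^sub>1 - (S\<^sub>1 - ?Ut * (basis_mat (zs ! i) * S\<^sub>0))"
      using constant_mat_ode_unique[OF st.t01 path[OF QR] G lin S] unfolding GX GY .
    also have "\<dots> = ?Ut * (basis_mat (zs ! i) * S\<^sub>0)"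
      by (rule eq_matI) (use S\<^sub>1 c in auto)
    finally have S1: "S t\<^sub>1 = ?Ut * (basis_mat (zs ! i) * S\<^sub>0)" .
    have "(\<lambda>j. basis_mat (zs[i := x] ! j)) = (\<lambda>j. basis_mat (zs ! j))(i := basis_mat x)"
      using i l by auto
    then show "node_state n r ts t\<^sub>0 t\<^sub>1 A A' X' Y' (\<lambda>j. basis_mat (zs[i := x] ! j))
              (Ten (Suc i) (tdims C) (S t\<^sub>1 * transpose_mat Q)) (Suc i)"
      using next_state[OF Ux(1,2) S\<^sub>1] X\<^sub>i unfolding V S1 dimC by simp
  qed
  \<comment> \<open>The field ignores its argument, so the prolongation drops out and the restricted
    field is again a function of time.\<close>
  have F\<^sub>i: "(\<lambda>t Y. ?B' Q t) = (\<lambda>t. restr n r ts i (frame_mat C zs i Q) \<circ> (\<lambda>Y. A' t) \<circ> prolong n r ts i (frame_mat C zs i Q))" for Q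
    by (simp add: fun_eq_iff)
  {
    obtain Q R where "is_QR ?M Q R"
      using QR_exists[OF st.core_left_invertible[OF i]] by blast
    then have QR: "is_QR ?M Q (transpose_mat (transpose_mat R))"
      by simp
    obtain y\<^sub>1 where y\<^sub>1: "ttn_step n r t\<^sub>0 t\<^sub>1 (ts ! i) (\<lambda>t Y. ?B' Q t) (?y (transpose_mat R)) y\<^sub>1"
      and y\<^sub>1': "root_orthonormal n r (ts ! i) y\<^sub>1" "ttn_tensor y\<^sub>1 = ?B Q t\<^sub>1" "left_invertible (basis_mat y\<^sub>1)"
      using child[OF QR] by blast
    obtain x S\<^sub>1 where x: "root_QR y\<^sub>1 x S\<^sub>1"
      using root_QR_exists[OF y\<^sub>1'(1,3)] by blast
    obtain S where S: "solves_mat_ode (r (ts ! i)) (\<lambda>t S. - ?G x (?B' Q t)) t\<^sub>0 t\<^sub>1 S\<^sub>1 S"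
      using ode(2)[OF QR y\<^sub>1'(1,2) x] by blast
    show "\<exists>z'. ttn_phi n r t\<^sub>0 t\<^sub>1 ts i (\<lambda>t Y. A' t) (TNode C zs) z'"
      by (rule exI, rule phi[OF QR refl F\<^sub>i y\<^sub>1 x S])
  }
  assume "ttn_phi n r t\<^sub>0 t\<^sub>1 ts i (\<lambda>t Y. A' t) (TNode C zs) z'"
  then show "\<exists>C' x. z' = TNode C' (zs[i := x])
      \<and> node_state n r ts t\<^sub>0 t\<^sub>1 A A' X' Y' (\<lambda>j. basis_mat (zs[i := x] ! j)) C' (Suc i)"
  proof (cases rule: ttn_phi.cases)
    case (phi Q S\<^sub>0 V F\<^sub>i y x S\<^sub>1 S)
    have F: "F\<^sub>i = (\<lambda>t Y. ?B' Q t)"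
      unfolding phi(3) phi(4) F\<^sub>i ..
    note y = phi(5)[unfolded F]
    have y': "root_orthonormal n r (ts ! i) y" "ttn_tensor y = ?B Q t\<^sub>1"
      using child[OF phi(2)] y by blast+
    show ?thesis
      using ode(3)[OF phi(2) y' phi(6) phi(7)[unfolded F]] phi(1) by blast
  qed
qed

inductive_cases ttn_step_LeafE: "ttn_step n r t\<^sub>0 t\<^sub>1 (Leaf l) F y y\<^sub>1"
inductive_cases ttn_step_NodeE: "ttn_step n r t\<^sub>0 t\<^sub>1 (Node ts) F y y\<^sub>1"
inductive_cases ttn_psiE: "ttn_psi r t\<^sub>0 t\<^sub>1 ts F (TNode C xs) y\<^sub>1"

text \<open>The core equation integrates the path contracted with the new bases, and
  \<open>final_core\<close> places the current core at its start.\<close>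

lemma psi_step:
  assumes st: "node_state n r ts t\<^sub>0 t\<^sub>1 A A' X' Y' (\<lambda>j. basis_mat (zs ! j)) C (length ts)"
    and l: "length zs = length ts"
  shows "\<exists>y\<^sub>1. ttn_psi r t\<^sub>0 t\<^sub>1 ts (\<lambda>t Y. A' t) (TNode C zs) y\<^sub>1"
    and "ttn_psi r t\<^sub>0 t\<^sub>1 ts (\<lambda>t Y. A' t) (TNode C zs) y\<^sub>1 \<Longrightarrow>
      root_orthonormal n r (Node ts) y\<^sub>1 \<and> ttn_tensor y\<^sub>1 = A t\<^sub>1"
proof -
  interpret node_state n r ts t\<^sub>0 t\<^sub>1 A A' X' Y' "\<lambda>j. basis_mat (zs ! j)" C "length ts"
    by (rule st)
  let ?L = "\<lambda>Z. multi_prod Z [0..<length ts] (\<lambda>j. transpose_mat (basis_mat (zs ! j)))"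
  have "multi_compat dims [0..<length ts] rt (\<lambda>j. transpose_mat (basis_mat (zs ! j)))"
    by (rule compat_transpose) auto
  from linear_multi_prod[OF this]
  have path: "tensor_C1 cdims t\<^sub>0 t\<^sub>1 (\<lambda>t. ?L (A t)) (\<lambda>t. ?L (A' t))"
    unfolding upd_dims_ndims using A by (rule tensor_C1_linear)
  note fin = final_core[OF refl]
  have "solves_tensor_ode cdims (\<lambda>t B. ?L (A' t)) t\<^sub>0 t\<^sub>1 C (\<lambda>t. ?L (A t))"
    using solves_constant_tensor_ode[OF path] fin(1) by simp
  then have "ttn_psi r t\<^sub>0 t\<^sub>1 ts (\<lambda>t Y. A' t) (TNode C zs) (TNode (?L (A t\<^sub>1)) zs)"
    using l by (intro ttn_psi.intros[where C = "\<lambda>t. ?L (A t)"]) simp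
  then show "\<exists>y\<^sub>1. ttn_psi r t\<^sub>0 t\<^sub>1 ts (\<lambda>t Y. A' t) (TNode C zs) y\<^sub>1"
    by blast
  assume "ttn_psi r t\<^sub>0 t\<^sub>1 ts (\<lambda>t Y. A' t) (TNode C zs) y\<^sub>1"
  then obtain D where D: "solves_tensor_ode cdims (\<lambda>t B. ?L (A' t)) t\<^sub>0 t\<^sub>1 C D" and y\<^sub>1: "y\<^sub>1 = TNode (D t\<^sub>1) zs"
    by (elim ttn_psiE) (auto simp: l)
  have "D t\<^sub>1 = ?L (A t\<^sub>1)"
    using constant_tensor_ode_unique[OF t01 path] D fin(1) by simp
  then have "ttn_tensor y\<^sub>1 = A t\<^sub>1"
    using fin(2) l by (simp add: y\<^sub>1 ttn_tensor_TNode)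
  moreover have "D t\<^sub>1 \<in> tensor_space cdims"
    using D t01 by (simp add: solves_tensor_ode_def)
  ultimately show "root_orthonormal n r (Node ts) y\<^sub>1 \<and> ttn_tensor y\<^sub>1 = A t\<^sub>1"
    using y\<^sub>1 l orthonormal_node_bases_axioms by simp
qed

section \<open>Runs as sequences of states, and the induction on the tree\<close>

lemma invariant_sequence:
  assumes "Inv 0 y" and ex: "\<And>i z. i < m \<Longrightarrow> Inv i z \<Longrightarrow> \<exists>z'. R i z z'"
    and inv: "\<And>i z z'. i < m \<Longrightarrow> Inv i z \<Longrightarrow> R i z z' \<Longrightarrow> Inv (Suc i) z'"
  obtains f where "f 0 = y" "\<forall>i < m. R i (f i) (f (Suc i))" "Inv m (f m)"
proof -
  \<comment> \<open>The rule for a node asks for all intermediate networks as one function. Choice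
    builds it, and the invariant guarantees at each step that there is something to choose.\<close>
  define f where "f = rec_nat y (\<lambda>i z. SOME z'. R i z z')"
  have R: "R i (f i) (f (Suc i))" if "i < m" "Inv i (f i)" for i
    using someI_ex[OF ex[OF that]] by (simp add: f_def)
  have "i \<le> m \<Longrightarrow> Inv i (f i)" for i
  proof (induction i)
    case (Suc i)
    then show ?case
      using R inv by (meson Suc_le_lessD less_imp_le_nat)
  qed (use assms in \<open>simp add: f_def\<close>)
  then show thesis
    using that[of f] R by (simp add: f_def)
qed

lemma invariant_along:
  assumes "Inv 0 (f 0)" "\<forall>i < m. R i (f i) (f (Suc i))"
    and inv: "\<And>i z z'. i < m \<Longrightarrow> Inv i z \<Longrightarrow> R i z z' \<Longrightarrow> Inv (Suc i) z'"
  shows "Inv m (f m)"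
proof -
  have "i \<le> m \<Longrightarrow> Inv i (f i)" for i
    using assms by (induction i) (auto simp: Suc_le_eq)
  then show ?thesis
    by simp
qed

lemma leaf_exact:
  assumes t01: "t\<^sub>0 < t\<^sub>1"
    and nd: "nondegenerate n r (Leaf l) X' Y'" and path: "tensor_C1 (vdims n r (Leaf l)) t\<^sub>0 t\<^sub>1 A A'"
    and rel: "transpose_mat (Mat 0 (A t\<^sub>1)) * Mat 0 (A t\<^sub>0) = transpose_mat (Mat 0 X') * Mat 0 Y'"
    and inv: "left_invertible (transpose_mat (Mat 0 (A t\<^sub>0)))"
    and net: "orthonormal_network n r (Leaf l) y" and init: "ttn_tensor y = A t\<^sub>0"
  shows "(\<exists>y\<^sub>1. ttn_step n r t\<^sub>0 t\<^sub>1 (Leaf l) (\<lambda>t Y. A' t) y y\<^sub>1)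
      \<and> (\<forall>y\<^sub>1. ttn_step n r t\<^sub>0 t\<^sub>1 (Leaf l) (\<lambda>t Y. A' t) y y\<^sub>1
          \<longrightarrow> root_orthonormal n r (Leaf l) y\<^sub>1 \<and> ttn_tensor y\<^sub>1 = A t\<^sub>1)"
proof -
  from net obtain U where U: "y = TLeaf U"
    by cases auto
  have mem: "A t\<^sub>1 \<in> tensor_space (vdims n r (Leaf l))"
    using path t01 by (simp add: tensor_C1_def)
  have M: "Mat 0 (A t\<^sub>1) \<in> carrier_mat (r (Leaf l)) (n l)"
    using Mat_0_vdims_carrier[OF mem] by simp
  have sol: "solves_tensor_ode (vdims n r (Leaf l)) (\<lambda>t Y. A' t) t\<^sub>0 t\<^sub>1 (ttn_tensor (TLeaf U)) A"
    using solves_constant_tensor_ode[OF path] init U by simp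
  have "root_orthonormal n r (Leaf l) y\<^sub>1 \<and> ttn_tensor y\<^sub>1 = A t\<^sub>1"
    if "ttn_step n r t\<^sub>0 t\<^sub>1 (Leaf l) (\<lambda>t Y. A' t) y y\<^sub>1" for y\<^sub>1
  proof -
    from that obtain U' Y where *: "y = TLeaf U'" "y\<^sub>1 = TLeaf (transpose_mat (Mat 0 (Y t\<^sub>1)))"
      "solves_tensor_ode [r (Leaf l), n l] (\<lambda>t Y. A' t) t\<^sub>0 t\<^sub>1 (Ten 0 [dim_col U', dim_row U'] (transpose_mat U')) Y"
      by (rule ttn_step_LeafE)
    have "solves_tensor_ode (vdims n r (Leaf l)) (\<lambda>t Y. A' t) t\<^sub>0 t\<^sub>1 (A t\<^sub>0) Y"
      using *(3) init *(1) by simp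
    then have "Y t\<^sub>1 = A t\<^sub>1"
      using constant_tensor_ode_unique[OF t01 path] by blast
    then show ?thesis
      using *(2) M Ten_Mat[OF mem, of 0] by simp
  qed
  then show ?thesis
    using ttn_step_ttn_phi.step_leaf[OF sol] U by blast
qed

lemma node_exact:
  assumes t01: "t\<^sub>0 < t\<^sub>1" and IH: "\<And>\<tau>. \<tau> \<in> set ts \<Longrightarrow> integrates_exactly n r t\<^sub>0 t\<^sub>1 \<tau>"
    and nd: "nondegenerate n r (Node ts) X' Y'" and path: "tensor_C1 (vdims n r (Node ts)) t\<^sub>0 t\<^sub>1 A A'"
    and rel: "transpose_mat (Mat 0 (A t\<^sub>1)) * Mat 0 (A t\<^sub>0) = transpose_mat (Mat 0 X') * Mat 0 Y'"
    and inv: "left_invertible (transpose_mat (Mat 0 (A t\<^sub>0)))"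
    and net: "orthonormal_network n r (Node ts) y" and init: "ttn_tensor y = A t\<^sub>0"
  shows "(\<exists>y\<^sub>1. ttn_step n r t\<^sub>0 t\<^sub>1 (Node ts) (\<lambda>t Y. A' t) y y\<^sub>1)
      \<and> (\<forall>y\<^sub>1. ttn_step n r t\<^sub>0 t\<^sub>1 (Node ts) (\<lambda>t Y. A' t) y y\<^sub>1
          \<longrightarrow> root_orthonormal n r (Node ts) y\<^sub>1 \<and> ttn_tensor y\<^sub>1 = A t\<^sub>1)"
proof -
  from net obtain C\<^sub>0 xs where y: "y = TNode C\<^sub>0 xs" and C\<^sub>0: "C\<^sub>0 \<in> tensor_space (r (Node ts) # map r ts)"
    and nets: "list_all2 (orthonormal_network n r) ts xs"
    by cases auto
  have root: "length xs = length ts" "orthonormal_node_bases n r ts (\<lambda>j. basis_mat (xs ! j))"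
    using orthonormal_network_root[OF net] y by auto
  \<comment> \<open>Subtrees not yet treated keep their original networks: the recursive call
    requires \<open>orthonormal_network\<close> there, while \<open>node_state\<close> records the
    bases alone.\<close>
  define Inv where "Inv i z \<longleftrightarrow> (\<exists>C zs. z = TNode C zs \<and> length zs = length ts
      \<and> (\<forall>j < length ts. i \<le> j \<longrightarrow> zs ! j = xs ! j)
      \<and> node_state n r ts t\<^sub>0 t\<^sub>1 A A' X' Y' (\<lambda>j. basis_mat (zs ! j)) C i)" for i z
  have node: "node_path n r ts t\<^sub>0 t\<^sub>1 A A' X' Y'"
    using t01 nd path rel inv by unfold_locales
  have "node_state n r ts t\<^sub>0 t\<^sub>1 A A' X' Y' (\<lambda>j. basis_mat (xs ! j)) C\<^sub>0 0"
  proof -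
    interpret node_path n r ts t\<^sub>0 t\<^sub>1 A A' X' Y'
      by (rule node)
    interpret orthonormal_node_bases n r ts "\<lambda>j. basis_mat (xs ! j)"
      by (rule root(2))
    show ?thesis
      by unfold_locales (use C\<^sub>0 init y root(1) in \<open>auto simp: ttn_tensor_TNode\<close>)
  qed
  then have Inv0: "Inv 0 y"
    using y root(1) by (auto simp: Inv_def)
  have step: "\<exists>z'. ttn_phi n r t\<^sub>0 t\<^sub>1 ts i (\<lambda>t Y. A' t) z z'"
      "ttn_phi n r t\<^sub>0 t\<^sub>1 ts i (\<lambda>t Y. A' t) z z' \<Longrightarrow> Inv (Suc i) z'"
    if i: "i < length ts" and "Inv i z" for i z z'
  proof -
    from \<open>Inv i z\<close> obtain C zs where z: "z = TNode C zs" "length zs = length ts"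
      and zs: "\<And>j. j < length ts \<Longrightarrow> i \<le> j \<Longrightarrow> zs ! j = xs ! j"
      and st: "node_state n r ts t\<^sub>0 t\<^sub>1 A A' X' Y' (\<lambda>j. basis_mat (zs ! j)) C i"
      unfolding Inv_def by blast
    have net_i: "orthonormal_network n r (ts ! i) (zs ! i)"
      using zs[OF i order_refl] nets i by (simp add: list_all2_conv_all_nth)
    note phi = phi_step[OF st i z(2) net_i IH[OF nth_mem[OF i]]]
    show "\<exists>z'. ttn_phi n r t\<^sub>0 t\<^sub>1 ts i (\<lambda>t Y. A' t) z z'"
      unfolding z(1) by (rule phi(1))
    assume "ttn_phi n r t\<^sub>0 t\<^sub>1 ts i (\<lambda>t Y. A' t) z z'"
    from phi(2)[OF this[unfolded z(1)]]
    obtain C' x where "z' = TNode C' (zs[i := x])"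
      "node_state n r ts t\<^sub>0 t\<^sub>1 A A' X' Y' (\<lambda>j. basis_mat (zs[i := x] ! j)) C' (Suc i)"
      by blast
    then show "Inv (Suc i) z'"
      using z(2) zs unfolding Inv_def by (intro exI[of _ C'] exI[of _ "zs[i := x]"]) auto
  qed
  have final: "\<exists>y\<^sub>1. ttn_psi r t\<^sub>0 t\<^sub>1 ts (\<lambda>t Y. A' t) z y\<^sub>1"
    "ttn_psi r t\<^sub>0 t\<^sub>1 ts (\<lambda>t Y. A' t) z y\<^sub>1 \<Longrightarrow> root_orthonormal n r (Node ts) y\<^sub>1 \<and> ttn_tensor y\<^sub>1 = A t\<^sub>1"
    if "Inv (length ts) z" for z y\<^sub>1
  proof -
    from that obtain C zs where z: "z = TNode C zs" "length zs = length ts"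
      and st: "node_state n r ts t\<^sub>0 t\<^sub>1 A A' X' Y' (\<lambda>j. basis_mat (zs ! j)) C (length ts)"
      unfolding Inv_def by blast
    show "\<exists>y\<^sub>1. ttn_psi r t\<^sub>0 t\<^sub>1 ts (\<lambda>t Y. A' t) z y\<^sub>1"
      unfolding z(1) by (rule psi_step(1)[OF st z(2)])
    assume "ttn_psi r t\<^sub>0 t\<^sub>1 ts (\<lambda>t Y. A' t) z y\<^sub>1"
    then show "root_orthonormal n r (Node ts) y\<^sub>1 \<and> ttn_tensor y\<^sub>1 = A t\<^sub>1"
      unfolding z(1) by (rule psi_step(2)[OF st z(2)])
  qed
  obtain f where f: "f 0 = y" "\<forall>i < length ts. ttn_phi n r t\<^sub>0 t\<^sub>1 ts i (\<lambda>t Y. A' t) (f i) (f (Suc i))"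
    "Inv (length ts) (f (length ts))"
    by (rule invariant_sequence[of Inv y "length ts" "\<lambda>i. ttn_phi n r t\<^sub>0 t\<^sub>1 ts i (\<lambda>t Y. A' t)", OF Inv0 step])
  obtain y\<^sub>1 where "ttn_psi r t\<^sub>0 t\<^sub>1 ts (\<lambda>t Y. A' t) (f (length ts)) y\<^sub>1"
    using final(1)[OF f(3)] by blast
  then have "ttn_step n r t\<^sub>0 t\<^sub>1 (Node ts) (\<lambda>t Y. A' t) y y\<^sub>1"
    using ttn_step_ttn_phi.step_node[OF f(2)] f(1) by simp
  moreover have "root_orthonormal n r (Node ts) y\<^sub>1 \<and> ttn_tensor y\<^sub>1 = A t\<^sub>1"
    if "ttn_step n r t\<^sub>0 t\<^sub>1 (Node ts) (\<lambda>t Y. A' t) y y\<^sub>1" for y\<^sub>1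
  proof -
    from that obtain g where g: "y = g 0" "\<forall>i < length ts. ttn_phi n r t\<^sub>0 t\<^sub>1 ts i (\<lambda>t Y. A' t) (g i) (g (Suc i))"
      "ttn_psi r t\<^sub>0 t\<^sub>1 ts (\<lambda>t Y. A' t) (g (length ts)) y\<^sub>1"
      by (rule ttn_step_NodeE)
    have "Inv (length ts) (g (length ts))"
      using g Inv0 step(2)
      by (intro invariant_along[of Inv g "length ts" "\<lambda>i. ttn_phi n r t\<^sub>0 t\<^sub>1 ts i (\<lambda>t Y. A' t)"]) auto
    then show ?thesis
      using final(2) g(3) by blast
  qed
  ultimately show ?thesis
    by blast
qed

theorem integrator_exact:
  assumes "t\<^sub>0 < t\<^sub>1"
  shows "integrates_exactly n r t\<^sub>0 t\<^sub>1 \<tau>"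
proof (induction \<tau>)
  case (Leaf l)
  show ?case
    unfolding integrates_exactly_def
    by (intro allI impI leaf_exact[OF assms])
next
  case (Node ts)
  show ?case
    unfolding integrates_exactly_def
    by (intro allI impI node_exact[OF assms Node.IH])
qed

lemma subtrees_self: "\<tau> \<in> subtrees \<tau>"
  by (cases \<tau>) auto

lemma subtrees_trans: "\<sigma> \<in> subtrees \<tau> \<Longrightarrow> \<tau> \<in> subtrees \<rho> \<Longrightarrow> \<sigma> \<in> subtrees \<rho>"
  by (induction \<rho>) auto

text \<open>Full tree rank at \<open>t\<^sub>1\<close> yields the mode factorizations and the full
  rank of the end point; the frames of the initial networks span the row spaces at
  \<open>t\<^sub>0\<close>.\<close>

lemma restricted_tensors_nondegenerate:
  assumes "t\<^sub>0 \<le> t\<^sub>1" and R: "restricted_tensors n r \<tau>\<^sub>r t\<^sub>0 t\<^sub>1 A Y0 Ar"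
    and full: "\<forall>\<tau> \<in> subtrees \<tau>\<^sub>r. Ar \<tau> t\<^sub>1 \<in> ttn_manifold n r \<tau>"
  shows "\<tau> \<in> subtrees \<tau>\<^sub>r \<Longrightarrow> orthonormal_rep n r \<tau> (Y0 \<tau>) (Ar \<tau> t\<^sub>0)
    \<Longrightarrow> nondegenerate n r \<tau> (Ar \<tau> t\<^sub>1) (Ar \<tau> t\<^sub>0)"
proof (induction \<tau>)
  case (Leaf l)
  obtain x where "full_rank_ttn n r (Leaf l) x" "ttn_tensor x = Ar (Leaf l) t\<^sub>1"
    using full Leaf.prems(1) by (auto simp: ttn_manifold_def)
  with Leaf.prems(2) show ?case
    using full_rank_ttn_basis unfolding orthonormal_rep_def basis_mat_def
    by (metis nondegenerate_Leaf)
next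
  case (Node ts)
  let ?X = "Ar (Node ts) t\<^sub>1" and ?Y = "Ar (Node ts) t\<^sub>0"
  obtain x where x: "full_rank_ttn n r (Node ts) x" "ttn_tensor x = ?X"
    using full Node.prems(1) unfolding ttn_manifold_def by fastforce
  have Y0: "full_rank_ttn n r (Node ts) (Y0 (Node ts))" "orthonormal_ttn (Y0 (Node ts))" "ttn_tensor (Y0 (Node ts)) = ?Y"
    using Node.prems(2) by (auto simp: orthonormal_rep_def)
  note bX = full_rank_ttn_basis[OF x(1)] and bY = full_rank_ttn_basis[OF Y0(1)]
  show ?case
  proof (rule nondegenerate_Node)
    show "?X \<in> tensor_space (vdims n r (Node ts))" "?Y \<in> tensor_space (vdims n r (Node ts))"
      using bX bY x Y0 by auto
    show "left_invertible (transpose_mat (Mat 0 ?X))" "left_invertible (transpose_mat (Mat 0 ?Y))"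
      using bX bY x Y0 by (auto simp: basis_mat_def)
    fix i assume i: "i < length ts"
    from x(1) obtain C xs where xC: "x = TNode C xs" "C \<in> tensor_space (r (Node ts) # map r ts)"
      "list_all2 (full_rank_ttn n r) ts xs"
      by cases auto
    have "full_rank_ttn n r (ts ! j) (xs ! j)" if "j < length ts" for j
      using xC(3) that by (simp add: list_all2_conv_all_nth)
    then interpret X: node_bases n r ts "\<lambda>j. basis_mat (xs ! j)"
      using full_rank_ttn_basis basis_mat_carrier by unfold_locales blast
    \<comment> \<open>Taking the basis of subtree \<open>i\<close> as the outermost factor exhibits
      the bound on the rank in that mode.\<close>
    have "ttn_tensor x = mode_prod (multi_prod C (X.others i) (\<lambda>j. basis_mat (xs ! j))) (Suc i) (basis_mat (xs ! i))"
      using X.node_tensor_remove(1)[OF xC(2) i] xC by (auto simp: ttn_tensor_TNode dest: list_all2_lengthD)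
    then show "\<exists>Z M. Z \<in> tensor_space ((vdims n r (Node ts))[Suc i := r (ts ! i)])
        \<and> M \<in> carrier_mat (tree_dim n (ts ! i)) (r (ts ! i)) \<and> ?X = mode_prod Z (Suc i) M"
      using X.node_tensor_remove(2)[OF xC(2) i] X.U[OF i] x(2) by metis
    obtain C xs Q S where Y0C: "Y0 (Node ts) = TNode C xs"
      and QR: "is_QR (transpose_mat (Mat (Suc i) C)) Q (transpose_mat S)"
      and rep: "orthonormal_rep n r (ts ! i) (Y0 (ts ! i))
                 (restr n r ts i (frame_mat C xs i Q) (ttn_tensor (Y0 (Node ts))))"
      and Ar: "\<forall>t \<in> {t\<^sub>0..t\<^sub>1}. Ar (ts ! i) t = restr n r ts i (frame_mat C xs i Q) (Ar (Node ts) t)"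
      using R i Node.prems(1) unfolding restricted_tensors_def by blast
    have root: "C \<in> tensor_space (r (Node ts) # map r ts)" "length xs = length ts"
      "orthonormal_node_bases n r ts (\<lambda>j. basis_mat (xs ! j))"
      using orthonormal_network_root[OF full_rank_orthonormal_network[OF Y0(1,2)]] Y0C by auto
    interpret orthonormal_node_bases n r ts "\<lambda>j. basis_mat (xs ! j)"
      by (rule root(3))
    interpret QR_frame n r ts "\<lambda>j. basis_mat (xs ! j)" C i Q S
      by unfold_locales (use root QR i in auto)
    have V: "frame_mat C xs i Q = V"
      by (simp add: frame_mat_def V_def T_def tensor_space_dims[OF root(1)] root(2))
    have Y: "?Y = network"
      using Y0(3) Y0C root(2) by (simp add: ttn_tensor_TNode)
    \<comment> \<open>The induction descends the tree while staying among the subtrees of the root,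
      for which the rank condition is given.\<close>
    have "ts ! i \<in> subtrees (Node ts)"
      using i subtrees_self[of "ts ! i"] by auto
    then have "ts ! i \<in> subtrees \<tau>\<^sub>r"
      using Node.prems(1) subtrees_trans by blast
    then have "nondegenerate n r (ts ! i) (Ar (ts ! i) t\<^sub>1) (Ar (ts ! i) t\<^sub>0)"
      using rep Ar Y0(3) assms(1) i by (intro Node.IH) auto
    then have "nondegenerate n r (ts ! i) (restr n r ts i V ?X) (restr n r ts i V ?Y)"
      using Ar assms(1) unfolding V by simp
    then show "\<exists>V \<in> carrier_mat (prod_list (del_nth (Suc i) (vdims n r (Node ts)))) (r (ts ! i)).
        Mat (Suc i) ?Y * V * transpose_mat V = Mat (Suc i) ?Y
        \<and> nondegenerate n r (ts ! i) (restr n r ts i V ?X) (restr n r ts i V ?Y)"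
      using Mat_Yc_VV V_carrier unfolding Y by blast
  qed
qed

theorem theorem5p1:
  fixes \<tau>\<^sub>r :: "'l ttree" and n :: "'l \<Rightarrow> nat" and r :: "'l ttree \<Rightarrow> nat"
    and t\<^sub>0 t\<^sub>1 :: real and A A' :: "real \<Rightarrow> tensor"
    and Y0 :: "'l ttree \<Rightarrow> ttn" and Ar :: "'l ttree \<Rightarrow> real \<Rightarrow> tensor"
    and y\<^sub>0 :: ttn
  assumes "valid_tree \<tau>\<^sub>r"
    and "\<forall>l \<in> leaves \<tau>\<^sub>r. r (Leaf l) \<le> n l"
    and "r \<tau>\<^sub>r = 1"
    and "t\<^sub>0 < t\<^sub>1"
    and "tensor_C1 (vdims n r \<tau>\<^sub>r) t\<^sub>0 t\<^sub>1 A A'"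
    and "\<forall>t \<in> {t\<^sub>0..t\<^sub>1}. A t \<in> ttn_manifold n r \<tau>\<^sub>r"
    and "restricted_tensors n r \<tau>\<^sub>r t\<^sub>0 t\<^sub>1 A Y0 Ar"
    and "\<forall>\<tau> \<in> subtrees \<tau>\<^sub>r. Ar \<tau> t\<^sub>1 \<in> ttn_manifold n r \<tau>"
    and "orthonormal_rep n r \<tau>\<^sub>r y\<^sub>0 (A t\<^sub>0)"
  shows "(\<exists>y\<^sub>1. ttn_step n r t\<^sub>0 t\<^sub>1 \<tau>\<^sub>r (\<lambda>t Y. A' t) y\<^sub>0 y\<^sub>1)
       \<and> (\<forall>y\<^sub>1. ttn_step n r t\<^sub>0 t\<^sub>1 \<tau>\<^sub>r (\<lambda>t Y. A' t) y\<^sub>0 y\<^sub>1 \<longrightarrow> ttn_tensor y\<^sub>1 = A t\<^sub>1)"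
proof -
  have ends: "Ar \<tau>\<^sub>r t\<^sub>0 = A t\<^sub>0" "Ar \<tau>\<^sub>r t\<^sub>1 = A t\<^sub>1" "orthonormal_rep n r \<tau>\<^sub>r (Y0 \<tau>\<^sub>r) (A t\<^sub>0)"
    using assms(4,7) by (auto simp: restricted_tensors_def)
  then have nd: "nondegenerate n r \<tau>\<^sub>r (A t\<^sub>1) (A t\<^sub>0)"
    using restricted_tensors_nondegenerate[OF less_imp_le[OF assms(4)] assms(7,8) subtrees_self] by simp
  have "orthonormal_network n r \<tau>\<^sub>r y\<^sub>0" "ttn_tensor y\<^sub>0 = A t\<^sub>0"
    using assms(9) full_rank_orthonormal_network by (auto simp: orthonormal_rep_def)
  \<comment> \<open>At the root the end points of the path are their own reference pair, so the
    equation between the contractions is reflexivity.\<close>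
  then show ?thesis
    using integrator_exact[OF assms(4), unfolded integrates_exactly_def, rule_format,
        OF nd assms(5) refl nondegenerateD(4)[OF nd]] by blast
qed

end
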